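(* Let $(\mathscr X,\mathcal X)$ be a measurable space, $n\ge 2$, and let $\mathscr M$ be a countable set of probability distributions on $(\mathscr X,\mathcal X)$, dominated by a $\sigma$-finite measure, whose $\rho$-dimension function is uniformly bounded by a non-decreasing function $m\mapsto D_m(\mathscr M)\ge 1$. Let $X_1,\dots,X_n$ be arbitrary (possibly dependent, not necessarily identically distributed) random variables with values in $(\mathscr X,\mathcal X)$, with marginal distributions $P_i=\mathcal L(X_i)$, and let $\mathbf P^*=\mathcal L(X_1,\dots,X_n)$. Then for every $s\in\{0,1,\dots,\lfloor (n-2)/2\rfloor\}$ the estimator $\hat P_s=\hat P_s(\mathbf X,\mathscr M)$ satisfies $$\mathbb E_{\mathbf P^*}\Big[\frac1n\sum_{i=1}^n h^2(P_i,\hat P_s)\Big]\le \frac{c_0}{n}\inf_{Q\in\mathscr M}\sum_{i=1}^n h^2(P_i,Q)+c_1\frac{s+1}{n}\big[17+D_{n(s,1)}(\mathscr M)\big]+\frac{c_2}{n}\sum_{b=1}^{s+1}\mathbf K\big(\mathbf P^*_{s,b}\,\|\,\mathbf P^{ind}_{s,b}\big),$$ where $c_0=602$, $c_1=20056/4.7$ and $c_2=30084$.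
   Context: Notation. $h$ is the Hellinger distance, $h^2(P,Q)=\frac12\int(\sqrt{dP/d\mu}-\sqrt{dQ/d\mu})^2d\mu$ ($\mu$ any dominating measure). $\mathbf K(Q\|P)=\int\log(dQ/dP)\,dQ$ if $Q\ll P$ and $+\infty$ otherwise. $\mathcal L(X)$ is the law of $X$, $[k]=\{1,\dots,k\}$, $\mathscr P_X$ is the set of all probability distributions on $(\mathscr X,\mathcal X)$. $\rho$-estimators. $\mathscr M\subset\mathscr P_X$ is non-empty, countable, and represented by a set $\mathcal M$ of densities with respect to a $\sigma$-finite measure $\mu$. Let $\psi(x)=\frac{x-1}{x+1}$ on $[0,+\infty]$ ($\psi(+\infty)=1$). For $m\ge1$, $\mathbf x\in\mathscr X^m$, $q,q'\in\mathcal M$, put $\mathbf T_m(\mathbf x,q,q')=\sum_{i=1}^m\psi\big(\sqrt{q'(x_i)/q(x_i)}\big)$ (with $0/0=1$, $a/0=+\infty$ for $a>0$), $\mathbf\Upsilon_m(\mathbf x,q)=\sup_{q'\in\mathcal M}\mathbf T_m(\mathbf x,q,q')$ and $\mathscr E_m(\mathbf x)=\{q\cdot\mu: q\in\mathcal M,\ \mathbf\Upsilon_m(\mathbf x,q)<\inf_{q'\in\mathcal M}\mathbf\Upsilon_m(\mathbf x,q')+11.36\}$. A $\rho$-estimator $\hat P(m,\mathbf X,\mathscr M)$ is any measurable element of the closure of $\mathscr E_m(\mathbf X)$ for the Hellinger distance. Blocks and estimator $\hat P_s$. For $s\in\{0,\dots,\lfloor(n-2)/2\rfloor\}$, $b\in[s+1]$: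 $n(s,b)=\lfloor\frac{n+s+1-b}{1+s}\rfloor$, $X^{(s,b)}_i=X_{b+(i-1)(s+1)}$ for $i\in[n(s,b)]$, $\mathbf X^{(s,b)}=(X_i^{(s,b)})_{i\in[n(s,b)]}$, $\mathbf P^*_{s,b}=\mathcal L(\mathbf X^{(s,b)})$, $\mathbf P^{ind}_{s,b}=\bigotimes_{i=1}^{n(s,b)}\mathcal L(X_i^{(s,b)})$. Let $\hat P_{s,b}=\hat P(n(s,b),\mathbf X^{(s,b)},\mathscr M)$; $\hat P_s(\mathbf X,\mathscr M)$ is any (measurable) element of $\mathscr M$ with $\sum_{b=1}^{s+1}n(s,b)h^2(\hat P_{s,b},\hat P_s)\le\inf_{Q\in\mathscr M}\sum_{b=1}^{s+1}n(s,b)h^2(\hat P_{s,b},Q)+\iota$, where $\iota\in(0,1273]$ is a fixed constant. $\rho$-dimension. For $m\ge1$, $\mathbf P=\bigotimes_{i=1}^mP_i$ with $P_i\in\mathscr P_X$, $P\in\mathscr M$, $y>0$, let $\mathscr B^{\mathscr M}(\mathbf P,P,y)=\{Q\in\mathscr M:\sum_{i=1}^m[h^2(P_i,P)+h^2(P_i,Q)]<y^2\}$. For a pair $(\nu,\mathcal M)$ consisting of a $\sigma$-finite measure $\nu$ and a set $\mathcal M$ of densities w.r.t. $\nu$ representing $\mathscr M$, let $w(\nu,\mathcal M,\mathscr M,\mathbf P,P,y)=\mathbb E_{\mathbf X\sim\mathbf P}\big[\sup_{Q\in\mathscr B^{\mathscr M}(\mathbf P,P,y)}|\mathbf T_m(\mathbf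 X,p,q)-\mathbb E_{\mathbf P}\mathbf T_m(\mathbf X,p,q)|\big]$, where $p,q\in\mathcal M$ are the densities of $P,Q$, and let $\mathbf w^{\mathscr M}(\mathbf P,P,y)$ be the infimum over all such pairs. The $\rho$-dimension function is $D^{\mathscr M}(\mathbf P,P^{\otimes m})=\big[\frac{3}{2^{21/2}}\sup\{y^2:\mathbf w^{\mathscr M}(\mathbf P,P,y)>\frac{3y^2}{64}\}\big]\vee1$. "Uniformly bounded by $m\mapsto D_m(\mathscr M)$" means $D^{\mathscr M}(\mathbf P,P^{\otimes m})\le D_m(\mathscr M)$ for all $m\ge1$, all product distributions $\mathbf P=\bigotimes_{i=1}^mP_i$ with $P_1,\dots,P_m\in\mathscr P_X$ and all $P\in\mathscr M$. *)

theory Defs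
  imports "HOL-Probability.Probability"
begin

text \<open>
  A measurable space is given by a measure \<open>S\<close> of which only \<open>space S\<close> and \<open>sets S\<close> matter; its
  probability distributions are the elements of \<open>space (prob_algebra S)\<close>. Vectors
  \<open>(x\<^sub>1, \<dots>, x\<^sub>m)\<close> are elements of \<open>space (Pi\<^sub>M {1..m} (\<lambda>_. S))\<close>.
\<close>

subsection \<open>Hellinger distance and Kullback--Leibler divergence\<close>

text \<open>
  The dominating measure is taken to be the least measure \<open>sup P Q\<close> above \<open>P\<close> and \<open>Q\<close>;
  \<open>hellinger_sq_dominating\<close> below shows that every other dominating measure gives the same value.
\<close>

definition hellinger_sq :: "'a measure \<Rightarrow> 'a measure \<Rightarrow> real" where
  "hellinger_sq P Q =
     1/2 * (\<integral>x. (sqrt (enn2real (RN_deriv (sup P Q) P x))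
                - sqrt (enn2real (RN_deriv (sup P Q) Q x)))\<^sup>2 \<partial>sup P Q)"

definition hellinger :: "'a measure \<Rightarrow> 'a measure \<Rightarrow> real" where
  "hellinger P Q = sqrt (hellinger_sq P Q)"

lemma sets_sup_eq: "sets P = sets S \<Longrightarrow> sets Q = sets S \<Longrightarrow> sets (sup P Q) = sets S"
  for S :: "'a measure"
  by (auto simp: sup_measure_def sup_lexord_def dest!: sets_eq_imp_space_eq)

lemma absolutely_continuous_sup:
  fixes P :: "'a measure"
  assumes "sets P = sets S" "sets Q = sets S"
  shows "absolutely_continuous (sup P Q) P" "absolutely_continuous (sup P Q) Q"
proof -
  have "\<forall>A\<in>sets S. emeasure P A \<le> emeasure (sup P Q) A"
    using le_measure[of P "sup P Q"] sets_sup_eq[OF assms] assms by simp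
  then show "absolutely_continuous (sup P Q) P"
    using assms sets_sup_eq[OF assms] unfolding absolutely_continuous_def null_sets_def
    by auto
  have "\<forall>A\<in>sets S. emeasure Q A \<le> emeasure (sup P Q) A"
    using le_measure[of Q "sup P Q"] sets_sup_eq[OF assms] assms by simp
  then show "absolutely_continuous (sup P Q) Q"
    using assms sets_sup_eq[OF assms] unfolding absolutely_continuous_def null_sets_def
    by auto
qed

lemma emeasure_sup_le:
  fixes P :: "'a measure"
  assumes "sets P = sets S" "sets Q = sets S" "A \<in> sets S"
  shows "emeasure (sup P Q) A \<le> emeasure P A + emeasure Q A"
proof -
  have "emeasure (sup P Q) A = emeasure (sup_measure' P Q) A"
    using assms sets_eq_imp_space_eq[of P Q] by (simp add: sup_measure_def sup_lexord_def)
  also have "\<dots> = (SUP Y\<in>sets P. emeasure P (A \<inter> Y) + emeasure Q (A \<inter> - Y))"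
    using assms by (subst emeasure_sup_measure') auto
  also have "\<dots> \<le> emeasure P A + emeasure Q A"
    using assms by (intro SUP_least add_mono emeasure_mono) auto
  finally show ?thesis .
qed

lemma finite_measure_sup:
  fixes P :: "'a measure"
  assumes "sets P = sets S" "sets Q = sets S" "finite_measure P" "finite_measure Q"
  shows "finite_measure (sup P Q)"
proof
  have sp: "space (sup P Q) = space S" "space P = space S" "space Q = space S"
    using assms sets_sup_eq[of P S Q] by (auto dest: sets_eq_imp_space_eq)
  have "emeasure (sup P Q) (space S) \<le> emeasure P (space S) + emeasure Q (space S)"
    by (rule emeasure_sup_le[OF assms(1,2)]) simp
  also have "\<dots> < \<infinity>"
    using finite_measure.emeasure_finite[OF assms(3), of "space S"]
      finite_measure.emeasure_finite[OF assms(4), of "space S"]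
    by (simp add: less_top)
  finally show "emeasure (sup P Q) (space (sup P Q)) \<noteq> \<infinity>"
    using sp by simp
qed

lemma hellinger_sq_dominating:
  fixes \<mu> :: "'a measure"
  assumes "P \<in> space (prob_algebra S)" "Q \<in> space (prob_algebra S)"
    and "sigma_finite_measure \<mu>" "sets \<mu> = sets S"
    and "absolutely_continuous \<mu> P" "absolutely_continuous \<mu> Q"
  shows "hellinger_sq P Q =
     1/2 * (\<integral>x. (sqrt (enn2real (RN_deriv \<mu> P x)) - sqrt (enn2real (RN_deriv \<mu> Q x)))\<^sup>2 \<partial>\<mu>)"
proof -
  interpret \<mu>: sigma_finite_measure \<mu> by fact
  have PQ: "sets P = sets S" "sets Q = sets S" "prob_space P" "prob_space Q"
    using assms by (auto simp: space_prob_algebra)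
  define \<nu> where "\<nu> = sup P Q"
  have sets_\<nu>: "sets \<nu> = sets S" unfolding \<nu>_def by (rule sets_sup_eq[OF PQ(1,2)])
  interpret \<nu>: finite_measure \<nu>
    unfolding \<nu>_def using PQ by (intro finite_measure_sup) (auto simp: prob_space_def)
  have ac: "absolutely_continuous \<nu> P" "absolutely_continuous \<nu> Q"
    unfolding \<nu>_def using absolutely_continuous_sup[OF PQ(1,2)] by auto
  have ac\<nu>: "absolutely_continuous \<mu> \<nu>"
    unfolding absolutely_continuous_def
  proof
    fix A assume A: "A \<in> null_sets \<mu>"
    then have "emeasure P A = 0" "emeasure Q A = 0" "A \<in> sets S"
      using assms by (auto simp: absolutely_continuous_def null_sets_def)
    then show "A \<in> null_sets \<nu>"
      using emeasure_sup_le[OF PQ(1,2), of A] sets_\<nu> by (auto simp: null_sets_def \<nu>_def)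
  qed
  define r where "r = RN_deriv \<mu> \<nu>"
  have r: "density \<mu> r = \<nu>" "r \<in> borel_measurable \<mu>"
    unfolding r_def using \<mu>.density_RN_deriv[OF ac\<nu>] sets_\<nu> assms by auto
  have r_fin: "AE x in \<mu>. r x \<noteq> \<infinity>"
    unfolding r_def using ac\<nu> sets_\<nu> assms
    by (intro \<mu>.RN_deriv_finite \<nu>.sigma_finite_measure_axioms) auto
  have chain: "AE x in \<mu>. r x * RN_deriv \<nu> R x = RN_deriv \<mu> R x"
    if "absolutely_continuous \<nu> R" "sets R = sets S" for R
  proof (rule \<mu>.RN_deriv_unique)
    have m: "RN_deriv \<nu> R \<in> borel_measurable \<mu>"
      using sets_\<nu> assms borel_measurable_RN_deriv[of \<nu> R] by (metis measurable_cong_sets)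
    show "(\<lambda>x. r x * RN_deriv \<nu> R x) \<in> borel_measurable \<mu>"
      using m r by measurable
    have "density \<mu> (\<lambda>x. r x * RN_deriv \<nu> R x) = density (density \<mu> r) (RN_deriv \<nu> R)"
      using m r by (subst density_density_eq) auto
    also have "\<dots> = R"
      using r \<nu>.density_RN_deriv[OF that(1)] that(2) sets_\<nu> by simp
    finally show "density \<mu> (\<lambda>x. r x * RN_deriv \<nu> R x) = R" .
  qed
  let ?f = "\<lambda>\<nu> x. (sqrt (enn2real (RN_deriv \<nu> P x)) - sqrt (enn2real (RN_deriv \<nu> Q x)))\<^sup>2"
  have [measurable_cong]: "sets \<nu> = sets \<mu>" using sets_\<nu> assms by simp
  have \<nu>_eq: "\<nu> = density \<mu> (\<lambda>x. ennreal (enn2real (r x)))"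
    unfolding r(1)[symmetric] using r_fin r(2)
    by (intro density_cong) (auto simp: less_top)
  have "integral\<^sup>L \<nu> (?f \<nu>) = (\<integral>x. ?f \<nu> x \<partial>density \<mu> (\<lambda>x. ennreal (enn2real (r x))))"
    using \<nu>_eq by simp
  also have "\<dots> = (\<integral>x. enn2real (r x) *\<^sub>R ?f \<nu> x \<partial>\<mu>)"
    using r(2) by (intro integral_density) auto
  also have "\<dots> = integral\<^sup>L \<mu> (?f \<mu>)"
  proof (rule integral_cong_AE)
    show "AE x in \<mu>. enn2real (r x) *\<^sub>R ?f \<nu> x = ?f \<mu> x"
      using chain[OF ac(1) PQ(1)] chain[OF ac(2) PQ(2)]
    proof eventually_elim
      case (elim x)
      have "?f \<mu> x = (sqrt (enn2real (r x)) * sqrt (enn2real (RN_deriv \<nu> P x))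
              - sqrt (enn2real (r x)) * sqrt (enn2real (RN_deriv \<nu> Q x)))\<^sup>2"
        by (simp add: elim[symmetric] enn2real_mult real_sqrt_mult)
      then show ?case
        by (simp add: right_diff_distrib[symmetric] power_mult_distrib)
    qed
  qed (use r(2) in auto)
  finally show ?thesis
    unfolding hellinger_sq_def \<nu>_def by simp
qed

lemma L2_triangle:
  fixes f g :: "'a \<Rightarrow> real"
  assumes [measurable]: "f \<in> borel_measurable M" "g \<in> borel_measurable M"
    and f: "integrable M (\<lambda>x. (f x)\<^sup>2)" and g: "integrable M (\<lambda>x. (g x)\<^sup>2)"
  shows "sqrt (\<integral>x. (f x + g x)\<^sup>2 \<partial>M) \<le> sqrt (\<integral>x. (f x)\<^sup>2 \<partial>M) + sqrt (\<integral>x. (g x)\<^sup>2 \<partial>M)"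
proof (rule field_le_epsilon)
  fix e :: real assume "0 < e"
  define A where "A = sqrt (\<integral>x. (f x)\<^sup>2 \<partial>M) + e / 2"
  define B where "B = sqrt (\<integral>x. (g x)\<^sup>2 \<partial>M) + e / 2"
  have pos: "0 < A" "0 < B" unfolding A_def B_def using \<open>0 < e\<close> by (auto intro!: add_nonneg_pos)
  have fA: "(\<integral>x. (f x)\<^sup>2 \<partial>M) \<le> A\<^sup>2"
    using \<open>0 < e\<close> by (intro sqrt_le_D) (simp add: A_def)
  have gB: "(\<integral>x. (g x)\<^sup>2 \<partial>M) \<le> B\<^sup>2"
    using \<open>0 < e\<close> by (intro sqrt_le_D) (simp add: B_def)
  have ineq: "(a + b)\<^sup>2 \<le> (A + B) * (a\<^sup>2 / A + b\<^sup>2 / B)" for a b :: real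
  proof -
    have "(A + B) * (a\<^sup>2 / A + b\<^sup>2 / B) - (a + b)\<^sup>2 = (B * a - A * b)\<^sup>2 / (A * B)"
      using pos by (simp add: field_simps power2_eq_square)
    also have "\<dots> \<ge> 0" using pos by simp
    finally show ?thesis by simp
  qed
  have fg: "integrable M (\<lambda>x. (A + B) * ((f x)\<^sup>2 / A + (g x)\<^sup>2 / B))"
    using f g by simp
  have "integrable M (\<lambda>x. (f x + g x)\<^sup>2)"
    by (rule Bochner_Integration.integrable_bound[OF fg])
       (auto intro!: order_trans[OF ineq])
  then have "(\<integral>x. (f x + g x)\<^sup>2 \<partial>M) \<le> (\<integral>x. (A + B) * ((f x)\<^sup>2 / A + (g x)\<^sup>2 / B) \<partial>M)"
    using fg by (intro integral_mono ineq)
  also have "\<dots> = (A + B) * ((\<integral>x. (f x)\<^sup>2 \<partial>M) / A + (\<integral>x. (g x)\<^sup>2 \<partial>M) / B)"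
    using f g by simp
  also have "\<dots> \<le> (A + B) * (A\<^sup>2 / A + B\<^sup>2 / B)"
    using pos fA gB by (intro mult_left_mono add_mono divide_right_mono) auto
  also have "\<dots> = (A + B)\<^sup>2"
    using pos by (simp add: power2_eq_square)
  finally have "sqrt (\<integral>x. (f x + g x)\<^sup>2 \<partial>M) \<le> A + B"
    using pos by (intro real_le_lsqrt) auto
  then show "sqrt (\<integral>x. (f x + g x)\<^sup>2 \<partial>M)
      \<le> sqrt (\<integral>x. (f x)\<^sup>2 \<partial>M) + sqrt (\<integral>x. (g x)\<^sup>2 \<partial>M) + e"
    by (simp add: A_def B_def)
qed

lemma integrable_RN_deriv:
  assumes "sigma_finite_measure \<mu>" "sets P = sets \<mu>" "absolutely_continuous \<mu> P" "prob_space P"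
  shows "integrable \<mu> (\<lambda>x. enn2real (RN_deriv \<mu> P x))"
    and "AE x in \<mu>. ennreal (enn2real (RN_deriv \<mu> P x)) = RN_deriv \<mu> P x"
proof -
  interpret \<mu>: sigma_finite_measure \<mu> by fact
  interpret P: prob_space P by fact
  have "AE x in \<mu>. RN_deriv \<mu> P x \<noteq> \<infinity>"
    using assms by (intro \<mu>.RN_deriv_finite P.sigma_finite_measure_axioms) auto
  then show AE: "AE x in \<mu>. ennreal (enn2real (RN_deriv \<mu> P x)) = RN_deriv \<mu> P x"
    by eventually_elim (simp add: less_top)
  have "(\<integral>\<^sup>+x. ennreal (enn2real (RN_deriv \<mu> P x)) \<partial>\<mu>) = (\<integral>\<^sup>+x. RN_deriv \<mu> P x * 1 \<partial>\<mu>)"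
    using AE by (intro nn_integral_cong_AE) auto
  also have "\<dots> = (\<integral>\<^sup>+x. 1 \<partial>P)"
    using assms by (intro \<mu>.RN_deriv_nn_integral[symmetric]) auto
  also have "\<dots> < \<infinity>"
    using P.emeasure_space_1 by simp
  finally show "integrable \<mu> (\<lambda>x. enn2real (RN_deriv \<mu> P x))"
    by (intro integrableI_nonneg) auto
qed

lemma Metric_space_hellinger: "Metric_space (space (prob_algebra S)) hellinger"
proof
  let ?s = "\<lambda>\<mu> P x. sqrt (enn2real (RN_deriv \<mu> P x))"
  have sq: "integrable \<mu> (\<lambda>x. (?s \<mu> P x - ?s \<mu> Q x)\<^sup>2)"
    if "sigma_finite_measure \<mu>" "sets \<mu> = sets S" "absolutely_continuous \<mu> P" "absolutely_continuous \<mu> Q"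
      "P \<in> space (prob_algebra S)" "Q \<in> space (prob_algebra S)" for \<mu> :: "'a measure" and P Q
  proof (rule Bochner_Integration.integrable_bound)
    have "integrable \<mu> (\<lambda>x. enn2real (RN_deriv \<mu> P x))" "integrable \<mu> (\<lambda>x. enn2real (RN_deriv \<mu> Q x))"
      using that by (auto intro!: integrable_RN_deriv(1) simp: space_prob_algebra)
    then show "integrable \<mu> (\<lambda>x. enn2real (RN_deriv \<mu> P x) + enn2real (RN_deriv \<mu> Q x))" by simp
    have "(sqrt a - sqrt b)\<^sup>2 \<le> a + b" if "0 \<le> a" "0 \<le> b" for a b :: real
      using that by (simp add: power2_diff)
    then show "AE x in \<mu>. norm ((?s \<mu> P x - ?s \<mu> Q x)\<^sup>2)
        \<le> norm (enn2real (RN_deriv \<mu> P x) + enn2real (RN_deriv \<mu> Q x))"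
      by simp
  qed measurable
  show "0 \<le> hellinger P Q" for P Q :: "'a measure"
    by (simp add: hellinger_def hellinger_sq_def)
  show "hellinger P Q = hellinger Q P" for P Q :: "'a measure"
    by (simp add: hellinger_def hellinger_sq_def sup_commute[of P Q] power2_commute)
  show "hellinger P Q = 0 \<longleftrightarrow> P = Q"
    if P: "P \<in> space (prob_algebra S)" and Q: "Q \<in> space (prob_algebra S)" for P Q
  proof
    let ?\<mu> = "sup P Q"
    have PQ: "sets P = sets S" "sets Q = sets S" "prob_space P" "prob_space Q"
      using P Q by (auto simp: space_prob_algebra)
    note ac = absolutely_continuous_sup[OF PQ(1,2)] and st = sets_sup_eq[OF PQ(1,2)]
    interpret finite_measure ?\<mu>
      using PQ by (intro finite_measure_sup) (auto simp: prob_space_def)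
    assume "hellinger P Q = 0"
    then have "(\<integral>x. (?s ?\<mu> P x - ?s ?\<mu> Q x)\<^sup>2 \<partial>?\<mu>) = 0"
      by (simp add: hellinger_def hellinger_sq_def)
    then have "AE x in ?\<mu>. (?s ?\<mu> P x - ?s ?\<mu> Q x)\<^sup>2 = 0"
      using sq[OF sigma_finite_measure_axioms st ac P Q]
      by (subst (asm) integral_nonneg_eq_0_iff_AE) auto
    moreover have "AE x in ?\<mu>. ennreal (enn2real (RN_deriv ?\<mu> P x)) = RN_deriv ?\<mu> P x"
      "AE x in ?\<mu>. ennreal (enn2real (RN_deriv ?\<mu> Q x)) = RN_deriv ?\<mu> Q x"
      using PQ ac st by (auto intro!: integrable_RN_deriv sigma_finite_measure_axioms)
    ultimately have "AE x in ?\<mu>. RN_deriv ?\<mu> P x = RN_deriv ?\<mu> Q x"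
      by eventually_elim (metis eq_iff_diff_eq_0 power_eq_0_iff real_sqrt_eq_iff)
    then have "density ?\<mu> (RN_deriv ?\<mu> P) = density ?\<mu> (RN_deriv ?\<mu> Q)"
      by (intro density_cong) auto
    then show "P = Q"
      using density_RN_deriv[OF ac(1)] density_RN_deriv[OF ac(2)] PQ st by simp
  qed (simp add: hellinger_def hellinger_sq_def)
  show "hellinger P R \<le> hellinger P Q + hellinger Q R"
    if P: "P \<in> space (prob_algebra S)" and Q: "Q \<in> space (prob_algebra S)"
      and R: "R \<in> space (prob_algebra S)" for P Q R
  proof -
    let ?\<mu> = "sup (sup P Q) R"
    have PQR: "sets P = sets S" "sets Q = sets S" "sets R = sets S"
        "prob_space P" "prob_space Q" "prob_space R"
      using P Q R by (auto simp: space_prob_algebra)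
    have st: "sets (sup P Q) = sets S" "sets ?\<mu> = sets S"
      using sets_sup_eq[of P S Q] sets_sup_eq[of "sup P Q" S R] PQR by auto
    interpret finite_measure ?\<mu>
      using PQR st by (intro finite_measure_sup[of _ S]) (auto simp: prob_space_def)
    have ac: "absolutely_continuous ?\<mu> P" "absolutely_continuous ?\<mu> Q" "absolutely_continuous ?\<mu> R"
      using absolutely_continuous_sup[OF st(1) PQR(3)] absolutely_continuous_sup[OF PQR(1,2)]
      by (auto simp: absolutely_continuous_def)
    note dom = hellinger_sq_dominating[OF _ _ sigma_finite_measure_axioms st(2)]
    note sq' = sq[OF sigma_finite_measure_axioms st(2)]
    have "sqrt (\<integral>x. ((?s ?\<mu> P x - ?s ?\<mu> Q x) + (?s ?\<mu> Q x - ?s ?\<mu> R x))\<^sup>2 \<partial>?\<mu>)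
        \<le> sqrt (\<integral>x. (?s ?\<mu> P x - ?s ?\<mu> Q x)\<^sup>2 \<partial>?\<mu>) + sqrt (\<integral>x. (?s ?\<mu> Q x - ?s ?\<mu> R x)\<^sup>2 \<partial>?\<mu>)"
      using P Q R ac by (intro L2_triangle sq') measurable
    then have "sqrt (1/2) * sqrt (\<integral>x. (?s ?\<mu> P x - ?s ?\<mu> R x)\<^sup>2 \<partial>?\<mu>)
        \<le> sqrt (1/2) * (sqrt (\<integral>x. (?s ?\<mu> P x - ?s ?\<mu> Q x)\<^sup>2 \<partial>?\<mu>)
             + sqrt (\<integral>x. (?s ?\<mu> Q x - ?s ?\<mu> R x)\<^sup>2 \<partial>?\<mu>))"
      by (intro mult_left_mono) auto
    then show ?thesis
      unfolding hellinger_def dom[OF P R ac(1,3)] dom[OF P Q ac(1,2)] dom[OF Q R ac(2,3)]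
      by (simp only: real_sqrt_mult distrib_left)
  qed
qed

definition hellinger_topology :: "'a measure \<Rightarrow> 'a measure topology" where
  "hellinger_topology S = Metric_space.mtopology (space (prob_algebra S)) hellinger"

definition hellinger_borel :: "'a measure \<Rightarrow> 'a measure measure" where
  "hellinger_borel S = sigma (space (prob_algebra S)) {U. openin (hellinger_topology S) U}"

text \<open>
  \<open>KL Q P\<close> is \<open>K(Q \<parallel> P)\<close>, so the arguments of the library constants are swapped. For \<open>Q\<close>
  absolutely continuous with respect to \<open>P\<close>, the negative part of \<open>ln (dQ/dP)\<close> is always
  \<open>Q\<close>-integrable, so the integral is \<open>\<infinity>\<close> whenever \<open>ln (dQ/dP)\<close> is not \<open>Q\<close>-integrable.
\<close>

definition KL :: "'a measure \<Rightarrow> 'a measure \<Rightarrow> ereal" where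
  "KL Q P =
     (if absolutely_continuous P Q \<and> integrable Q (entropy_density (exp 1) P Q)
      then ereal (KL_divergence (exp 1) P Q) else \<infinity>)"

subsection \<open>\<open>\<rho>\<close>-estimators\<close>

text \<open>
  Each distribution of the model \<open>\<PP>\<close> has exactly one density in \<open>\<M>\<close>.
\<close>

definition represents ::
  "'a measure \<Rightarrow> 'a measure \<Rightarrow> ('a \<Rightarrow> real) set \<Rightarrow> 'a measure set \<Rightarrow> bool" where
  "represents S \<mu> \<M> \<PP> \<longleftrightarrow>
     sigma_finite_measure \<mu> \<and> sets \<mu> = sets S \<and>
     (\<forall>q\<in>\<M>. q \<in> borel_measurable S \<and> (\<forall>x\<in>space S. 0 \<le> q x)) \<and>
     bij_betw (\<lambda>q. density \<mu> (\<lambda>x. ennreal (q x))) \<M> \<PP>"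

definition density_in :: "'a measure \<Rightarrow> ('a \<Rightarrow> real) set \<Rightarrow> 'a measure \<Rightarrow> 'a \<Rightarrow> real" where
  "density_in \<mu> \<M> P = the_inv_into \<M> (\<lambda>q. density \<mu> (\<lambda>x. ennreal (q x))) P"

definition psi :: "ereal \<Rightarrow> real" where
  "psi x = (if x = \<infinity> then 1 else (real_of_ereal x - 1) / (real_of_ereal x + 1))"

definition sqrt_ratio :: "real \<Rightarrow> real \<Rightarrow> ereal" where
  "sqrt_ratio a b = (if b = 0 then (if a = 0 then 1 else \<infinity>) else ereal (sqrt (a / b)))"

definition T_stat :: "nat \<Rightarrow> (nat \<Rightarrow> 'a) \<Rightarrow> ('a \<Rightarrow> real) \<Rightarrow> ('a \<Rightarrow> real) \<Rightarrow> real" where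
  "T_stat m x q q' = (\<Sum>i=1..m. psi (sqrt_ratio (q' (x i)) (q (x i))))"

definition Upsilon :: "('a \<Rightarrow> real) set \<Rightarrow> nat \<Rightarrow> (nat \<Rightarrow> 'a) \<Rightarrow> ('a \<Rightarrow> real) \<Rightarrow> real" where
  "Upsilon \<M> m x q = (SUP q'\<in>\<M>. T_stat m x q q')"

definition rho_set ::
  "'a measure \<Rightarrow> ('a \<Rightarrow> real) set \<Rightarrow> nat \<Rightarrow> (nat \<Rightarrow> 'a) \<Rightarrow> 'a measure set" where
  "rho_set \<mu> \<M> m x =
     {density \<mu> (\<lambda>z. ennreal (q z)) | q.
        q \<in> \<M> \<and> Upsilon \<M> m x q < (INF q'\<in>\<M>. Upsilon \<M> m x q') + 11.36}"

definition rho_estimator ::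
  "'a measure \<Rightarrow> 'a measure \<Rightarrow> ('a \<Rightarrow> real) set \<Rightarrow> nat \<Rightarrow> ((nat \<Rightarrow> 'a) \<Rightarrow> 'a measure) \<Rightarrow> bool" where
  "rho_estimator S \<mu> \<M> m P\<^sub>h \<longleftrightarrow>
     P\<^sub>h \<in> Pi\<^sub>M {1..m} (\<lambda>_. S) \<rightarrow>\<^sub>M hellinger_borel S \<and>
     (\<forall>x\<in>space (Pi\<^sub>M {1..m} (\<lambda>_. S)). P\<^sub>h x \<in> hellinger_topology S closure_of rho_set \<mu> \<M> m x)"

subsection \<open>Blocks\<close>

definition block_size :: "nat \<Rightarrow> nat \<Rightarrow> nat \<Rightarrow> nat" where
  "block_size n s b = (n + s + 1 - b) div (1 + s)"

definition block_index :: "nat \<Rightarrow> nat \<Rightarrow> nat \<Rightarrow> nat" where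
  "block_index s b i = b + (i - 1) * (s + 1)"

definition block :: "nat \<Rightarrow> nat \<Rightarrow> nat \<Rightarrow> (nat \<Rightarrow> 'a) \<Rightarrow> nat \<Rightarrow> 'a" where
  "block n s b x = (\<lambda>i\<in>{1..block_size n s b}. x (block_index s b i))"

definition block_law ::
  "'w measure \<Rightarrow> 'a measure \<Rightarrow> (nat \<Rightarrow> 'w \<Rightarrow> 'a) \<Rightarrow> nat \<Rightarrow> nat \<Rightarrow> nat \<Rightarrow> (nat \<Rightarrow> 'a) measure" where
  "block_law \<Omega> S X n s b =
     distr \<Omega> (Pi\<^sub>M {1..block_size n s b} (\<lambda>_. S)) (\<lambda>\<omega>. block n s b (\<lambda>i. X i \<omega>))"

definition block_ind_law ::
  "'w measure \<Rightarrow> 'a measure \<Rightarrow> (nat \<Rightarrow> 'w \<Rightarrow> 'a) \<Rightarrow> nat \<Rightarrow> nat \<Rightarrow> nat \<Rightarrow> (nat \<Rightarrow> 'a) measure" where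
  "block_ind_law \<Omega> S X n s b =
     Pi\<^sub>M {1..block_size n s b} (\<lambda>i. distr \<Omega> S (X (block_index s b i)))"

text \<open>
  The \<open>\<rho>\<close>-estimators \<open>P\<^sub>b b\<close> built on the blocks are existentially quantified: any choice of them
  is allowed. Measurability of \<open>P\<^sub>s\<close> is with respect to the Hellinger Borel sets; as the model is
  countable, this amounts to every \<open>{x. P\<^sub>s x = Q}\<close> being measurable.
\<close>

definition block_rho_estimator ::
  "'a measure \<Rightarrow> 'a measure \<Rightarrow> ('a \<Rightarrow> real) set \<Rightarrow> 'a measure set \<Rightarrow> real \<Rightarrow> nat \<Rightarrow> nat \<Rightarrow>
     ((nat \<Rightarrow> 'a) \<Rightarrow> 'a measure) \<Rightarrow> bool" where
  "block_rho_estimator S \<mu> \<M> \<PP> \<iota> n s P\<^sub>s \<longleftrightarrow>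
     P\<^sub>s \<in> Pi\<^sub>M {1..n} (\<lambda>_. S) \<rightarrow>\<^sub>M hellinger_borel S \<and>
     (\<exists>P\<^sub>b. (\<forall>b\<in>{1..s+1}. rho_estimator S \<mu> \<M> (block_size n s b) (P\<^sub>b b)) \<and>
       (\<forall>x\<in>space (Pi\<^sub>M {1..n} (\<lambda>_. S)). P\<^sub>s x \<in> \<PP> \<and>
          (\<Sum>b=1..s+1. real (block_size n s b) * (hellinger (P\<^sub>b b (block n s b x)) (P\<^sub>s x))\<^sup>2)
          \<le> (INF Q\<in>\<PP>. \<Sum>b=1..s+1.
                real (block_size n s b) * (hellinger (P\<^sub>b b (block n s b x)) Q)\<^sup>2) + \<iota>))"

subsection \<open>\<open>\<rho>\<close>-dimension\<close>

definition rho_ball ::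
  "'a measure set \<Rightarrow> nat \<Rightarrow> (nat \<Rightarrow> 'a measure) \<Rightarrow> 'a measure \<Rightarrow> real \<Rightarrow> 'a measure set" where
  "rho_ball \<PP> m Ps P y =
     {Q\<in>\<PP>. (\<Sum>i=1..m. (hellinger (Ps i) P)\<^sup>2 + (hellinger (Ps i) Q)\<^sup>2) < y\<^sup>2}"

text \<open>
  The integrand takes values in \<open>ennreal\<close>, so that a supremum over an empty ball is \<open>0\<close>.
\<close>

definition w_rep ::
  "'a measure \<Rightarrow> ('a \<Rightarrow> real) set \<Rightarrow> 'a measure set \<Rightarrow> nat \<Rightarrow> (nat \<Rightarrow> 'a measure) \<Rightarrow> 'a measure \<Rightarrow>
     real \<Rightarrow> ennreal" where
  "w_rep \<nu> \<M> \<PP> m Ps P y =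
     (\<integral>\<^sup>+x. (SUP Q\<in>rho_ball \<PP> m Ps P y.
        ennreal \<bar>T_stat m x (density_in \<nu> \<M> P) (density_in \<nu> \<M> Q)
          - (\<integral>z. T_stat m z (density_in \<nu> \<M> P) (density_in \<nu> \<M> Q) \<partial>Pi\<^sub>M {1..m} Ps)\<bar>)
      \<partial>Pi\<^sub>M {1..m} Ps)"

definition w_inf ::
  "'a measure \<Rightarrow> 'a measure set \<Rightarrow> nat \<Rightarrow> (nat \<Rightarrow> 'a measure) \<Rightarrow> 'a measure \<Rightarrow> real \<Rightarrow> ennreal" where
  "w_inf S \<PP> m Ps P y =
     (INF (\<nu>, \<M>)\<in>{(\<nu>, \<M>). represents S \<nu> \<M> \<PP>}. w_rep \<nu> \<M> \<PP> m Ps P y)"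

definition rho_dim ::
  "'a measure \<Rightarrow> 'a measure set \<Rightarrow> nat \<Rightarrow> (nat \<Rightarrow> 'a measure) \<Rightarrow> 'a measure \<Rightarrow> ennreal" where
  "rho_dim S \<PP> m Ps P =
     max (ennreal (3 / 2 powr (21/2)) *
            (SUP y\<in>{y. 0 < y \<and> w_inf S \<PP> m Ps P y > ennreal (3 * y\<^sup>2 / 64)}. ennreal (y\<^sup>2)))
         1"

definition rho_dim_bounded :: "'a measure \<Rightarrow> 'a measure set \<Rightarrow> (nat \<Rightarrow> real) \<Rightarrow> bool" where
  "rho_dim_bounded S \<PP> D \<longleftrightarrow>
     (\<forall>m\<ge>1. \<forall>Ps. (\<forall>i\<in>{1..m}. Ps i \<in> space (prob_algebra S)) \<longrightarrow>
        (\<forall>P\<in>\<PP>. rho_dim S \<PP> m Ps P \<le> ennreal (D m)))"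

end

theory Submission
  imports Defs
begin

text \<open>
  On one block with independent observations, let \<open>H\<close> and \<open>A Q\<close> be the sums of the squared Hellinger
  distances from the marginals to \<open>P\<close> and to \<open>Q\<close>. The statistic comparing \<open>P\<close> with \<open>Q\<close> has mean at
  most \<open>4 H - 3/8 A Q\<close> and variance at most \<open>2 (H + A Q)\<close>. The dimension bounds the mean of the
  supremum of the centred statistic over balls, and a Talagrand-type inequality, proved by
  tensorization of entropy, turns this into exponential moments. Summing over shells of \<open>H + A Q\<close>
  bounds an exponential moment of \<open>A\<close> at the estimator, with a rate that does not depend on the
  dimension. By the variational formula for the Kullback--Leibler divergence this yields a bound in
  mean under the true, dependent law of the block. The Hellinger triangle inequality combines the
  blocks.
\<close>

subsection \<open>Entropy of product measures\<close>

text \<open>Passing to the dependent law costs the divergence plus the logarithm of the exponential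
  moment, both divided by the rate. Fixing the rate at \<open>1 / 300\<close> keeps the divergence
  free of a dimension factor, and the dimension enters additively, through the logarithm. The
  constants rest on one margin. For \<open>Y\<close> at least a fixed multiple of the dimension, the
  mean supremum over a ball of squared radius \<open>Y\<close> is about \<open>3/64 * Y\<close>;
  compensating the variance and concentrating raise this to \<open>0.0906 * Y\<close>, up to a
  multiple of \<open>H\<close>, still well below the drift of \<open>3/8\<close> per unit of
  \<open>A Q\<close>. Peeling spends part of the difference, and the rest leaves a positive multiple
  of \<open>A\<close> at the estimator. A separate obstacle is that the dimension is an infimum over
  representations of the model, while the estimator uses one of them and the data need not be
  dominated: two versions of the densities may differ where the data have mass. The resulting error
  is again a multiple of \<open>H\<close>.\<close>

lemma ln_ge_one_minus_inverse: "0 < t \<Longrightarrow> 1 - 1 / t \<le> ln (t::real)"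
  using ln_le_minus_one[of "1/t"] by (simp add: ln_div)

lemma (in prob_space) integrable_bounded:
  fixes f :: "'a \<Rightarrow> real"
  assumes "f \<in> borel_measurable M" "\<And>x. x \<in> space M \<Longrightarrow> \<bar>f x\<bar> \<le> B"
  shows "integrable M f"
  using assms by (intro integrable_const_bound[where B = B]) auto

lemma (in prob_space) integral_between:
  fixes f :: "'a \<Rightarrow> real"
  assumes "integrable M f" "\<And>x. x \<in> space M \<Longrightarrow> a \<le> f x" "\<And>x. x \<in> space M \<Longrightarrow> f x \<le> b"
  shows "a \<le> integral\<^sup>L M f" "integral\<^sup>L M f \<le> b"
proof -
  have "(\<integral>x. a \<partial>M) \<le> integral\<^sup>L M f" using assms by (intro integral_mono) auto
  then show "a \<le> integral\<^sup>L M f" by (simp add: prob_space)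
  have "integral\<^sup>L M f \<le> (\<integral>x. b \<partial>M)" using assms by (intro integral_mono) auto
  then show "integral\<^sup>L M f \<le> b" by (simp add: prob_space)
qed

lemma abs_ln_between:
  fixes t :: real
  assumes "0 < a" "a \<le> t" "t \<le> b"
  shows "\<bar>ln t\<bar> \<le> \<bar>ln a\<bar> + \<bar>ln b\<bar>"
  using ln_mono[of a t] ln_mono[of t b] assms by linarith

text \<open>Joint convexity of \<open>u * ln (u / v)\<close>, through its tangent plane: with
  \<open>L\<close> the ratio of the means, \<open>1 - 1 / t \<le> ln t\<close> at
  \<open>t = f x / g x / L\<close> gives a linear lower bound whose terms
  \<open>f x - g x * L\<close> cancel in the mean.\<close>

lemma (in prob_space) log_sum_inequality:
  fixes f g :: "'a \<Rightarrow> real"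
  assumes m[measurable]: "f \<in> borel_measurable M" "g \<in> borel_measurable M"
    and a: "0 < a"
    and f: "\<And>x. x \<in> space M \<Longrightarrow> a \<le> f x \<and> f x \<le> b"
    and g: "\<And>x. x \<in> space M \<Longrightarrow> a \<le> g x \<and> g x \<le> b"
  shows "expectation f * ln (expectation f / expectation g) \<le> (\<integral>x. f x * ln (f x / g x) \<partial>M)"
proof -
  have i: "integrable M f" "integrable M g"
    using a f g by (fastforce intro!: integrable_bounded[where B = b] m)+
  have bb: "a \<le> expectation f" "a \<le> expectation g"
    using integral_between[OF i(1), of a b] integral_between[OF i(2), of a b] f g by auto
  have il: "integrable M (\<lambda>x. f x * ln (f x / g x))"
  proof (rule integrable_bounded[where B = "b * ((\<bar>ln a\<bar> + \<bar>ln b\<bar>) + (\<bar>ln a\<bar> + \<bar>ln b\<bar>))"])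
    fix x assume x: "x \<in> space M"
    have "\<bar>ln (f x / g x)\<bar> \<le> \<bar>ln (f x)\<bar> + \<bar>ln (g x)\<bar>"
      using f[OF x] g[OF x] a by (subst ln_div) auto
    also have "\<dots> \<le> (\<bar>ln a\<bar> + \<bar>ln b\<bar>) + (\<bar>ln a\<bar> + \<bar>ln b\<bar>)"
      using f[OF x] g[OF x] a by (intro add_mono abs_ln_between) auto
    finally show "\<bar>f x * ln (f x / g x)\<bar> \<le> b * ((\<bar>ln a\<bar> + \<bar>ln b\<bar>) + (\<bar>ln a\<bar> + \<bar>ln b\<bar>))"
      using f[OF x] a unfolding abs_mult by (intro mult_mono) auto
  qed measurable
  define L where "L = expectation f / expectation g"
  have L: "0 < L" using bb a by (auto simp: L_def)
  have "(\<integral>x. f x * ln L + f x - g x * L \<partial>M) \<le> (\<integral>x. f x * ln (f x / g x) \<partial>M)"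
  proof (rule integral_mono)
    fix x assume x: "x \<in> space M"
    have p: "0 < f x" "0 < g x" using f[OF x] g[OF x] a by auto
    have "1 - 1 / (f x / g x / L) \<le> ln (f x / g x / L)"
      using p L by (intro ln_ge_one_minus_inverse) auto
    then have "f x * (1 - 1 / (f x / g x / L)) \<le> f x * (ln (f x / g x) - ln L)"
      using p L by (intro mult_left_mono) (auto simp: ln_div ln_mult)
    moreover have "f x * (1 - 1 / (f x / g x / L)) = f x - g x * L"
      using p L by (simp add: field_simps)
    ultimately show "f x * ln L + f x - g x * L \<le> f x * ln (f x / g x)"
      by (simp add: algebra_simps)
  qed (use i il in auto)
  moreover have "(\<integral>x. f x * ln L + f x - g x * L \<partial>M) = expectation f * ln L"
    using i bb a by (simp add: L_def)
  ultimately show ?thesis by (simp add: L_def)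
qed

lemma (in product_prob_space) prob_space_product: "prob_space (PiM J M)"
  by (intro prob_space_PiM M.prob_space_axioms)

lemma abs_mult_ln_div_le:
  fixes a b t u :: real
  assumes "0 < a" "a \<le> t" "t \<le> b" "a \<le> u" "u \<le> b"
  shows "\<bar>t * ln (t / u) - t + u\<bar> \<le> 2 * b * (\<bar>ln a\<bar> + \<bar>ln b\<bar>) + 2 * b"
proof -
  have "\<bar>ln (t / u)\<bar> \<le> \<bar>ln t\<bar> + \<bar>ln u\<bar>"
    using assms by (subst ln_div) auto
  also have "\<dots> \<le> 2 * (\<bar>ln a\<bar> + \<bar>ln b\<bar>)"
    using abs_ln_between[of a t b] abs_ln_between[of a u b] assms by auto
  finally have "\<bar>t * ln (t / u)\<bar> \<le> b * (2 * (\<bar>ln a\<bar> + \<bar>ln b\<bar>))"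
    unfolding abs_mult using assms by (intro mult_mono) auto
  then show ?thesis using assms by (simp add: algebra_simps)
qed

text \<open>The entropy in one coordinate is the minimum over constants \<open>c\<close> of the mean
  of \<open>f * ln (f / c) - f + c\<close>, and \<open>g i\<close> is such a constant in coordinate
  \<open>i\<close>. Leaving \<open>g i\<close> free allows a maximum to be compared later with the
  maximum that omits one summand.\<close>

lemma (in product_prob_space) entropy_tensorization:
  fixes f :: "('i \<Rightarrow> 'a) \<Rightarrow> real" and g :: "'i \<Rightarrow> ('i \<Rightarrow> 'a) \<Rightarrow> real"
  assumes "finite J" "0 < a"
    and "f \<in> borel_measurable (PiM J M)"
    and "\<And>x. x \<in> space (PiM J M) \<Longrightarrow> a \<le> f x \<and> f x \<le> b"
    and "\<And>i. i \<in> J \<Longrightarrow> g i \<in> borel_measurable (PiM J M)"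
    and "\<And>i x. i \<in> J \<Longrightarrow> x \<in> space (PiM J M) \<Longrightarrow> a \<le> g i x \<and> g i x \<le> b"
    and "\<And>i x z. i \<in> J \<Longrightarrow> x \<in> space (PiM J M) \<Longrightarrow> z \<in> space (M i) \<Longrightarrow> g i (x(i := z)) = g i x"
  shows "(\<integral>x. f x * ln (f x) \<partial>PiM J M) - (\<integral>x. f x \<partial>PiM J M) * ln (\<integral>x. f x \<partial>PiM J M)
    \<le> (\<Sum>i\<in>J. \<integral>x. f x * ln (f x / g i x) - f x + g i x \<partial>PiM J M)"
  using assms(1,3-)
proof (induction J arbitrary: f g rule: finite_induct)
  case empty
  then show ?case by (simp add: PiM_empty lebesgue_integral_count_space_finite)
next
  case (insert k J f g)
  note [measurable] = insert.prems(1)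
  have gm[measurable]: "\<And>i. i \<in> insert k J \<Longrightarrow> g i \<in> borel_measurable (PiM (insert k J) M)"
    by (rule insert.prems(3))
  note fb = insert.prems(2) and gb = insert.prems(4) and gi = insert.prems(5)
  interpret PJ: prob_space "PiM J M" by (rule prob_space_product)
  interpret PI: prob_space "PiM (insert k J) M" by (rule prob_space_product)
  have up: "y(k := z) \<in> space (PiM (insert k J) M)" if "y \<in> space (PiM J M)" "z \<in> space (M k)" for y z
    using that by (auto simp: space_PiM PiE_iff extensional_def)
  have upm: "(\<lambda>z. y(k := z)) \<in> M k \<rightarrow>\<^sub>M PiM (insert k J) M" if "y \<in> space (PiM J M)" for y
    using that by measurable
  have upm2: "(\<lambda>(y, z). y(k := z)) \<in> PiM J M \<Otimes>\<^sub>M M k \<rightarrow>\<^sub>M PiM (insert k J) M"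
    by (rule measurable_add_dim)
  have sec[measurable]: "(\<lambda>z. h (y(k := z))) \<in> borel_measurable (M k)"
    if "h \<in> borel_measurable (PiM (insert k J) M)" "y \<in> space (PiM J M)" for h :: "('i \<Rightarrow> 'a) \<Rightarrow> real" and y
    using measurable_comp[OF upm[OF that(2)] that(1)] by (simp add: comp_def)
  have intm: "(\<lambda>y. \<integral>z. h (y(k := z)) \<partial>M k) \<in> borel_measurable (PiM J M)"
    if "h \<in> borel_measurable (PiM (insert k J) M)" for h :: "('i \<Rightarrow> 'a) \<Rightarrow> real"
    using measurable_comp[OF upm2 that] 
    by (intro M.borel_measurable_lebesgue_integral) (simp add: comp_def split_beta')
  \<comment> \<open>\<open>F\<close> and \<open>G i\<close> integrate out the new coordinate. The
    entropy of \<open>f\<close> is the mean of its entropy in that coordinate plus the entropy of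
    \<open>F\<close>, to which the induction hypothesis applies.\<close>
  define F where "F y = (\<integral>z. f (y(k := z)) \<partial>M k)" for y
  define G where "G i y = (\<integral>z. g i (y(k := z)) \<partial>M k)" for i y
  have fI: "integrable (M k) (\<lambda>z. f (y(k := z)))" if "y \<in> space (PiM J M)" for y
    using that fb[OF up] \<open>0 < a\<close> insert.prems(1) by (intro M.integrable_bounded[where B = b] sec) fastforce+
  have gI: "integrable (M k) (\<lambda>z. g i (y(k := z)))" if "y \<in> space (PiM J M)" "i \<in> insert k J" for y i
    using that gb[OF _ up] \<open>0 < a\<close> gm by (intro M.integrable_bounded[where B = b] sec) fastforce+
  have Fb: "a \<le> F y \<and> F y \<le> b" if "y \<in> space (PiM J M)" for y
    unfolding F_def using M.integral_between[OF fI[OF that], of a b] fb up that by auto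
  have Gb: "a \<le> G i y \<and> G i y \<le> b" if "y \<in> space (PiM J M)" "i \<in> insert k J" for y i
    unfolding G_def using M.integral_between[OF gI[OF that], of a b] gb up that by auto
  have Fm[measurable]: "F \<in> borel_measurable (PiM J M)"
    unfolding F_def using insert.prems(1) by (rule intm)
  have Gm: "G i \<in> borel_measurable (PiM J M)" if "i \<in> insert k J" for i
    unfolding G_def using gm[OF that] by (rule intm)
  have Gi: "G i (x(i := z)) = G i x" if "i \<in> J" "x \<in> space (PiM J M)" "z \<in> space (M i)" for i x z
    unfolding G_def
  proof (rule Bochner_Integration.integral_cong)
    fix w assume "w \<in> space (M k)"
    then show "g i (x(i := z, k := w)) = g i (x(k := w))"
      using gi[of i "x(k := w)" z] that(1,3) up[OF that(2), of w] insert.hyps fun_upd_twist[of i k x z w]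
        by (metis insertI2)
  qed simp
  have IH: "(\<integral>y. F y * ln (F y) \<partial>PiM J M) - (\<integral>y. F y \<partial>PiM J M) * ln (\<integral>y. F y \<partial>PiM J M)
    \<le> (\<Sum>i\<in>J. \<integral>y. F y * ln (F y / G i y) - F y + G i y \<partial>PiM J M)"
  proof (rule insert.IH)
    show "G i (x(i := z)) = G i x" if "i \<in> J" "x \<in> space (PiM J M)" "z \<in> space (M i)" for i x z
      using that by (rule Gi)
    show "a \<le> G i x \<and> G i x \<le> b" if "i \<in> J" "x \<in> space (PiM J M)" for i x
      using that Gb by simp
  qed (use Fm Fb Gm in simp_all)
  define B where "B = 2 * b * (\<bar>ln a\<bar> + \<bar>ln b\<bar>) + 2 * b"
  let ?h = "\<lambda>i x. f x * ln (f x / g i x) - f x + g i x"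
  have hm: "?h i \<in> borel_measurable (PiM (insert k J) M)" if "i \<in> insert k J" for i
    using gm[OF that] by measurable
  have hb: "\<bar>?h i x\<bar> \<le> B" if "i \<in> insert k J" "x \<in> space (PiM (insert k J) M)" for i x
    unfolding B_def using fb gb that \<open>0 < a\<close> by (intro abs_mult_ln_div_le) auto
  have hI: "integrable (PiM (insert k J) M) (?h i)" if "i \<in> insert k J" for i
    using hm hb that by (intro PI.integrable_bounded[where B = B]) auto
  have hIk: "integrable (M k) (\<lambda>z. ?h i (y(k := z)))" if "i \<in> insert k J" "y \<in> space (PiM J M)" for i y
    using hm hb that up by (intro M.integrable_bounded[where B = B] sec) auto
  have fin: "integral\<^sup>L (PiM (insert k J) M) h = (\<integral>y. (\<integral>z. h (y(k := z)) \<partial>M k) \<partial>PiM J M)"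
    if "integrable (PiM (insert k J) M) h" for h :: "('i \<Rightarrow> 'a) \<Rightarrow> real"
    using product_integral_insert[OF insert.hyps that] .
  have bnd: "\<bar>\<integral>z. h (y(k := z)) \<partial>M k\<bar> \<le> C"
    if "integrable (M k) (\<lambda>z. h (y(k := z)))" "\<And>x. x \<in> space (PiM (insert k J) M) \<Longrightarrow> \<bar>h x\<bar> \<le> C"
      "y \<in> space (PiM J M)" for h :: "('i \<Rightarrow> 'a) \<Rightarrow> real" and y C
    using M.integral_between[OF that(1), of "-C" C] that(2)[OF up[OF that(3)]] by (simp add: abs_le_iff) (smt (verit, best))
  define C where "C = b * (\<bar>ln a\<bar> + \<bar>ln b\<bar>)"
  have fl: "\<bar>f x * ln (f x)\<bar> \<le> C" if "x \<in> space (PiM (insert k J) M)" for x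
    unfolding C_def abs_mult using fb[OF that] \<open>0 < a\<close> abs_ln_between[of a "f x" b] by (intro mult_mono) auto
  have flm[measurable]: "(\<lambda>x. f x * ln (f x)) \<in> borel_measurable (PiM (insert k J) M)" by measurable
  have flI: "integrable (PiM (insert k J) M) (\<lambda>x. f x * ln (f x))"
    using fl by (intro PI.integrable_bounded[where B = C]) auto
  have flIk: "integrable (M k) (\<lambda>z. f (y(k := z)) * ln (f (y(k := z))))" if "y \<in> space (PiM J M)" for y
    using fl up that flm by (intro M.integrable_bounded[where B = C] sec[OF flm]) auto
  have fII: "integrable (PiM (insert k J) M) f"
    using fb \<open>0 < a\<close> by (intro PI.integrable_bounded[where B = b]) fastforce+
  \<comment> \<open>The variational formula in coordinate \<open>k\<close>, where \<open>g k\<close>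
    is a constant \<open>c\<close>: the loss is
    \<open>F y * ln (c / F y) \<le> c - F y\<close>.\<close>
  have s1: "(\<integral>z. f (y(k := z)) * ln (f (y(k := z))) \<partial>M k) - F y * ln (F y) \<le> (\<integral>z. ?h k (y(k := z)) \<partial>M k)"
    if y: "y \<in> space (PiM J M)" for y
  proof -
    obtain z0 where z0: "z0 \<in> space (M k)" using M.not_empty by auto
    define c where "c = g k (y(k := z0))"
    have c: "g k (y(k := z)) = c" if "z \<in> space (M k)" for z
      unfolding c_def using gi[OF insertI1 up[OF y z0] that] by (simp only: fun_upd_upd)
    have c0: "0 < c" unfolding c_def using gb[OF insertI1 up[OF y z0]] \<open>0 < a\<close> by linarith
    have "(\<integral>z. ?h k (y(k := z)) \<partial>M k)
        = (\<integral>z. f (y(k := z)) * ln (f (y(k := z))) - f (y(k := z)) * ln c - f (y(k := z)) + c \<partial>M k)"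
    proof (rule Bochner_Integration.integral_cong)
      fix z assume "z \<in> space (M k)"
      then show "?h k (y(k := z)) = f (y(k := z)) * ln (f (y(k := z))) - f (y(k := z)) * ln c - f (y(k := z)) + c"
        using c c0 fb[OF up[OF y]] \<open>0 < a\<close> by (fastforce simp: ln_div algebra_simps)
    qed simp
    also have "\<dots> = (\<integral>z. f (y(k := z)) * ln (f (y(k := z))) \<partial>M k) - F y * ln c - F y + c"
      using flIk[OF y] fI[OF y] by (simp add: F_def M.prob_space)
    finally have e: "(\<integral>z. ?h k (y(k := z)) \<partial>M k)
      = (\<integral>z. f (y(k := z)) * ln (f (y(k := z))) \<partial>M k) - F y * ln c - F y + c" .
    have F0: "0 < F y" using Fb[OF y] \<open>0 < a\<close> by auto
    have "F y * ln (c / F y) \<le> F y * (c / F y - 1)"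
      using F0 c0 by (intro mult_left_mono ln_le_minus_one) auto
    also have "\<dots> = c - F y" using F0 by (simp add: field_simps)
    finally show ?thesis using F0 c0 unfolding e by (simp add: ln_div algebra_simps)
  qed
  \<comment> \<open>By convexity, averaging \<open>f\<close> and \<open>g i\<close> over coordinate
    \<open>k\<close> can only lower the summand of index \<open>i\<close>.\<close>
  have s2: "F y * ln (F y / G i y) - F y + G i y \<le> (\<integral>z. ?h i (y(k := z)) \<partial>M k)"
    if y: "y \<in> space (PiM J M)" and i: "i \<in> J" for y i
  proof -
    have fb': "a \<le> f (y(k := z)) \<and> f (y(k := z)) \<le> b" if "z \<in> space (M k)" for z
      using fb up y that by auto
    have gb': "a \<le> g i (y(k := z)) \<and> g i (y(k := z)) \<le> b" if "z \<in> space (M k)" for z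
      using gb up y that i by auto
    have "F y * ln (F y / G i y) \<le> (\<integral>z. f (y(k := z)) * ln (f (y(k := z)) / g i (y(k := z))) \<partial>M k)"
      unfolding F_def G_def using insert.prems(1) gm[of i] i y \<open>0 < a\<close> fb' gb'
      by (intro M.log_sum_inequality[where a = a and b = b] sec) auto
    moreover have "(\<integral>z. ?h i (y(k := z)) \<partial>M k)
      = (\<integral>z. f (y(k := z)) * ln (f (y(k := z)) / g i (y(k := z))) \<partial>M k) - F y + G i y"
    proof -
      have "integrable (M k) (\<lambda>z. ?h i (y(k := z)) + f (y(k := z)) - g i (y(k := z)))"
        using i by (intro Bochner_Integration.integrable_diff[OF
            Bochner_Integration.integrable_add[OF hIk[OF _ y] fI[OF y]] gI[OF y]]) simp_all
      moreover have "(\<lambda>z. ?h i (y(k := z)) + f (y(k := z)) - g i (y(k := z)))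
          = (\<lambda>z. f (y(k := z)) * ln (f (y(k := z)) / g i (y(k := z))))"
        by (rule ext) simp
      ultimately have "integrable (M k) (\<lambda>z. f (y(k := z)) * ln (f (y(k := z)) / g i (y(k := z))))"
        by metis
      then show ?thesis
        using fI[of y] gI[of y i] y i by (simp add: F_def G_def)
    qed
    ultimately show ?thesis by simp
  qed
  have FlI: "integrable (PiM J M) (\<lambda>y. F y * ln (F y))"
  proof (rule PJ.integrable_bounded[where B = C])
    fix y assume "y \<in> space (PiM J M)"
    then show "\<bar>F y * ln (F y)\<bar> \<le> C"
      unfolding C_def abs_mult using Fb \<open>0 < a\<close> abs_ln_between[of a "F y" b] by (intro mult_mono) fastforce+
  qed measurable
  have flJ: "integrable (PiM J M) (\<lambda>y. \<integral>z. f (y(k := z)) * ln (f (y(k := z))) \<partial>M k)"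
    using intm[OF flm] bnd[OF flIk fl] by (rule PJ.integrable_bounded)
  have hJ: "integrable (PiM J M) (\<lambda>y. \<integral>z. ?h i (y(k := z)) \<partial>M k)" if "i \<in> insert k J" for i
    using intm[OF hm[OF that]] bnd[OF hIk[OF that] hb[OF that]] by (rule PJ.integrable_bounded)
  have FGI: "integrable (PiM J M) (\<lambda>y. F y * ln (F y / G i y) - F y + G i y)" if "i \<in> J" for i
    using that Fb Gb Gm[of i] \<open>0 < a\<close> unfolding B_def
    by (intro PJ.integrable_bounded[where B = "2 * b * (\<bar>ln a\<bar> + \<bar>ln b\<bar>) + 2 * b"] abs_mult_ln_div_le)
       auto
  have "(\<integral>x. f x * ln (f x) \<partial>PiM (insert k J) M) - (\<integral>x. f x \<partial>PiM (insert k J) M) * ln (\<integral>x. f x \<partial>PiM (insert k J) M)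
     = (\<integral>y. (\<integral>z. f (y(k := z)) * ln (f (y(k := z))) \<partial>M k) - F y * ln (F y) \<partial>PiM J M)
      + ((\<integral>y. F y * ln (F y) \<partial>PiM J M) - (\<integral>y. F y \<partial>PiM J M) * ln (\<integral>y. F y \<partial>PiM J M))"
    unfolding fin[OF flI] fin[OF fII] F_def[symmetric] using flJ FlI by simp
  also have "\<dots> \<le> (\<integral>y. (\<integral>z. ?h k (y(k := z)) \<partial>M k) \<partial>PiM J M)
      + (\<Sum>i\<in>J. \<integral>y. (\<integral>z. ?h i (y(k := z)) \<partial>M k) \<partial>PiM J M)"
  proof (intro add_mono order_trans[OF IH] sum_mono)
    show "(\<integral>y. (\<integral>z. f (y(k := z)) * ln (f (y(k := z))) \<partial>M k) - F y * ln (F y) \<partial>PiM J M)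
      \<le> (\<integral>y. (\<integral>z. ?h k (y(k := z)) \<partial>M k) \<partial>PiM J M)"
      using flJ FlI hJ s1 by (intro integral_mono) auto
    show "(\<integral>y. F y * ln (F y / G i y) - F y + G i y \<partial>PiM J M)
      \<le> (\<integral>y. (\<integral>z. ?h i (y(k := z)) \<partial>M k) \<partial>PiM J M)" if "i \<in> J" for i
      using FGI hJ s2 that by (intro integral_mono) auto
  qed
  also have "\<dots> = (\<Sum>i\<in>insert k J. \<integral>x. ?h i x \<partial>PiM (insert k J) M)"
    using insert.hyps hI by (simp add: fin)
  finally show ?case .
qed

subsection \<open>Concentration of maxima of sums\<close>

text \<open>The difference of the two sides has derivative \<open>u * (2 * c - exp u)\<close>, which
  has the sign of \<open>u\<close> up to \<open>U\<close>; hence its minimum is its value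
  \<open>0\<close> at \<open>u = 0\<close>.\<close>

lemma exp_entropy_bound:
  fixes u U c :: real
  assumes "u \<le> U" "0 \<le> U" "exp U \<le> 2 * c"
  shows "exp u * (u - 1) + 1 \<le> c * u\<^sup>2"
proof -
  define h where "h u = c * u\<^sup>2 - exp u * (u - 1) - 1" for u :: real
  have d: "(h has_real_derivative t * (2 * c - exp t)) (at t)" for t
    unfolding h_def by (auto intro!: derivative_eq_intros simp: algebra_simps)
  have e: "exp t \<le> 2 * c" if "t \<le> U" for t
    using that assms by (meson exp_le_cancel_iff order_trans)
  have "h 0 \<le> h u"
  proof (cases "0 \<le> u")
    case True
    show ?thesis
    proof (rule DERIV_nonneg_imp_nondecreasing[OF True])
      fix x assume "0 \<le> x" "x \<le> u"
      then show "\<exists>y. (h has_real_derivative y) (at x) \<and> 0 \<le> y"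
        using d[of x] e[of x] assms by (intro exI[of _ "x * (2 * c - exp x)"]) auto
    qed
  next
    case False
    then have "u \<le> 0" by simp
    then show ?thesis
    proof (rule DERIV_nonpos_imp_nonincreasing)
      fix x assume "u \<le> x" "x \<le> 0"
      then show "\<exists>y. (h has_real_derivative y) (at x) \<and> y \<le> 0"
        using d[of x] e[of x] assms
        by (intro exI[of _ "x * (2 * c - exp x)"]) (auto intro!: mult_nonpos_nonneg)
    qed
  qed
  then show ?thesis by (simp add: h_def)
qed

text \<open>Here \<open>a t\<close> stands for the sum over the other coordinates, so
  \<open>d = z x - z0\<close> is what one coordinate adds to the maximum. Its square is traded for a
  linear term: if \<open>y\<close> is the increment at a maximizer of \<open>a\<close>, then
  \<open>y \<le> d \<le> K\<close> gives \<open>d\<^sup>2 - y\<^sup>2 \<le> (d - y) / k\<close>, and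
  by the moment condition \<open>y\<^sup>2 - y / k\<close> has nonpositive mean. Linear increments
  can be added over the coordinates.\<close>

lemma (in prob_space) entropy_increment_bound:
  fixes W :: "'t \<Rightarrow> 'a \<Rightarrow> real" and a :: "'t \<Rightarrow> real"
  assumes T: "finite T" "T \<noteq> {}"
    and Wm: "\<And>t. t \<in> T \<Longrightarrow> W t \<in> borel_measurable M"
    and Wb: "\<And>t x. t \<in> T \<Longrightarrow> x \<in> space M \<Longrightarrow> \<bar>W t x\<bar> \<le> K"
    and mom: "\<And>t. t \<in> T \<Longrightarrow> k * (\<integral>x. (W t x)\<^sup>2 \<partial>M) \<le> (\<integral>x. W t x \<partial>M)"
    and k: "0 < k" "2 * K * k \<le> 1" and l: "0 < l" "exp (l * K) \<le> 2 * c" and K: "0 \<le> K"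
  defines "z \<equiv> \<lambda>x. Max ((\<lambda>t. a t + W t x) ` T)" and "z0 \<equiv> Max (a ` T)"
  shows "(\<integral>x. exp (l * z x) * (l * (z x - z0)) - exp (l * z x) + exp (l * z0) \<partial>M)
    \<le> c / k * l\<^sup>2 * (\<integral>x. (z x - z0) * exp (l * z x) \<partial>M)"
proof -
  have c: "0 < c" using l(2) exp_gt_zero[of "l*K"] by linarith
  obtain t0 where t0: "t0 \<in> T" "z0 = a t0"
    unfolding z0_def using Max_in[of "a ` T"] T by (auto simp del: Max_in)
  have zm[measurable]: "z \<in> borel_measurable M"
    unfolding z_def using T Wm by (intro borel_measurable_Max) auto
  have Ym[measurable]: "W t0 \<in> borel_measurable M" using Wm t0 by auto
  have Yd: "W t0 x \<le> z x - z0" for x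
  proof -
    have "a t0 + W t0 x \<le> z x" unfolding z_def using T t0 by (intro Max_ge) auto
    then show ?thesis using t0 by simp
  qed
  have dK: "z x - z0 \<le> K" if x: "x \<in> space M" for x
  proof -
    have "z x \<le> z0 + K"
    proof (unfold z_def, rule Max.boundedI)
      fix y assume "y \<in> (\<lambda>t. a t + W t x) ` T"
      then obtain t where t: "t \<in> T" "y = a t + W t x" by auto
      have "a t \<le> z0" unfolding z0_def using T t by (intro Max_ge) auto
      moreover have "W t x \<le> K" using Wb[OF t(1) x] by auto
      ultimately show "y \<le> z0 + K" using t by simp
    qed (use T in auto)
    then show ?thesis by simp
  qed
  have db: "\<bar>z x - z0\<bar> \<le> K" if x: "x \<in> space M" for x
    using dK[OF x] Yd[of x] Wb[OF t0(1) x] by auto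
  define A where "A = exp (l * z0)"
  have A: "0 < A" by (simp add: A_def)
  have eb: "exp (l * z x) \<le> exp (l * (z0 + K))" if x: "x \<in> space M" for x
    using dK[OF x] l by simp
  have ei: "integrable M (\<lambda>x. exp (l * z x))"
    using eb by (intro integrable_bounded[where B = "exp (l * (z0 + K))"]) auto
  have dei: "integrable M (\<lambda>x. (z x - z0) * exp (l * z x))"
  proof (rule integrable_bounded)
    fix x assume "x \<in> space M"
    then show "\<bar>(z x - z0) * exp (l * z x)\<bar> \<le> K * exp (l * (z0 + K))"
      unfolding abs_mult using eb db K by (intro mult_mono) auto
  qed measurable
  have Yi: "integrable M (W t0)"
    using Wb[OF t0(1)] by (intro integrable_bounded[where B = K]) auto
  have Yi2: "integrable M (\<lambda>x. (W t0 x)\<^sup>2)"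
  proof (rule integrable_bounded)
    show "\<bar>(W t0 x)\<^sup>2\<bar> \<le> K\<^sup>2" if "x \<in> space M" for x
      using power_mono[OF Wb[OF t0(1) that] abs_ge_zero, of 2] by simp
  qed measurable
  note Yi = Yi Yi2
  have pw: "exp (l * z x) * (l * (z x - z0)) - exp (l * z x) + exp (l * z0)
     \<le> c * l\<^sup>2 * (A * ((W t0 x)\<^sup>2 - W t0 x / k) + (z x - z0) * exp (l * z x) / k)" if x: "x \<in> space M" for x
  proof -
    define d where "d = z x - z0"
    define y where "y = W t0 x"
    have e: "exp (l * z x) = A * exp (l * d)"
      unfolding A_def d_def by (simp add: exp_add[symmetric] algebra_simps)
    have b: "y \<le> d" "d \<le> K" "y \<le> K" using Yd[of x] dK[OF x] Wb[OF t0(1) x] by (auto simp: d_def y_def)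
    have "exp (l * d) * (l * d - 1) + 1 \<le> c * (l * d)\<^sup>2"
      using l b K by (intro exp_entropy_bound[where U = "l * K"]) auto
    then have 1: "A * (exp (l * d) * (l * d - 1) + 1) \<le> A * (c * (l * d)\<^sup>2)"
      using A by (intro mult_left_mono) auto
    have "d\<^sup>2 - y\<^sup>2 = (d - y) * (d + y)" by (simp add: power2_eq_square algebra_simps)
    also have "\<dots> \<le> (d - y) * (1 / k)"
    proof (rule mult_left_mono)
      have "d + y \<le> 2 * K" using b by simp
      also have "\<dots> \<le> 1 / k" using k by (simp add: field_simps)
      finally show "d + y \<le> 1 / k" .
    qed (use b in auto)
    finally have 2: "d\<^sup>2 \<le> y\<^sup>2 - y / k + d / k" by (simp add: diff_divide_distrib)
    \<comment> \<open>True for either sign of \<open>d\<close>; it puts the weight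
      \<open>exp (l * z x)\<close> of the right-hand side onto the linear term.\<close>
    have 3: "d \<le> d * exp (l * d)"
    proof (cases "0 \<le> d")
      case True then show ?thesis using l by (simp add: mult_le_cancel_left1)
    next
      case False
      then have "exp (l * d) \<le> 1" using l by (simp add: mult_nonneg_nonpos)
      then show ?thesis using False by (simp add: mult_le_cancel_left2)
    qed
    have "A * (c * (l * d)\<^sup>2) = c * l\<^sup>2 * (A * d\<^sup>2)" by (simp add: power_mult_distrib)
    also have "\<dots> \<le> c * l\<^sup>2 * (A * (y\<^sup>2 - y / k + d * exp (l * d) / k))"
      using 2 3 A c l k
      by (intro mult_left_mono order_trans[OF 2] add_mono divide_right_mono) auto
    finally show ?thesis
      using 1 unfolding e A_def[symmetric] d_def[symmetric] y_def[symmetric] by (simp add: algebra_simps)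
  qed
  have "(\<integral>x. exp (l * z x) * (l * (z x - z0)) - exp (l * z x) + exp (l * z0) \<partial>M)
     \<le> (\<integral>x. c * l\<^sup>2 * (A * ((W t0 x)\<^sup>2 - W t0 x / k) + (z x - z0) * exp (l * z x) / k) \<partial>M)"
  proof (rule integral_mono)
    have "integrable M (\<lambda>x. l * ((z x - z0) * exp (l * z x)) - exp (l * z x) + exp (l * z0))"
      using dei ei by auto
    then show "integrable M (\<lambda>x. exp (l * z x) * (l * (z x - z0)) - exp (l * z x) + exp (l * z0))"
      by (simp add: mult_ac)
  qed (use pw Yi dei in auto)
  also have "\<dots> = c * l\<^sup>2 * (A * ((\<integral>x. (W t0 x)\<^sup>2 \<partial>M) - (\<integral>x. W t0 x \<partial>M) / k)
      + (\<integral>x. (z x - z0) * exp (l * z x) \<partial>M) / k)"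
    using Yi dei by simp
  also have "\<dots> \<le> c * l\<^sup>2 * (0 + (\<integral>x. (z x - z0) * exp (l * z x) \<partial>M) / k)"
  proof (intro mult_left_mono add_right_mono mult_nonneg_nonpos)
    show "(\<integral>x. (W t0 x)\<^sup>2 \<partial>M) - (\<integral>x. W t0 x \<partial>M) / k \<le> 0"
      using mom[OF t0(1)] k by (simp add: field_simps)
  qed (use A c in auto)
  finally show ?thesis by simp
qed

section \<open>Exponential moments and Herbst's argument\<close>

lemma abs_exp_minus_one_minus:
  "\<bar>exp u - 1 - u\<bar> \<le> exp \<bar>u\<bar> * u\<^sup>2" for u :: real
proof -
  obtain t where t: "\<bar>t\<bar> \<le> \<bar>u\<bar>" "exp u = (\<Sum>m<2. u ^ m / fact m) + exp t / fact 2 * u ^ 2"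
    using Maclaurin_exp_le[of u 2] by blast
  have "exp u - 1 - u = exp t * u\<^sup>2 / 2"
    using t(2) by (simp add: numeral_2_eq_2)
  moreover have "exp t * u\<^sup>2 / 2 \<le> exp \<bar>u\<bar> * u\<^sup>2"
  proof -
    have "exp t \<le> exp \<bar>u\<bar>" using t(1) by simp
    then have "exp t * u\<^sup>2 \<le> exp \<bar>u\<bar> * u\<^sup>2" by (intro mult_right_mono) auto
    moreover have "0 \<le> exp t * u\<^sup>2" by simp
    ultimately show ?thesis by linarith
  qed
  moreover have "0 \<le> exp t * u\<^sup>2 / 2" by simp
  ultimately show ?thesis by linarith
qed

text \<open>As \<open>Z\<close> is bounded, the second-order remainder of
  \<open>exp (h * Z x)\<close> is at most a constant times \<open>h\<^sup>2\<close>, uniformly in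
  \<open>x\<close>, so differentiation under the integral needs only this bound.\<close>

lemma (in prob_space) has_real_derivative_mgf:
  fixes Z :: "'a \<Rightarrow> real"
  assumes Zm[measurable]: "Z \<in> borel_measurable M" and Zb: "\<And>x. x \<in> space M \<Longrightarrow> \<bar>Z x\<bar> \<le> B"
  shows "((\<lambda>l. \<integral>x. exp (l * Z x) \<partial>M) has_real_derivative (\<integral>x. Z x * exp (l * Z x) \<partial>M)) (at l)"
proof -
  let ?F = "\<lambda>l. \<integral>x. exp (l * Z x) \<partial>M"
  let ?D = "\<integral>x. Z x * exp (l * Z x) \<partial>M"
  have B: "0 \<le> B" using Zb not_empty by fastforce
  have lZ: "l * Z x \<le> \<bar>l\<bar> * B" if "x \<in> space M" for x l
  proof -
    have "l * Z x \<le> \<bar>l\<bar> * \<bar>Z x\<bar>" by (simp add: abs_mult[symmetric])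
    also have "\<dots> \<le> \<bar>l\<bar> * B" using Zb[OF that] by (intro mult_left_mono) auto
    finally show ?thesis .
  qed
  have ei: "integrable M (\<lambda>x. exp (l * Z x))" for l
    using lZ by (intro integrable_bounded[where B = "exp (\<bar>l\<bar> * B)"]) auto
  have di: "integrable M (\<lambda>x. Z x * exp (l * Z x))"
  proof (rule integrable_bounded)
    fix x assume "x \<in> space M"
    then show "\<bar>Z x * exp (l * Z x)\<bar> \<le> B * exp (\<bar>l\<bar> * B)"
      unfolding abs_mult using lZ Zb B by (intro mult_mono) auto
  qed measurable
  define C where "C = exp (\<bar>l\<bar> * B) * (exp B * B\<^sup>2)"
  have main: "\<bar>?F (l + h) - ?F l - h * ?D\<bar> \<le> C * h\<^sup>2" if h: "\<bar>h\<bar> \<le> 1" for h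
  proof -
    have "?F (l + h) - ?F l - h * ?D = (\<integral>x. exp ((l + h) * Z x) - exp (l * Z x) - h * (Z x * exp (l * Z x)) \<partial>M)"
      using ei di by simp
    also have "\<bar>\<dots>\<bar> \<le> C * h\<^sup>2"
    proof -
      have b: "\<bar>exp ((l + h) * Z x) - exp (l * Z x) - h * (Z x * exp (l * Z x))\<bar> \<le> C * h\<^sup>2" if x: "x \<in> space M" for x
      proof -
        have "exp ((l + h) * Z x) - exp (l * Z x) - h * (Z x * exp (l * Z x)) = exp (l * Z x) * (exp (h * Z x) - 1 - h * Z x)"
          by (simp add: algebra_simps exp_add)
        also have "\<bar>\<dots>\<bar> \<le> exp (\<bar>l\<bar> * B) * (exp B * (B\<^sup>2 * h\<^sup>2))"
          unfolding abs_mult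
        proof (intro mult_mono)
          have hz: "\<bar>h * Z x\<bar> \<le> B"
            using mult_mono[OF h Zb[OF x]] by (simp add: abs_mult)
          have "(h * Z x)\<^sup>2 \<le> B\<^sup>2 * h\<^sup>2"
            using mult_right_mono[OF power_mono[OF Zb[OF x], of 2], of "h\<^sup>2"]
            unfolding power_mult_distrib by (simp only: power2_abs mult.commute zero_le_power2 abs_ge_zero)
          then show "\<bar>exp (h * Z x) - 1 - h * Z x\<bar> \<le> exp B * (B\<^sup>2 * h\<^sup>2)"
            using hz by (intro order_trans[OF abs_exp_minus_one_minus] mult_mono) auto
        qed (use lZ[OF x] in auto)
        finally show ?thesis by (simp add: C_def mult_ac)
      qed
      have i: "integrable M (\<lambda>x. exp ((l + h) * Z x) - exp (l * Z x) - h * (Z x * exp (l * Z x)))"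
        using ei di by auto
      show ?thesis
        using integral_between[OF i, of "- (C * h\<^sup>2)" "C * h\<^sup>2"] b by (simp add: abs_le_iff) (smt (verit, best))
    qed
    finally show ?thesis .
  qed
  have "((\<lambda>h. (?F (l + h) - ?F l) / h - ?D) \<longlongrightarrow> 0) (at 0)"
  proof (rule Lim_null_comparison)
    show "((\<lambda>h::real. C * \<bar>h\<bar>) \<longlongrightarrow> 0) (at 0)"
      by (rule tendsto_eq_intros | simp)+
    have "\<forall>\<^sub>F h::real in at 0. \<bar>h\<bar> < 1 \<and> h \<noteq> 0"
      unfolding eventually_at by (auto intro!: exI[of _ 1])
    then show "\<forall>\<^sub>F h in at 0. norm ((?F (l + h) - ?F l) / h - ?D) \<le> C * \<bar>h\<bar>"
    proof eventually_elim
      case (elim h)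
      have "(?F (l + h) - ?F l) / h - ?D = (?F (l + h) - ?F l - h * ?D) / h"
        using elim by (simp add: field_simps)
      moreover have "\<bar>?F (l + h) - ?F l - h * ?D\<bar> / \<bar>h\<bar> \<le> C * h\<^sup>2 / \<bar>h\<bar>"
        using main[of h] elim by (intro divide_right_mono) auto
      moreover have "h\<^sup>2 = \<bar>h\<bar> * \<bar>h\<bar>" by (simp add: power2_eq_square)
      then have "C * h\<^sup>2 / \<bar>h\<bar> = C * \<bar>h\<bar>"
        using elim by (simp del: abs_mult_self_eq)
      ultimately show ?case by simp
    qed
  qed
  then show ?thesis
    unfolding DERIV_def by (subst (asm) LIM_zero_iff)
qed

text \<open>Herbst's argument: the assumption says that \<open>ln E exp (l Z) * (1 / l - c)\<close> is nonincreasing in \<open>l\<close>.\<close>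

lemma (in prob_space) ln_mgf_le_of_entropy_bound:
  fixes Z :: "'a \<Rightarrow> real"
  assumes Zm[measurable]: "Z \<in> borel_measurable M" and Zb: "\<And>x. x \<in> space M \<Longrightarrow> \<bar>Z x\<bar> \<le> B"
    and l: "0 < l" "c * l < 1"
    and ent: "\<And>t. 0 < t \<Longrightarrow> t \<le> l \<Longrightarrow>
      t * (\<integral>x. Z x * exp (t * Z x) \<partial>M) - (\<integral>x. exp (t * Z x) \<partial>M) * ln (\<integral>x. exp (t * Z x) \<partial>M)
      \<le> c * t\<^sup>2 * (\<integral>x. Z x * exp (t * Z x) \<partial>M)"
  shows "ln (\<integral>x. exp (l * Z x) \<partial>M) \<le> l * (\<integral>x. Z x \<partial>M) / (1 - c * l)"
proof -
  define F where "F t = (\<integral>x. exp (t * Z x) \<partial>M)" for t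
  define D where "D t = (\<integral>x. Z x * exp (t * Z x) \<partial>M)" for t
  have F': "(F has_real_derivative D t) (at t)" for t
    unfolding F_def D_def by (rule has_real_derivative_mgf[OF Zm Zb])
  have Fpos: "0 < F t" for t
  proof -
    have b: "- (\<bar>t\<bar> * B) \<le> t * Z x \<and> t * Z x \<le> \<bar>t\<bar> * B" if "x \<in> space M" for x
    proof -
      have "\<bar>t * Z x\<bar> \<le> \<bar>t\<bar> * B" unfolding abs_mult using Zb[OF that] by (intro mult_left_mono) auto
      then show ?thesis by auto
    qed
    have "integrable M (\<lambda>x. exp (t * Z x))"
      using b by (intro integrable_bounded[where B = "exp (\<bar>t\<bar> * B)"]) auto
    then have "exp (- (\<bar>t\<bar> * B)) \<le> F t"
      unfolding F_def using b by (intro integral_between(1)) auto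
    then show ?thesis using exp_gt_zero less_le_trans by blast
  qed
  have F0: "F 0 = 1" "D 0 = (\<integral>x. Z x \<partial>M)" by (simp_all add: F_def D_def prob_space)
  define u where "u t = ln (F t) * (1 / t - c)" for t
  have mono: "u l \<le> u t" if t: "0 < t" "t \<le> l" for t
  proof (rule DERIV_nonpos_imp_nonincreasing[OF t(2)])
    fix x assume x: "t \<le> x" "x \<le> l"
    then have x0: "0 < x" using t by simp
    have "(u has_real_derivative D x / F x * (1 / x - c) - ln (F x) / x\<^sup>2) (at x)"
      unfolding u_def using x0 Fpos[of x]
      by (auto intro!: derivative_eq_intros F' simp: power2_eq_square field_simps)
    moreover have "D x / F x * (1 / x - c) - ln (F x) / x\<^sup>2
       = (x * D x - F x * ln (F x) - c * x\<^sup>2 * D x) / (F x * x\<^sup>2)"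
      using x0 Fpos[of x] by (simp add: field_simps power2_eq_square)
    moreover have "\<dots> \<le> 0"
      using ent[OF x0 x(2)] x0 Fpos[of x]
      by (intro divide_nonpos_pos) (auto simp: F_def D_def)
    ultimately show "\<exists>y. (u has_real_derivative y) (at x) \<and> y \<le> 0" by auto
  qed
  \<comment> \<open>\<open>u\<close> is undefined at \<open>0\<close>, so its value there is
    replaced by the limit: \<open>ln (F t) / t\<close> tends to the derivative of
    \<open>ln F\<close> at \<open>0\<close>, which is the mean of \<open>Z\<close>, and
    \<open>c * ln (F t)\<close> vanishes.\<close>
  have lnF: "((\<lambda>t. ln (F t)) has_real_derivative D 0) (at 0)"
    using Fpos[of 0] F0 by (auto intro!: derivative_eq_intros F')
  have "((\<lambda>t. ln (F t) / t) \<longlongrightarrow> D 0) (at 0)"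
    using lnF unfolding DERIV_def by (simp add: F0)
  then have l1: "((\<lambda>t. ln (F t) / t) \<longlongrightarrow> D 0) (at_right 0)"
    by (rule filterlim_mono) (auto simp: at_le)
  have "((\<lambda>t. ln (F t)) \<longlongrightarrow> ln (F 0)) (at 0)"
    using DERIV_isCont[OF lnF] by (simp add: isCont_def)
  then have l2: "((\<lambda>t. ln (F t)) \<longlongrightarrow> 0) (at_right 0)"
    unfolding F0 by (simp add: filterlim_mono at_le)
  have "((\<lambda>t. ln (F t) / t - c * ln (F t)) \<longlongrightarrow> D 0 - c * 0) (at_right 0)"
    by (intro tendsto_intros l1 l2)
  then have "(u \<longlongrightarrow> D 0) (at_right 0)"
    by (simp add: u_def[abs_def] algebra_simps)
  moreover have "\<forall>\<^sub>F t in at_right 0. u l \<le> u t"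
    using mono l(1) unfolding eventually_at_right_field by (intro exI[of _ l]) auto
  ultimately have "u l \<le> D 0"
    by (intro tendsto_lowerbound) auto
  then have "ln (F l) * (1 - c * l) \<le> l * D 0"
    using l(1) by (simp add: u_def field_simps)
  then show ?thesis
    using l(2) unfolding F0(2)[symmetric] F_def[symmetric] by (simp add: field_simps)
qed

text \<open>
  A one-sided Talagrand-type inequality. The moment condition is met by \<open>X + k Var X\<close> for a
  centred \<open>X\<close>, up to a factor \<open>1 + k\<^sup>2\<close>: adding a multiple of the variance to the process replaces
  the usual variance factor.
\<close>

lemma (in product_prob_space) ln_mgf_Max_sum_le:
  fixes W :: "'i \<Rightarrow> 't \<Rightarrow> 'a \<Rightarrow> real"
  assumes J: "finite J" and T: "finite T" "T \<noteq> {}"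
    and Wm: "\<And>i t. i \<in> J \<Longrightarrow> t \<in> T \<Longrightarrow> W i t \<in> borel_measurable (M i)"
    and Wb: "\<And>i t x. i \<in> J \<Longrightarrow> t \<in> T \<Longrightarrow> x \<in> space (M i) \<Longrightarrow> \<bar>W i t x\<bar> \<le> K"
    and mom: "\<And>i t. i \<in> J \<Longrightarrow> t \<in> T \<Longrightarrow> k * (\<integral>x. (W i t x)\<^sup>2 \<partial>M i) \<le> (\<integral>x. W i t x \<partial>M i)"
    and k: "0 < k" "2 * K * k \<le> 1" and K: "0 \<le> K"
    and l: "0 < l" "exp (l * K) \<le> 2 * c" "c / k * l < 1"
  defines "Z \<equiv> \<lambda>x. Max ((\<lambda>t. \<Sum>i\<in>J. W i t (x i)) ` T)"
  shows "ln (\<integral>x. exp (l * Z x) \<partial>PiM J M) \<le> l * (\<integral>x. Z x \<partial>PiM J M) / (1 - c / k * l)"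
proof -
  interpret PJ: prob_space "PiM J M" by (rule prob_space_product)
  have c: "0 < c" using l(2) exp_gt_zero[of "l*K"] by linarith
  define B where "B = real (card J) * K"
  have B: "0 \<le> B" using K by (simp add: B_def)
  have sb: "\<bar>\<Sum>i\<in>I. W i t (x i)\<bar> \<le> B" if "t \<in> T" "x \<in> space (PiM J M)" "I \<subseteq> J" for t x I
  proof -
    have "\<bar>\<Sum>i\<in>I. W i t (x i)\<bar> \<le> (\<Sum>i\<in>I. K)"
      using that Wb by (intro order_trans[OF sum_abs] sum_mono) (auto simp: space_PiM PiE_iff)
    also have "\<dots> \<le> B"
      using that(3) J K by (auto simp: B_def intro!: mult_right_mono card_mono)
    finally show ?thesis .
  qed
  define Zi where "Zi i x = Max ((\<lambda>t. \<Sum>j\<in>J - {i}. W j t (x j)) ` T)" for i x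
  have Mb: "\<bar>Max (h ` T)\<bar> \<le> B" if "\<And>t. t \<in> T \<Longrightarrow> \<bar>h t\<bar> \<le> B" for h :: "'t \<Rightarrow> real"
    using Max_in[of "h ` T"] T that by (auto simp del: Max_in)
  have Zb: "\<bar>Z x\<bar> \<le> B" if "x \<in> space (PiM J M)" for x
    unfolding Z_def using sb that by (intro Mb) auto
  have Zib: "\<bar>Zi i x\<bar> \<le> B" if "x \<in> space (PiM J M)" for i x
    unfolding Zi_def using sb that by (intro Mb) auto
  have Wm': "(\<lambda>x. W i t (x i)) \<in> borel_measurable (PiM J M)" if "i \<in> J" "t \<in> T" for i t
    using measurable_component_singleton[OF that(1)] Wm[OF that] by (rule measurable_compose)
  have Zm[measurable]: "Z \<in> borel_measurable (PiM J M)"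
    unfolding Z_def using T Wm' by (intro borel_measurable_Max borel_measurable_sum) auto
  have Zim[measurable]: "Zi i \<in> borel_measurable (PiM J M)" for i
    unfolding Zi_def using T Wm' by (intro borel_measurable_Max borel_measurable_sum) auto
  show ?thesis
  proof (rule PJ.ln_mgf_le_of_entropy_bound[OF Zm Zb l(1,3)])
    fix r assume r: "0 < r" "r \<le> l"
    have rK: "exp (r * K) \<le> 2 * c"
    proof -
      have "exp (r * K) \<le> exp (l * K)" using r K by (simp add: mult_right_mono)
      then show ?thesis using l by linarith
    qed
    let ?f = "\<lambda>x. exp (r * Z x)" and ?g = "\<lambda>i x. exp (r * Zi i x)"
    have eb: "exp (- (r * B)) \<le> exp (r * y) \<and> exp (r * y) \<le> exp (r * B)" if "\<bar>y\<bar> \<le> B" for y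
    proof -
      have "r * y \<le> r * B" "r * (- y) \<le> r * B" by (rule mult_left_mono; use that r in linarith)+
      then show ?thesis by auto
    qed
    have ent: "(\<integral>x. ?f x * ln (?f x) \<partial>PiM J M) - (\<integral>x. ?f x \<partial>PiM J M) * ln (\<integral>x. ?f x \<partial>PiM J M)
      \<le> (\<Sum>i\<in>J. \<integral>x. ?f x * ln (?f x / ?g i x) - ?f x + ?g i x \<partial>PiM J M)"
    proof (rule entropy_tensorization[OF J, where a = "exp (- (r * B))" and b = "exp (r * B)"])
      fix i x z assume "i \<in> J" "x \<in> space (PiM J M)" "z \<in> space (M i)"
      have "(\<Sum>j\<in>J - {i}. W j t ((x(i := z)) j)) = (\<Sum>j\<in>J - {i}. W j t (x j))" for t
        by (intro sum.cong) auto
      then show "?g i (x(i := z)) = ?g i x" unfolding Zi_def by simp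
    qed (use eb Zb Zib in auto)
    let ?h = "\<lambda>i x. exp (r * Z x) * (r * (Z x - Zi i x)) - exp (r * Z x) + exp (r * Zi i x)"
    let ?d = "\<lambda>i x. (Z x - Zi i x) * exp (r * Z x)"
    have ebz: "exp (r * Z x) \<le> exp (r * B)" "exp (r * Zi i x) \<le> exp (r * B)" if "x \<in> space (PiM J M)" for x i
      using eb Zb[OF that] Zib[OF that] by auto
    have dI: "integrable (PiM J M) (?d i)" for i
    proof (rule PJ.integrable_bounded[where B = "(B + B) * exp (r * B)"])
      fix x assume "x \<in> space (PiM J M)"
      then show "\<bar>?d i x\<bar> \<le> (B + B) * exp (r * B)"
        using Zb[of x] Zib[of x i] ebz[of x] B unfolding abs_mult by (intro mult_mono) auto
    qed measurable
    have eI: "integrable (PiM J M) (\<lambda>x. exp (r * Z x))" "integrable (PiM J M) (\<lambda>x. exp (r * Zi i x))" for i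
      using ebz by (auto intro!: PJ.integrable_bounded[where B = "exp (r * B)"])
    have hI: "integrable (PiM J M) (?h i)" for i
    proof -
      have "integrable (PiM J M) (\<lambda>x. r * ?d i x - exp (r * Z x) + exp (r * Zi i x))"
        using dI eI by auto
      then show ?thesis by (simp add: mult_ac)
    qed
    have step: "(\<integral>x. ?h i x \<partial>PiM J M) \<le> c / k * r\<^sup>2 * (\<integral>x. ?d i x \<partial>PiM J M)" if i: "i \<in> J" for i
    proof -
      let ?I = "J - {i}"
      have JI: "J = insert i ?I" "finite ?I" "i \<notin> ?I" using i J by auto
      interpret PI: prob_space "PiM ?I M" by (rule prob_space_product)
      have up: "y(i := z) \<in> space (PiM J M)" if "y \<in> space (PiM ?I M)" "z \<in> space (M i)" for y z
        using that i by (auto simp: space_PiM PiE_iff extensional_def)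
      have fub: "(\<integral>x. h x \<partial>PiM J M) = (\<integral>y. (\<integral>z. h (y(i := z)) \<partial>M i) \<partial>PiM ?I M)"
        if "integrable (PiM J M) h" for h :: "_ \<Rightarrow> real"
        using product_integral_insert[OF JI(2,3), of h] that JI(1) by simp
      have fubI: "integrable (PiM ?I M) (\<lambda>y. (\<integral>z. h (y(i := z)) \<partial>M i))"
        if h: "h \<in> borel_measurable (PiM J M)" and C: "\<And>x. x \<in> space (PiM J M) \<Longrightarrow> \<bar>h x\<bar> \<le> C"
        for h :: "_ \<Rightarrow> real" and C
      proof (rule PI.integrable_bounded)
        have "(\<lambda>(y, z). y(i := z)) \<in> PiM ?I M \<Otimes>\<^sub>M M i \<rightarrow>\<^sub>M PiM J M"
          using measurable_add_dim[of i ?I M] JI(1) by simp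
        from measurable_comp[OF this h]
        show "(\<lambda>y. (\<integral>z. h (y(i := z)) \<partial>M i)) \<in> borel_measurable (PiM ?I M)"
          by (intro M.borel_measurable_lebesgue_integral) (simp add: comp_def split_beta')
        fix y assume y: "y \<in> space (PiM ?I M)"
        have "(\<lambda>z. y(i := z)) \<in> M i \<rightarrow>\<^sub>M PiM (insert i ?I) M"
          using y by measurable
        then have "(\<lambda>z. y(i := z)) \<in> M i \<rightarrow>\<^sub>M PiM J M"
          unfolding JI(1)[symmetric] .
        then have "(\<lambda>z. h (y(i := z))) \<in> borel_measurable (M i)"
          using h by (rule measurable_compose)
        then have "integrable (M i) (\<lambda>z. h (y(i := z)))"
          using C up[OF y] by (intro M.integrable_bounded[where B = C]) auto
        then show "\<bar>\<integral>z. h (y(i := z)) \<partial>M i\<bar> \<le> C"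
          using M.integral_between[of i "\<lambda>z. h (y(i := z))" "- C" C] C[OF up[OF y]]
          by (simp add: abs_le_iff) (smt (verit, best))
      qed
      have Zi_up: "Zi i (y(i := z)) = Max ((\<lambda>t. \<Sum>j\<in>?I. W j t (y j)) ` T)" for y z
      proof -
        have "(\<Sum>j\<in>?I. W j t ((y(i := z)) j)) = (\<Sum>j\<in>?I. W j t (y j))" for t
          by (intro sum.cong) auto
        then show ?thesis unfolding Zi_def by simp
      qed
      have Z_up: "Z (y(i := z)) = Max ((\<lambda>t. (\<Sum>j\<in>?I. W j t (y j)) + W i t z) ` T)" for y z
      proof -
        have "(\<Sum>j\<in>J. W j t ((y(i := z)) j)) = W i t z + (\<Sum>j\<in>?I. W j t (y j))" for t
          unfolding sum.remove[OF J i, of "\<lambda>j. W j t ((y(i := z)) j)"] by (auto intro!: sum.cong)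
        then show ?thesis unfolding Z_def by (simp add: add.commute)
      qed
      \<comment> \<open>With the other coordinates frozen at \<open>y\<close>, \<open>Zi i\<close>
        is the constant \<open>z0\<close> and \<open>Z\<close> the maximum \<open>z\<close> of the
        one-coordinate bound; Fubini integrates over \<open>y\<close> afterwards.\<close>
      have "(\<integral>z. ?h i (y(i := z)) \<partial>M i) \<le> c / k * r\<^sup>2 * (\<integral>z. ?d i (y(i := z)) \<partial>M i)"
        if y: "y \<in> space (PiM ?I M)" for y
        unfolding Zi_up unfolding Z_up
        using T Wm[OF i] Wb[OF i] mom[OF i] k r(1) rK K by (rule M.entropy_increment_bound)
      then have "(\<integral>y. (\<integral>z. ?h i (y(i := z)) \<partial>M i) \<partial>PiM ?I M)
          \<le> (\<integral>y. c / k * r\<^sup>2 * (\<integral>z. ?d i (y(i := z)) \<partial>M i) \<partial>PiM ?I M)"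
      proof (intro integral_mono)
        show "integrable (PiM ?I M) (\<lambda>y. (\<integral>z. ?h i (y(i := z)) \<partial>M i))"
        proof (rule fubI)
          fix x assume x: "x \<in> space (PiM J M)"
          have 1: "\<bar>exp (r * Z x) * (r * (Z x - Zi i x))\<bar> \<le> exp (r * B) * (r * (B + B))"
            using Zb[OF x] Zib[OF x, of i] ebz[OF x] B r unfolding abs_mult by (intro mult_mono) auto
          have 2: "\<bar>exp (r * Z x)\<bar> \<le> exp (r * B)" "\<bar>exp (r * Zi i x)\<bar> \<le> exp (r * B)"
            using ebz[OF x] by auto
          show "\<bar>?h i x\<bar> \<le> exp (r * B) * (r * (B + B)) + exp (r * B) + exp (r * B)"
            using 1 2 by linarith
        qed measurable
        show "integrable (PiM ?I M) (\<lambda>y. c / k * r\<^sup>2 * (\<integral>z. ?d i (y(i := z)) \<partial>M i))"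
        proof (rule integrable_mult_right, rule fubI)
          fix x assume "x \<in> space (PiM J M)"
          then show "\<bar>?d i x\<bar> \<le> (B + B) * exp (r * B)"
            using Zb[of x] Zib[of x i] ebz[of x] B unfolding abs_mult by (intro mult_mono) auto
        qed measurable
      qed
      then show ?thesis unfolding fub[OF hI] fub[OF dI] by simp
    qed
    \<comment> \<open>Self-bounding property: at an index \<open>t\<close> attaining
      \<open>Z x\<close>, omitting coordinate \<open>i\<close> loses at most
      \<open>W i t (x i)\<close>, and these terms add up to \<open>Z x\<close>. This closes the
      inequality required by Herbst's argument.\<close>
    have le: "(\<Sum>i\<in>J. ?d i x) \<le> Z x * exp (r * Z x)" for x
    proof -
      obtain t where t: "t \<in> T" "Z x = (\<Sum>i\<in>J. W i t (x i))"
        unfolding Z_def using Max_in[of "(\<lambda>t. \<Sum>i\<in>J. W i t (x i)) ` T"] T by (auto simp del: Max_in)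
      have "Z x - Zi i x \<le> W i t (x i)" if "i \<in> J" for i
      proof -
        have "(\<Sum>j\<in>J - {i}. W j t (x j)) \<le> Zi i x"
          unfolding Zi_def using T t by (intro Max_ge) auto
        then show ?thesis unfolding t(2) using sum.remove[OF J that, of "\<lambda>i. W i t (x i)"] by simp
      qed
      then have "(\<Sum>i\<in>J. Z x - Zi i x) \<le> Z x" unfolding t(2) by (intro sum_mono) auto
      then show ?thesis unfolding sum_distrib_right[symmetric] by (intro mult_right_mono) auto
    qed
    have zeI: "integrable (PiM J M) (\<lambda>x. Z x * exp (r * Z x))"
    proof (rule PJ.integrable_bounded[where B = "B * exp (r * B)"])
      fix x assume "x \<in> space (PiM J M)"
      then show "\<bar>Z x * exp (r * Z x)\<bar> \<le> B * exp (r * B)"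
        using Zb[of x] ebz[of x] B unfolding abs_mult by (intro mult_mono) auto
    qed measurable
    have lnq: "ln (?f x / ?g i x) = r * (Z x - Zi i x)" for i x
      by (simp add: ln_div right_diff_distrib)
    have "(\<integral>x. ?f x * ln (?f x) \<partial>PiM J M) - (\<integral>x. ?f x \<partial>PiM J M) * ln (\<integral>x. ?f x \<partial>PiM J M)
      \<le> (\<Sum>i\<in>J. \<integral>x. ?h i x \<partial>PiM J M)"
      using ent unfolding lnq .
    also have "\<dots> \<le> (\<Sum>i\<in>J. c / k * r\<^sup>2 * (\<integral>x. ?d i x \<partial>PiM J M))"
      by (intro sum_mono step)
    also have "\<dots> = c / k * r\<^sup>2 * (\<integral>x. (\<Sum>i\<in>J. ?d i x) \<partial>PiM J M)"
      using dI by (simp add: sum_distrib_left)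
    also have "\<dots> \<le> c / k * r\<^sup>2 * (\<integral>x. Z x * exp (r * Z x) \<partial>PiM J M)"
      using c k le dI zeI by (intro mult_left_mono integral_mono) auto
    finally have *: "(\<integral>x. ?f x * ln (?f x) \<partial>PiM J M) - (\<integral>x. ?f x \<partial>PiM J M) * ln (\<integral>x. ?f x \<partial>PiM J M)
      \<le> c / k * r\<^sup>2 * (\<integral>x. Z x * exp (r * Z x) \<partial>PiM J M)" .
    show "r * (\<integral>x. Z x * exp (r * Z x) \<partial>PiM J M) - (\<integral>x. ?f x \<partial>PiM J M) * ln (\<integral>x. ?f x \<partial>PiM J M)
      \<le> c / k * r\<^sup>2 * (\<integral>x. Z x * exp (r * Z x) \<partial>PiM J M)"
    proof -
      have e: "(\<integral>x. ?f x * ln (?f x) \<partial>PiM J M) = (\<integral>x. r * (Z x * exp (r * Z x)) \<partial>PiM J M)"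
        by (intro Bochner_Integration.integral_cong) simp_all
      show ?thesis using *[unfolded e] by simp
    qed
  qed
qed

subsection \<open>Hellinger distance and the function \<open>psi\<close>\<close>

text \<open>One formula covers all conventions: at \<open>b = 0 < a\<close> it gives the value
  \<open>1\<close> of \<open>psi\<close> at infinity, and at \<open>a = b = 0\<close> division by
  zero gives \<open>0\<close>, the value of \<open>psi\<close> at \<open>1\<close>. It also makes
  the antisymmetry evident.\<close>

lemma psi_sqrt_ratio:
  "0 \<le> a \<Longrightarrow> 0 \<le> b \<Longrightarrow> psi (sqrt_ratio a b) = (sqrt a - sqrt b) / (sqrt a + sqrt b)"
proof (cases "b = 0")
  case False
  assume "0 \<le> a" "0 \<le> b"
  then have b: "0 < sqrt b" using False by simp
  have "psi (sqrt_ratio a b) = (sqrt a / sqrt b - 1) / (sqrt a / sqrt b + 1)"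
    using False by (simp add: psi_def sqrt_ratio_def real_sqrt_divide)
  also have "\<dots> = (sqrt a / sqrt b - 1) * sqrt b / ((sqrt a / sqrt b + 1) * sqrt b)"
    using b by simp
  also have "\<dots> = (sqrt a - sqrt b) / (sqrt a + sqrt b)"
    using b by (simp add: left_diff_distrib distrib_right)
  finally show ?thesis .
qed (auto simp: psi_def sqrt_ratio_def)

lemma psi_sqrt_ratio_swap:
  "0 \<le> a \<Longrightarrow> 0 \<le> b \<Longrightarrow> psi (sqrt_ratio a b) = - psi (sqrt_ratio b a)"
  by (simp add: psi_sqrt_ratio minus_divide_left add.commute)

lemma abs_psi_sqrt_ratio_le:
  assumes "0 \<le> a" "0 \<le> b"
  shows "\<bar>psi (sqrt_ratio a b)\<bar> \<le> 1"
proof -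
  have "\<bar>sqrt a - sqrt b\<bar> \<le> sqrt a + sqrt b"
    using assms by (simp add: abs_le_iff)
  then have "\<bar>sqrt a - sqrt b\<bar> / (sqrt a + sqrt b) \<le> 1"
    using assms by (auto intro!: divide_le_eq_1[THEN iffD2] simp: less_le)
  then show ?thesis
    using assms by (simp add: psi_sqrt_ratio abs_divide)
qed

lemma measurable_psi_sqrt_ratio [measurable (raw)]:
  assumes [measurable]: "f \<in> borel_measurable M" "g \<in> borel_measurable M"
    and "\<And>x. x \<in> space M \<Longrightarrow> 0 \<le> f x" "\<And>x. x \<in> space M \<Longrightarrow> 0 \<le> g x"
  shows "(\<lambda>x. psi (sqrt_ratio (f x) (g x))) \<in> borel_measurable M"
proof -
  have "(\<lambda>x. (sqrt (f x) - sqrt (g x)) / (sqrt (f x) + sqrt (g x))) \<in> borel_measurable M"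
    by measurable
  then show ?thesis
    using assms(3,4) by (subst measurable_cong) (auto simp: psi_sqrt_ratio)
qed

text \<open>
  With \<open>a\<close>, \<open>b\<close>, \<open>c\<close> the square roots of the densities of the data, of \<open>P\<close> and of \<open>Q\<close>, the term
  \<open>(c\<^sup>2 - b\<^sup>2) / 4\<close> integrates to \<open>0\<close>; its coefficient is forced by tangency at \<open>a = b = c\<close>.
\<close>

lemma psi_drift_pointwise:
  fixes a b c :: real
  assumes nn: "0 \<le> a" "0 \<le> b" "0 \<le> c"
  shows "a\<^sup>2 * ((c - b) / (c + b)) \<le> 2 * (a - b)\<^sup>2 - 3/16 * (a - c)\<^sup>2 + (c\<^sup>2 - b\<^sup>2) / 4"
proof (cases "c + b = 0")
  case True
  then have "c = 0" "b = 0" using nn by auto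
  then show ?thesis by simp
next
  case False
  define s where "s = c + b"
  have s: "0 < s" using False nn by (simp add: s_def)
  \<comment> \<open>This is \<open>16\<close> times the slack after multiplication by
    \<open>s\<close>. Only the factor \<open>28 * s - 8 * a\<close> can be negative; then
    \<open>a\<close> exceeds \<open>s\<close>, hence also \<open>b\<close> and \<open>c\<close>, and
    the worst case is \<open>b = 0\<close>, \<open>c = s\<close>.\<close>
  have key: "0 \<le> (c - a)\<^sup>2 * (8 * a + s) + (b - a)\<^sup>2 * (28 * s - 8 * a)"
  proof (cases "8 * a \<le> 28 * s")
    case True then show ?thesis using nn s by simp
  next
    case False
    have 1: "(a - s)\<^sup>2 \<le> (c - a)\<^sup>2"
      using nn False s by (simp add: power2_commute[of c a] s_def power_mono)
    have "(b - a)\<^sup>2 \<le> a\<^sup>2"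
      using nn False s by (simp add: power2_commute[of b a] s_def power_mono)
    then have 2: "a\<^sup>2 * (28 * s - 8 * a) \<le> (b - a)\<^sup>2 * (28 * s - 8 * a)"
      using False by (intro mult_right_mono_neg) auto
    have "(a - s)\<^sup>2 * (8 * a + s) \<le> (c - a)\<^sup>2 * (8 * a + s)"
      using 1 nn s by (intro mult_right_mono) auto
    moreover have "(a - s)\<^sup>2 * (8 * a + s) + a\<^sup>2 * (28 * s - 8 * a) = 13 * a\<^sup>2 * s + 6 * a * s\<^sup>2 + s ^ 3"
      by (simp add: power2_eq_square power3_eq_cube algebra_simps)
    moreover have "0 \<le> 13 * a\<^sup>2 * s + 6 * a * s\<^sup>2 + s ^ 3" using nn s by simp
    ultimately show ?thesis using 2 by linarith
  qed
  define X where "X = 2 * (a - b)\<^sup>2 - 3/16 * (a - c)\<^sup>2 + (c\<^sup>2 - b\<^sup>2) / 4"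
  have "X * s - a\<^sup>2 * (c - b)
      = ((c - a)\<^sup>2 * (8 * a + s) + (b - a)\<^sup>2 * (28 * s - 8 * a)) / 16"
    unfolding s_def X_def by (simp add: power2_eq_square field_simps)
  with key have "0 \<le> X * s - a\<^sup>2 * (c - b)" by simp
  then have "a\<^sup>2 * (c - b) \<le> X * s" by simp
  then have "a\<^sup>2 * (c - b) / s \<le> X"
    using s by (simp only: pos_divide_le_eq)
  then show ?thesis by (simp add: s_def X_def)
qed

text \<open>In terms of \<open>s = c + b\<close> and \<open>d = c - b\<close> the right-hand side is
  \<open>2 * (a - s / 2)\<^sup>2 + d\<^sup>2 / 2\<close>. The last term suffices if
  \<open>a\<^sup>2 \<le> s\<^sup>2 / 2\<close>; otherwise the worst case is
  \<open>d\<^sup>2 = s\<^sup>2\<close>, where the slack is a multiple of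
  \<open>(a - s)\<^sup>2\<close>.\<close>

lemma psi_variance_pointwise:
  fixes a b c :: real
  assumes nn: "0 \<le> a" "0 \<le> b" "0 \<le> c"
  shows "a\<^sup>2 * ((c - b) / (c + b))\<^sup>2 \<le> (a - b)\<^sup>2 + (a - c)\<^sup>2"
proof (cases "c + b = 0")
  case False
  define s d where "s = c + b" and "d = c - b"
  have s: "0 < s" using False nn by (simp add: s_def)
  have "s\<^sup>2 - d\<^sup>2 = 4 * b * c" by (simp add: s_def d_def power2_eq_square algebra_simps)
  then have ds: "d\<^sup>2 \<le> s\<^sup>2" using mult_nonneg_nonneg[OF nn(2,3)] by simp
  have e: "(a - b)\<^sup>2 + (a - c)\<^sup>2 = 2 * (a - s / 2)\<^sup>2 + d\<^sup>2 / 2"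
    unfolding s_def d_def by (simp add: power2_eq_square field_simps)
  have "a\<^sup>2 * d\<^sup>2 \<le> s\<^sup>2 * (2 * (a - s / 2)\<^sup>2 + d\<^sup>2 / 2)"
  proof (cases "a\<^sup>2 \<le> s\<^sup>2 / 2")
    case True
    then have "a\<^sup>2 * d\<^sup>2 \<le> s\<^sup>2 / 2 * d\<^sup>2" by (intro mult_right_mono) auto
    moreover have "0 \<le> s\<^sup>2 * (2 * (a - s / 2)\<^sup>2)" by simp
    moreover have "s\<^sup>2 * (2 * (a - s / 2)\<^sup>2 + d\<^sup>2 / 2) = s\<^sup>2 * (2 * (a - s / 2)\<^sup>2) + s\<^sup>2 / 2 * d\<^sup>2"
      by (simp add: distrib_left)
    ultimately show ?thesis by linarith
  next
    case False
    have "(a\<^sup>2 - s\<^sup>2 / 2) * d\<^sup>2 \<le> (a\<^sup>2 - s\<^sup>2 / 2) * s\<^sup>2"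
      using False ds by (intro mult_left_mono) auto
    also have "\<dots> \<le> (2 * (a - s / 2)\<^sup>2) * s\<^sup>2"
    proof (rule mult_right_mono)
      have "2 * (a - s / 2)\<^sup>2 - (a\<^sup>2 - s\<^sup>2 / 2) = (a - s)\<^sup>2"
        by (simp add: power2_eq_square field_simps)
      then show "a\<^sup>2 - s\<^sup>2 / 2 \<le> 2 * (a - s / 2)\<^sup>2" by (smt (verit) zero_le_power2)
    qed simp
    finally show ?thesis by (simp add: algebra_simps)
  qed
  then have "a\<^sup>2 * d\<^sup>2 / s\<^sup>2 \<le> (a - b)\<^sup>2 + (a - c)\<^sup>2"
    unfolding e using s by (simp add: pos_divide_le_eq mult.commute)
  then show ?thesis by (simp add: s_def d_def power_divide)
qed simp

section \<open>Hellinger distances through densities\<close>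

lemma hellinger_sq_nonneg [simp]: "0 \<le> hellinger_sq P Q"
  by (simp add: hellinger_sq_def)

lemma hellinger_power2 [simp]: "(hellinger P Q)\<^sup>2 = hellinger_sq P Q"
  by (simp add: hellinger_def)

lemma hellinger_nonneg [simp]: "0 \<le> hellinger P Q"
  by (simp add: hellinger_def)

lemma hellinger_commute: "hellinger P Q = hellinger Q P"
  using Metric_space.commute[OF Metric_space_hellinger] .

lemma hellinger_triangle:
  assumes "P \<in> space (prob_algebra S)" "Q \<in> space (prob_algebra S)" "R \<in> space (prob_algebra S)"
  shows "hellinger P R \<le> hellinger P Q + hellinger Q R"
  using Metric_space.triangle[OF Metric_space_hellinger assms] .

lemma AE_RN_deriv_density_real:
  assumes "sigma_finite_measure \<nu>" "f \<in> borel_measurable \<nu>" "\<And>x. x \<in> space \<nu> \<Longrightarrow> 0 \<le> f x"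
  shows "AE x in \<nu>. enn2real (RN_deriv \<nu> (density \<nu> (\<lambda>x. ennreal (f x))) x) = f x"
proof -
  interpret sigma_finite_measure \<nu> by fact
  have "AE x in \<nu>. ennreal (f x) = RN_deriv \<nu> (density \<nu> (\<lambda>x. ennreal (f x))) x"
    using assms(2) by (intro RN_deriv_unique) auto
  then show ?thesis using AE_space
  proof eventually_elim
    case (elim x)
    show ?case using assms(3)[OF elim(2)] unfolding elim(1)[symmetric] by simp
  qed
qed

lemma prob_density_integral:
  fixes f :: "'a \<Rightarrow> real"
  assumes f[measurable]: "f \<in> borel_measurable \<nu>" and nn: "\<And>x. x \<in> space \<nu> \<Longrightarrow> 0 \<le> f x"
    and p: "prob_space (density \<nu> (\<lambda>x. ennreal (f x)))"
  shows "integrable \<nu> f" "(\<integral>x. f x \<partial>\<nu>) = 1"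
proof -
  have "(\<integral>\<^sup>+x. ennreal (f x) \<partial>\<nu>) = emeasure (density \<nu> (\<lambda>x. ennreal (f x))) (space \<nu>)"
    by (subst emeasure_density) (auto intro!: nn_integral_cong simp: indicator_def)
  also have "\<dots> = 1" using prob_space.emeasure_space_1[OF p] by simp
  finally have 1: "(\<integral>\<^sup>+x. ennreal (f x) \<partial>\<nu>) = 1" .
  show i: "integrable \<nu> f"
    using nn 1 by (intro integrableI_nonneg AE_I2) auto
  have "ennreal (\<integral>x. f x \<partial>\<nu>) = 1"
    using nn_integral_eq_integral[OF i] nn 1 by (simp add: AE_I2)
  then show "(\<integral>x. f x \<partial>\<nu>) = 1" by (simp add: ennreal_eq_1)
qed

lemma hellinger_sq_density:
  fixes f g :: "'a \<Rightarrow> real"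
  assumes \<nu>: "sigma_finite_measure \<nu>" "sets \<nu> = sets S"
    and f[measurable]: "f \<in> borel_measurable \<nu>" and fn: "\<And>x. x \<in> space \<nu> \<Longrightarrow> 0 \<le> f x"
    and g[measurable]: "g \<in> borel_measurable \<nu>" and gn: "\<And>x. x \<in> space \<nu> \<Longrightarrow> 0 \<le> g x"
    and P: "density \<nu> (\<lambda>x. ennreal (f x)) \<in> space (prob_algebra S)"
    and Q: "density \<nu> (\<lambda>x. ennreal (g x)) \<in> space (prob_algebra S)"
  shows "hellinger_sq (density \<nu> (\<lambda>x. ennreal (f x))) (density \<nu> (\<lambda>x. ennreal (g x)))
      = 1/2 * (\<integral>x. (sqrt (f x) - sqrt (g x))\<^sup>2 \<partial>\<nu>)"
    and "integrable \<nu> (\<lambda>x. (sqrt (f x) - sqrt (g x))\<^sup>2)"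
    and "(\<integral>x. (sqrt (f x) - sqrt (g x))\<^sup>2 \<partial>\<nu>) \<le> 2"
proof -
  have "hellinger_sq (density \<nu> (\<lambda>x. ennreal (f x))) (density \<nu> (\<lambda>x. ennreal (g x)))
     = 1/2 * (\<integral>x. (sqrt (enn2real (RN_deriv \<nu> (density \<nu> (\<lambda>x. ennreal (f x))) x))
        - sqrt (enn2real (RN_deriv \<nu> (density \<nu> (\<lambda>x. ennreal (g x))) x)))\<^sup>2 \<partial>\<nu>)"
    using \<nu> P Q by (intro hellinger_sq_dominating absolutely_continuousI_density) auto
  also have "(\<integral>x. (sqrt (enn2real (RN_deriv \<nu> (density \<nu> (\<lambda>x. ennreal (f x))) x))
        - sqrt (enn2real (RN_deriv \<nu> (density \<nu> (\<lambda>x. ennreal (g x))) x)))\<^sup>2 \<partial>\<nu>)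
      = (\<integral>x. (sqrt (f x) - sqrt (g x))\<^sup>2 \<partial>\<nu>)"
  proof (rule integral_cong_AE)
    show "AE x in \<nu>. (sqrt (enn2real (RN_deriv \<nu> (density \<nu> (\<lambda>x. ennreal (f x))) x))
        - sqrt (enn2real (RN_deriv \<nu> (density \<nu> (\<lambda>x. ennreal (g x))) x)))\<^sup>2
        = (sqrt (f x) - sqrt (g x))\<^sup>2"
    proof -
      have "AE x in \<nu>. enn2real (RN_deriv \<nu> (density \<nu> (\<lambda>x. ennreal (f x))) x) = f x"
        using \<nu>(1) f fn by (rule AE_RN_deriv_density_real)
      moreover have "AE x in \<nu>. enn2real (RN_deriv \<nu> (density \<nu> (\<lambda>x. ennreal (g x))) x) = g x"
        using \<nu>(1) g gn by (rule AE_RN_deriv_density_real)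
      ultimately show ?thesis by eventually_elim simp
    qed
  qed measurable
  finally show "hellinger_sq (density \<nu> (\<lambda>x. ennreal (f x))) (density \<nu> (\<lambda>x. ennreal (g x)))
      = 1/2 * (\<integral>x. (sqrt (f x) - sqrt (g x))\<^sup>2 \<partial>\<nu>)" .
  have pr: "prob_space (density \<nu> (\<lambda>x. ennreal (f x)))" "prob_space (density \<nu> (\<lambda>x. ennreal (g x)))"
    using P Q by (auto simp: space_prob_algebra)
  note If = prob_density_integral[OF f fn pr(1)] and Ig = prob_density_integral[OF g gn pr(2)]
  have le: "(sqrt (f x) - sqrt (g x))\<^sup>2 \<le> f x + g x" if "x \<in> space \<nu>" for x
    using fn[OF that] gn[OF that] by (simp add: power2_diff)
  show i: "integrable \<nu> (\<lambda>x. (sqrt (f x) - sqrt (g x))\<^sup>2)"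
  proof (rule Bochner_Integration.integrable_bound)
    show "integrable \<nu> (\<lambda>x. f x + g x)" using If Ig by simp
    show "AE x in \<nu>. norm ((sqrt (f x) - sqrt (g x))\<^sup>2) \<le> norm (f x + g x)"
      using le fn gn by (intro AE_I2) simp
  qed measurable
  have "(\<integral>x. (sqrt (f x) - sqrt (g x))\<^sup>2 \<partial>\<nu>) \<le> (\<integral>x. f x + g x \<partial>\<nu>)"
    using i If Ig le by (intro integral_mono) auto
  also have "\<dots> = 2" using If Ig by simp
  finally show "(\<integral>x. (sqrt (f x) - sqrt (g x))\<^sup>2 \<partial>\<nu>) \<le> 2" .
qed

text \<open>A data distribution \<open>R\<close> need not be dominated by the measure
  \<open>\<mu>\<close> of the model, so both are referred to \<open>sup \<mu> R\<close>, which is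
  sigma-finite because it is at most \<open>\<mu> + R\<close> on every set. Real-valued densities
  permit the pointwise inequalities on square roots.\<close>

lemma common_dominating_measure:
  fixes R \<mu> :: "'a measure"
  assumes R: "R \<in> space (prob_algebra S)" and \<mu>: "sigma_finite_measure \<mu>" "sets \<mu> = sets S"
  obtains \<nu> r u where "sigma_finite_measure \<nu>" "sets \<nu> = sets S"
    "r \<in> borel_measurable \<nu>" "u \<in> borel_measurable \<nu>" "\<And>x. 0 \<le> r x" "\<And>x. 0 \<le> u x"
    "R = density \<nu> (\<lambda>x. ennreal (r x))" "\<mu> = density \<nu> (\<lambda>x. ennreal (u x))"
proof -
  interpret \<mu>: sigma_finite_measure \<mu> by fact
  have R': "sets R = sets S" "prob_space R" using R by (auto simp: space_prob_algebra)
  interpret R: prob_space R by fact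
  define \<nu> where "\<nu> = sup \<mu> R"
  have st: "sets \<nu> = sets S" unfolding \<nu>_def by (rule sets_sup_eq[OF \<mu>(2) R'(1)])
  have ac: "absolutely_continuous \<nu> \<mu>" "absolutely_continuous \<nu> R"
    unfolding \<nu>_def using absolutely_continuous_sup[OF \<mu>(2) R'(1)] by auto
  have sf: "sigma_finite_measure \<nu>"
  proof
    obtain A :: "'a set set" where A: "countable A" "A \<subseteq> sets \<mu>" "\<Union>A = space \<mu>" "\<forall>a\<in>A. emeasure \<mu> a \<noteq> \<infinity>"
      using \<mu>.sigma_finite_countable by blast
    have "emeasure \<nu> a \<noteq> \<infinity>" if a: "a \<in> A" for a
    proof -
      have "emeasure \<nu> a \<le> emeasure \<mu> a + emeasure R a"
        unfolding \<nu>_def using A a \<mu>(2) by (intro emeasure_sup_le[OF \<mu>(2) R'(1)]) auto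
      also have "\<dots> < \<infinity>"
      proof -
        have "emeasure R a \<noteq> top" by simp
        then have "emeasure R a < top" unfolding less_top .
        moreover have "emeasure \<mu> a < top" using A(4) a unfolding less_top[symmetric] by simp
        ultimately show ?thesis by simp
      qed
      finally show ?thesis by simp
    qed
    then have fin: "\<forall>a\<in>A. emeasure \<nu> a \<noteq> \<infinity>" by blast
    have s\<mu>: "sets \<nu> = sets \<mu>" using st \<mu>(2) by (rule trans[OF _ sym])
    show "\<exists>A. countable A \<and> A \<subseteq> sets \<nu> \<and> \<Union> A = space \<nu> \<and> (\<forall>a\<in>A. emeasure \<nu> a \<noteq> \<infinity>)"
      unfolding s\<mu> sets_eq_imp_space_eq[OF s\<mu>]
      by (rule exI[of _ A]) (use A(1-3) fin in \<open>simp only: simp_thms\<close>)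
  qed
  interpret \<nu>: sigma_finite_measure \<nu> by fact
  have dens: "N = density \<nu> (\<lambda>x. ennreal (enn2real (RN_deriv \<nu> N x)))"
    if "sigma_finite_measure N" "absolutely_continuous \<nu> N" "sets N = sets S" for N
  proof -
    have "AE x in \<nu>. RN_deriv \<nu> N x \<noteq> \<infinity>"
      using that st by (intro \<nu>.RN_deriv_finite) auto
    then have "AE x in \<nu>. RN_deriv \<nu> N x = ennreal (enn2real (RN_deriv \<nu> N x))"
      by eventually_elim (simp add: less_top)
    then have "density \<nu> (RN_deriv \<nu> N) = density \<nu> (\<lambda>x. ennreal (enn2real (RN_deriv \<nu> N x)))"
      by (intro density_cong) auto
    then show ?thesis using \<nu>.density_RN_deriv[OF that(2)] that(3) st by simp
  qed
  show thesis
    by (rule that[OF sf st _ _ _ _ dens[OF R.sigma_finite_measure_axioms ac(2) R'(1)] dens[OF \<mu>(1) ac(1) \<mu>(2)]]) auto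
qed

lemma density_real_density:
  fixes u p :: "'a \<Rightarrow> real"
  assumes "u \<in> borel_measurable \<nu>" "p \<in> borel_measurable \<nu>" "\<And>x. 0 \<le> u x"
  shows "density (density \<nu> (\<lambda>x. ennreal (u x))) (\<lambda>x. ennreal (p x)) = density \<nu> (\<lambda>x. ennreal (u x * p x))"
  using assms by (subst density_density_eq) (auto simp: ennreal_mult' intro!: density_cong)

text \<open>The pointwise inequalities are integrated against a measure dominating \<open>R\<close>
  and \<open>\<mu>\<close>. The term \<open>(?q x - ?p x) / 4\<close> disappears because both
  densities have integral \<open>1\<close>, and the factor \<open>1/2\<close> in the Hellinger
  distance doubles the coefficients.\<close>

lemma
  assumes \<mu>: "sigma_finite_measure \<mu>" "sets \<mu> = sets S"
    and R: "R \<in> space (prob_algebra S)"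
    and pm: "p \<in> borel_measurable S" and pn: "\<And>x. x \<in> space S \<Longrightarrow> 0 \<le> p x"
    and qm: "q \<in> borel_measurable S" and qn: "\<And>x. x \<in> space S \<Longrightarrow> 0 \<le> q x"
    and P: "density \<mu> (\<lambda>x. ennreal (p x)) \<in> space (prob_algebra S)"
    and Q: "density \<mu> (\<lambda>x. ennreal (q x)) \<in> space (prob_algebra S)"
  shows expectation_psi_le: "(\<integral>x. psi (sqrt_ratio (q x) (p x)) \<partial>R)
      \<le> 4 * hellinger_sq R (density \<mu> (\<lambda>x. ennreal (p x))) - 3/8 * hellinger_sq R (density \<mu> (\<lambda>x. ennreal (q x)))"
      (is "?E \<le> 4 * hellinger_sq R ?P - 3/8 * hellinger_sq R ?Q")
    and expectation_psi_square_le: "(\<integral>x. (psi (sqrt_ratio (q x) (p x)))\<^sup>2 \<partial>R)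
      \<le> 2 * (hellinger_sq R (density \<mu> (\<lambda>x. ennreal (p x))) + hellinger_sq R (density \<mu> (\<lambda>x. ennreal (q x))))"
      (is "?V \<le> _")
proof -
  obtain \<nu> r u where \<nu>: "sigma_finite_measure \<nu>" "sets \<nu> = sets S"
    and m: "r \<in> borel_measurable \<nu>" "u \<in> borel_measurable \<nu>"
    and nn: "\<And>x. 0 \<le> r x" "\<And>x. 0 \<le> u x"
    and Rd: "R = density \<nu> (\<lambda>x. ennreal (r x))" and \<mu>d: "\<mu> = density \<nu> (\<lambda>x. ennreal (u x))"
    using common_dominating_measure[OF R \<mu>] by blast
  have sp: "space \<nu> = space S" using \<nu>(2) by (rule sets_eq_imp_space_eq)
  note [measurable] = m
  have [measurable]: "p \<in> borel_measurable \<nu>" "q \<in> borel_measurable \<nu>"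
    using pm qm \<nu>(2) by (auto cong: measurable_cong_sets)
  let ?p = "\<lambda>x. u x * p x" and ?q = "\<lambda>x. u x * q x"
  have pqn: "\<And>x. x \<in> space \<nu> \<Longrightarrow> 0 \<le> ?p x" "\<And>x. x \<in> space \<nu> \<Longrightarrow> 0 \<le> ?q x"
    using nn pn qn sp by auto
  have Pd: "?P = density \<nu> (\<lambda>x. ennreal (?p x))" "?Q = density \<nu> (\<lambda>x. ennreal (?q x))"
    unfolding \<mu>d using nn by (auto intro!: density_real_density)
  have RP: "density \<nu> (\<lambda>x. ennreal (r x)) \<in> space (prob_algebra S)"
    "density \<nu> (\<lambda>x. ennreal (?p x)) \<in> space (prob_algebra S)"
    "density \<nu> (\<lambda>x. ennreal (?q x)) \<in> space (prob_algebra S)"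
    using R P Q unfolding Rd Pd by auto
  have rn: "\<And>x. x \<in> space \<nu> \<Longrightarrow> 0 \<le> r x" using nn by simp
  have pm': "?p \<in> borel_measurable \<nu>" and qm': "?q \<in> borel_measurable \<nu>" by measurable
  have hP: "hellinger_sq R ?P = 1/2 * (\<integral>x. (sqrt (r x) - sqrt (?p x))\<^sup>2 \<partial>\<nu>)"
    "integrable \<nu> (\<lambda>x. (sqrt (r x) - sqrt (?p x))\<^sup>2)"
    unfolding Pd unfolding Rd
    using hellinger_sq_density[OF \<nu> m(1) rn pm' pqn(1) RP(1) RP(2)] by simp_all
  have hQ: "hellinger_sq R ?Q = 1/2 * (\<integral>x. (sqrt (r x) - sqrt (?q x))\<^sup>2 \<partial>\<nu>)"
    "integrable \<nu> (\<lambda>x. (sqrt (r x) - sqrt (?q x))\<^sup>2)"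
    unfolding Pd unfolding Rd
    using hellinger_sq_density[OF \<nu> m(1) rn qm' pqn(2) RP(1) RP(3)] by simp_all
  have pI: "integrable \<nu> ?p" "(\<integral>x. ?p x \<partial>\<nu>) = 1"
    using prob_density_integral[of ?p \<nu>] pqn RP by (auto simp: space_prob_algebra)
  have qI: "integrable \<nu> ?q" "(\<integral>x. ?q x \<partial>\<nu>) = 1"
    using prob_density_integral[of ?q \<nu>] pqn RP by (auto simp: space_prob_algebra)
  have rI: "integrable \<nu> r"
    using prob_density_integral[of r \<nu>] nn RP by (auto simp: space_prob_algebra)
  let ?f = "\<lambda>x. psi (sqrt_ratio (q x) (p x))"
  have fm[measurable]: "?f \<in> borel_measurable \<nu>"
    by (rule measurable_psi_sqrt_ratio) (use pn qn sp in simp_all)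
  have f1: "\<bar>?f x\<bar> \<le> 1" if "x \<in> space \<nu>" for x
    using abs_psi_sqrt_ratio_le pn qn that sp by auto
  have f2: "(?f x)\<^sup>2 \<le> 1" if "x \<in> space \<nu>" for x
    using f1[OF that] by (simp add: abs_square_le_1)
  have feq: "?f x = (sqrt (?q x) - sqrt (?p x)) / (sqrt (?q x) + sqrt (?p x))" if x: "x \<in> space \<nu>" "u x \<noteq> 0" for x
  proof -
    have "(sqrt (?q x) - sqrt (?p x)) / (sqrt (?q x) + sqrt (?p x))
       = (sqrt (u x) * (sqrt (q x) - sqrt (p x))) / (sqrt (u x) * (sqrt (q x) + sqrt (p x)))"
      by (simp add: real_sqrt_mult algebra_simps)
    then show ?thesis using x pn qn sp by (simp add: psi_sqrt_ratio)
  qed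
  have "?E = (\<integral>x. r x * ?f x \<partial>\<nu>)"
    unfolding Rd using nn by (subst integral_density) auto
  also have "\<dots> \<le> (\<integral>x. 2 * (sqrt (r x) - sqrt (?p x))\<^sup>2 - 3/16 * (sqrt (r x) - sqrt (?q x))\<^sup>2 + (?q x - ?p x) / 4 \<partial>\<nu>)"
  proof (rule integral_mono)
    show "integrable \<nu> (\<lambda>x. r x * ?f x)"
    proof (rule Bochner_Integration.integrable_bound[OF rI])
      show "AE x in \<nu>. norm (r x * ?f x) \<le> norm (r x)"
        using f1 nn by (intro AE_I2) (simp add: abs_mult mult_left_le)
    qed measurable
    fix x assume x: "x \<in> space \<nu>"
    show "r x * ?f x \<le> 2 * (sqrt (r x) - sqrt (?p x))\<^sup>2 - 3/16 * (sqrt (r x) - sqrt (?q x))\<^sup>2 + (?q x - ?p x) / 4"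
    \<comment> \<open>Where \<open>u\<close> vanishes, \<open>q x / p x\<close> cannot be recovered
      from \<open>u x * q x\<close> and \<open>u x * p x\<close>. There
      \<open>\<bar>psi\<bar> \<le> 1\<close> is enough, since the right-hand side is
      \<open>(2 - 3/16) * r x\<close>.\<close>
    proof (cases "u x = 0")
      case True
      have "r x * ?f x \<le> r x * 1" using f1[OF x] nn by (intro mult_left_mono) auto
      then show ?thesis using True nn(1)[of x] by simp
    next
      case False
      show ?thesis
        using psi_drift_pointwise[of "sqrt (r x)" "sqrt (?p x)" "sqrt (?q x)"] nn(1)[of x] pqn[OF x]
        by (simp add: feq[OF x False])
    qed
  qed (use hP hQ pI qI in auto)
  also have "\<dots> = 4 * hellinger_sq R ?P - 3/8 * hellinger_sq R ?Q"
    using hP hQ pI qI by simp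
  finally show "?E \<le> 4 * hellinger_sq R ?P - 3/8 * hellinger_sq R ?Q" .
  have "?V = (\<integral>x. r x * (?f x)\<^sup>2 \<partial>\<nu>)"
    unfolding Rd using nn by (subst integral_density) auto
  also have "\<dots> \<le> (\<integral>x. (sqrt (r x) - sqrt (?p x))\<^sup>2 + (sqrt (r x) - sqrt (?q x))\<^sup>2 \<partial>\<nu>)"
  proof (rule integral_mono)
    show "integrable \<nu> (\<lambda>x. r x * (?f x)\<^sup>2)"
    proof (rule Bochner_Integration.integrable_bound[OF rI])
      show "AE x in \<nu>. norm (r x * (?f x)\<^sup>2) \<le> norm (r x)"
        using f2 nn by (intro AE_I2) (simp add: abs_mult mult_left_le)
    qed measurable
    fix x assume x: "x \<in> space \<nu>"
    show "r x * (?f x)\<^sup>2 \<le> (sqrt (r x) - sqrt (?p x))\<^sup>2 + (sqrt (r x) - sqrt (?q x))\<^sup>2"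
    proof (cases "u x = 0")
      case True
      have "r x * (?f x)\<^sup>2 \<le> r x * 1" using f2[OF x] nn by (intro mult_left_mono) auto
      then show ?thesis using True nn(1)[of x] by simp
    next
      case False
      show ?thesis
        using psi_variance_pointwise[of "sqrt (r x)" "sqrt (?p x)" "sqrt (?q x)"] nn(1)[of x] pqn[OF x]
        by (simp add: feq[OF x False])
    qed
  qed (use hP hQ in auto)
  also have "\<dots> = 2 * (hellinger_sq R ?P + hellinger_sq R ?Q)"
    using hP hQ by simp
  finally show "?V \<le> 2 * (hellinger_sq R ?P + hellinger_sq R ?Q)" .
qed

text \<open>On a \<open>P\<close>-null set the density of \<open>P\<close> vanishes almost
  everywhere, so the squared difference of the square roots is the density of \<open>R\<close>, and
  the whole \<open>R\<close>-mass of the set is counted in \<open>2 * hellinger_sq R P\<close>. This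
  will control the choice of densities.\<close>

lemma
  assumes R: "R \<in> space (prob_algebra S)" and P: "P \<in> space (prob_algebra S)"
  shows hellinger_sq_le_1: "hellinger_sq R P \<le> 1"
    and measure_null_le_hellinger_sq: "N \<in> sets S \<Longrightarrow> emeasure P N = 0 \<Longrightarrow> measure R N \<le> 2 * hellinger_sq R P"
proof -
  have P': "prob_space P" "sets P = sets S" using P by (auto simp: space_prob_algebra)
  interpret P: prob_space P by fact
  obtain \<nu> r u where \<nu>: "sigma_finite_measure \<nu>" "sets \<nu> = sets S"
    and m[measurable]: "r \<in> borel_measurable \<nu>" "u \<in> borel_measurable \<nu>"
    and nn: "\<And>x. 0 \<le> r x" "\<And>x. 0 \<le> u x"
    and Rd: "R = density \<nu> (\<lambda>x. ennreal (r x))" and Pd: "P = density \<nu> (\<lambda>x. ennreal (u x))"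
    using common_dominating_measure[OF R P.sigma_finite_measure_axioms P'(2)] by blast
  have RP: "density \<nu> (\<lambda>x. ennreal (r x)) \<in> space (prob_algebra S)"
    "density \<nu> (\<lambda>x. ennreal (u x)) \<in> space (prob_algebra S)"
    using R P unfolding Rd Pd by auto
  have nn': "\<And>x. x \<in> space \<nu> \<Longrightarrow> 0 \<le> r x" "\<And>x. x \<in> space \<nu> \<Longrightarrow> 0 \<le> u x" using nn by simp_all
  note h = hellinger_sq_density[OF \<nu> m(1) nn'(1) m(2) nn'(2) RP]
  show "hellinger_sq R P \<le> 1" unfolding Rd Pd using h by simp
  have rI: "integrable \<nu> r"
    using prob_density_integral[of r \<nu>] nn RP by (auto simp: space_prob_algebra)
  assume N: "N \<in> sets S" "emeasure P N = 0"
  have N'[measurable]: "N \<in> sets \<nu>" using N \<nu> by simp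
  have "(\<integral>\<^sup>+x. ennreal (u x) * indicator N x \<partial>\<nu>) = 0"
    using N(2) unfolding Pd by (simp add: emeasure_density)
  then have "AE x in \<nu>. ennreal (u x) * indicator N x = 0"
    by (subst (asm) nn_integral_0_iff_AE) auto
  then have u0: "AE x in \<nu>. x \<in> N \<longrightarrow> u x = 0"
    by (rule eventually_mono) (use nn in \<open>auto simp: indicator_def order.antisym\<close>)
  have "measure R N = (\<integral>x. indicator N x \<partial>R)"
  proof -
    have "N \<in> sets R" using N R by (simp add: space_prob_algebra)
    then show ?thesis by simp
  qed
  also have "\<dots> = (\<integral>x. r x * indicator N x \<partial>\<nu>)"
    unfolding Rd using nn by (subst integral_density) auto
  also have "\<dots> \<le> (\<integral>x. (sqrt (r x) - sqrt (u x))\<^sup>2 \<partial>\<nu>)"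
  proof (rule integral_mono_AE)
    show "integrable \<nu> (\<lambda>x. r x * indicator N x)"
      using integrable_mult_indicator[OF N' rI] by (simp add: mult.commute)
    show "AE x in \<nu>. r x * indicator N x \<le> (sqrt (r x) - sqrt (u x))\<^sup>2"
      using u0 by (rule eventually_mono) (use nn in \<open>auto simp: indicator_def\<close>)
  qed (use h in auto)
  also have "\<dots> = 2 * hellinger_sq R P" unfolding Rd Pd using h by simp
  finally show "measure R N \<le> 2 * hellinger_sq R P" .
qed

subsection \<open>Densities and the deviation process\<close>

lemma represents_density_in:
  assumes "represents S \<mu> \<M> \<PP>" "Q \<in> \<PP>"
  shows "density_in \<mu> \<M> Q \<in> \<M>" "density \<mu> (\<lambda>x. ennreal (density_in \<mu> \<M> Q x)) = Q"
    "density_in \<mu> \<M> Q \<in> borel_measurable S" "x \<in> space S \<Longrightarrow> 0 \<le> density_in \<mu> \<M> Q x"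
proof -
  have bij: "bij_betw (\<lambda>q. density \<mu> (\<lambda>x. ennreal (q x))) \<M> \<PP>"
    using assms(1) by (simp add: represents_def)
  show 1: "density_in \<mu> \<M> Q \<in> \<M>"
    unfolding density_in_def using bij assms(2)
    by (intro the_inv_into_into) (auto simp: bij_betw_def)
  show "density \<mu> (\<lambda>x. ennreal (density_in \<mu> \<M> Q x)) = Q"
    unfolding density_in_def using f_the_inv_into_f_bij_betw[OF bij] assms(2) by simp
  show "density_in \<mu> \<M> Q \<in> borel_measurable S" "x \<in> space S \<Longrightarrow> 0 \<le> density_in \<mu> \<M> Q x"
    using 1 assms(1) by (auto simp: represents_def)
qed

lemma represents_density_in_density:
  assumes "represents S \<mu> \<M> \<PP>" "q \<in> \<M>"
  shows "density \<mu> (\<lambda>x. ennreal (q x)) \<in> \<PP>" "density_in \<mu> \<M> (density \<mu> (\<lambda>x. ennreal (q x))) = q"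
proof -
  have bij: "bij_betw (\<lambda>q. density \<mu> (\<lambda>x. ennreal (q x))) \<M> \<PP>"
    using assms(1) by (simp add: represents_def)
  then show "density \<mu> (\<lambda>x. ennreal (q x)) \<in> \<PP>" using assms(2) by (auto simp: bij_betw_def)
  show "density_in \<mu> \<M> (density \<mu> (\<lambda>x. ennreal (q x))) = q"
    unfolding density_in_def using bij assms(2) by (intro the_inv_into_f_f) (auto simp: bij_betw_def)
qed

lemma represents_sigma_finite: "represents S \<mu> \<M> \<PP> \<Longrightarrow> sigma_finite_measure \<mu>"
  and represents_sets: "represents S \<mu> \<M> \<PP> \<Longrightarrow> sets \<mu> = sets S"
  by (simp_all add: represents_def)

definition psi_dens :: "'a measure \<Rightarrow> ('a \<Rightarrow> real) set \<Rightarrow> 'a measure \<Rightarrow> 'a measure \<Rightarrow> 'a \<Rightarrow> real" where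
  "psi_dens \<mu> \<M> P Q x = psi (sqrt_ratio (density_in \<mu> \<M> Q x) (density_in \<mu> \<M> P x))"

lemma psi_dens_measurable:
  assumes "represents S \<mu> \<M> \<PP>" "P \<in> \<PP>" "Q \<in> \<PP>"
  shows "psi_dens \<mu> \<M> P Q \<in> borel_measurable S"
  unfolding psi_dens_def[abs_def]
  using represents_density_in[OF assms(1,2)] represents_density_in[OF assms(1,3)]
  by (intro measurable_psi_sqrt_ratio) auto

lemma abs_psi_dens_le:
  assumes "represents S \<mu> \<M> \<PP>" "P \<in> \<PP>" "Q \<in> \<PP>" "x \<in> space S"
  shows "\<bar>psi_dens \<mu> \<M> P Q x\<bar> \<le> 1"
  unfolding psi_dens_def using represents_density_in(4)[OF assms(1,2)] represents_density_in(4)[OF assms(1,3)] assms(4)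
  by (intro abs_psi_sqrt_ratio_le) auto

text \<open>
  On \<open>{p > 0}\<close>, which carries \<open>P\<close>, the ratio \<open>q / p\<close> is the density of the part of \<open>Q\<close> that is
  absolutely continuous with respect to \<open>P\<close>, whatever the dominating measure.
\<close>

lemma AE_ratio_eq:
  fixes p q p' q' :: "'a \<Rightarrow> real"
  assumes st: "sets \<mu> = sets S" "sets \<nu> = sets S"
    and m: "p \<in> borel_measurable S" "q \<in> borel_measurable S" "p' \<in> borel_measurable S" "q' \<in> borel_measurable S"
    and nn: "\<And>x. x \<in> space S \<Longrightarrow> 0 \<le> p x" "\<And>x. x \<in> space S \<Longrightarrow> 0 \<le> q x"
      "\<And>x. x \<in> space S \<Longrightarrow> 0 \<le> p' x" "\<And>x. x \<in> space S \<Longrightarrow> 0 \<le> q' x"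
    and P: "P = density \<mu> (\<lambda>x. ennreal (p x))" "P = density \<nu> (\<lambda>x. ennreal (p' x))"
    and Q: "Q = density \<mu> (\<lambda>x. ennreal (q x))" "Q = density \<nu> (\<lambda>x. ennreal (q' x))"
    and prob: "prob_space P"
  shows "AE x in P. 0 < p x \<and> 0 < p' x \<and> q x / p x = q' x / p' x"
proof -
  interpret P: prob_space P by fact
  have sp: "space \<mu> = space S" "space \<nu> = space S" using st by (auto dest: sets_eq_imp_space_eq)
  have m\<mu>[measurable]: "p \<in> borel_measurable \<mu>" "q \<in> borel_measurable \<mu>" "p' \<in> borel_measurable \<mu>" "q' \<in> borel_measurable \<mu>"
    using m st by (simp_all cong: measurable_cong_sets)
  have m\<nu>[measurable]: "p \<in> borel_measurable \<nu>" "q \<in> borel_measurable \<nu>" "p' \<in> borel_measurable \<nu>" "q' \<in> borel_measurable \<nu>"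
    using m st by (simp_all cong: measurable_cong_sets)
  have p0: "AE x in P. 0 < p x"
    unfolding P(1) by (subst AE_density) auto
  have p'0: "AE x in P. 0 < p' x"
    unfolding P(2) by (subst AE_density) auto
  define f where "f x = (if 0 < p x \<and> 0 < p' x then q x / p x else 0)" for x
  define f' where "f' x = (if 0 < p x \<and> 0 < p' x then q' x / p' x else 0)" for x
  define e where "e x = (if 0 < p x \<and> 0 < p' x then 1 else 0 :: real)" for x
  have fm: "f \<in> borel_measurable S" "f' \<in> borel_measurable S" "e \<in> borel_measurable S"
    unfolding f_def[abs_def] f'_def[abs_def] e_def[abs_def] using m by measurable
  have fm\<mu>[measurable]: "f \<in> borel_measurable \<mu>" "e \<in> borel_measurable \<mu>"
    using fm st by (simp_all cong: measurable_cong_sets)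
  have fm\<nu>[measurable]: "f' \<in> borel_measurable \<nu>" "e \<in> borel_measurable \<nu>"
    using fm st by (simp_all cong: measurable_cong_sets)
  have "density P (\<lambda>x. ennreal (f x)) = density \<mu> (\<lambda>x. ennreal (p x) * ennreal (f x))"
    unfolding P(1) by (rule density_density_eq) auto
  also have "\<dots> = density \<mu> (\<lambda>x. ennreal (q x) * ennreal (e x))"
    using nn sp by (intro density_cong AE_I2) (auto simp: f_def e_def ennreal_mult'[symmetric])
  also have "\<dots> = density Q (\<lambda>x. ennreal (e x))"
    unfolding Q(1) by (rule density_density_eq[symmetric]) auto
  finally have 1: "density P (\<lambda>x. ennreal (f x)) = density Q (\<lambda>x. ennreal (e x))" .
  have "density P (\<lambda>x. ennreal (f' x)) = density \<nu> (\<lambda>x. ennreal (p' x) * ennreal (f' x))"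
    unfolding P(2) by (rule density_density_eq) auto
  also have "\<dots> = density \<nu> (\<lambda>x. ennreal (q' x) * ennreal (e x))"
    using nn sp by (intro density_cong AE_I2) (auto simp: f'_def e_def ennreal_mult'[symmetric])
  also have "\<dots> = density Q (\<lambda>x. ennreal (e x))"
    unfolding Q(2) by (rule density_density_eq[symmetric]) auto
  finally have "density P (\<lambda>x. ennreal (f x)) = density P (\<lambda>x. ennreal (f' x))"
    using 1 by simp
  moreover have "f \<in> borel_measurable P" "f' \<in> borel_measurable P"
    using fm st unfolding P(1) by (simp_all cong: measurable_cong_sets)
  ultimately have "AE x in P. ennreal (f x) = ennreal (f' x)"
    by (intro P.density_unique) auto
  moreover have "AE x in P. x \<in> space S"
    using AE_space[of P] unfolding P(1) by (simp add: sp)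
  ultimately show ?thesis using p0 p'0
  proof eventually_elim
    case (elim x)
    have "0 \<le> q x / p x" "0 \<le> q' x / p' x" using nn elim by auto
    then show ?case using elim by (simp add: f_def f'_def ennreal_inj)
  qed
qed

text \<open>Countability of the model gives one exceptional set for all \<open>Q\<close>. It is null
  for \<open>P\<close> only: where the density of \<open>P\<close> vanishes, \<open>psi\<close> is
  \<open>1\<close> or \<open>0\<close> according to whether that of \<open>Q\<close> is positive,
  which may depend on the representation.\<close>

lemma psi_dens_eq_outside_null:
  assumes rep: "represents S \<mu> \<M> \<PP>" "represents S \<nu> \<N> \<PP>"
    and \<PP>: "countable \<PP>" "\<PP> \<subseteq> space (prob_algebra S)" and P: "P \<in> \<PP>"
  obtains N where "N \<in> sets S" "emeasure P N = 0"
    "\<And>Q x. Q \<in> \<PP> \<Longrightarrow> x \<in> space S - N \<Longrightarrow> psi_dens \<mu> \<M> P Q x = psi_dens \<nu> \<N> P Q x"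
proof -
  have P': "prob_space P" "sets P = sets S" using P \<PP> by (auto simp: space_prob_algebra)
  have "AE x in P. \<forall>Q\<in>\<PP>. psi_dens \<mu> \<M> P Q x = psi_dens \<nu> \<N> P Q x"
    unfolding AE_ball_countable[OF \<PP>(1)]
  proof
    fix Q assume Q: "Q \<in> \<PP>"
    note d = represents_density_in[OF rep(1) P] represents_density_in[OF rep(1) Q]
      represents_density_in[OF rep(2) P] represents_density_in[OF rep(2) Q]
    have "AE x in P. 0 < density_in \<mu> \<M> P x \<and> 0 < density_in \<nu> \<N> P x \<and>
        density_in \<mu> \<M> Q x / density_in \<mu> \<M> P x = density_in \<nu> \<N> Q x / density_in \<nu> \<N> P x"
      using represents_sets[OF rep(1)] represents_sets[OF rep(2)] d(3,7,11,15) d(4,8,12,16)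
        d(2)[symmetric] d(10)[symmetric] d(6)[symmetric] d(14)[symmetric] P'(1)
      by (rule AE_ratio_eq)
    then show "AE x in P. psi_dens \<mu> \<M> P Q x = psi_dens \<nu> \<N> P Q x"
      by eventually_elim (simp add: psi_dens_def sqrt_ratio_def)
  qed
  then obtain N where N: "{x \<in> space P. \<not> (\<forall>Q\<in>\<PP>. psi_dens \<mu> \<M> P Q x = psi_dens \<nu> \<N> P Q x)} \<subseteq> N"
    "emeasure P N = 0" "N \<in> sets P"
    by (rule AE_E)
  have "space P = space S" using P'(2) by (rule sets_eq_imp_space_eq)
  with N P' show thesis by (intro that[of N]) auto
qed

section \<open>The comparison process under a product law\<close>

locale rho_product =
  fixes S :: "'a measure" and \<PP> :: "'a measure set" and Ps :: "nat \<Rightarrow> 'a measure" and m :: nat and P :: "'a measure"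
  assumes countable_model: "countable \<PP>" and model_prob: "\<PP> \<subseteq> space (prob_algebra S)"
    and Ps: "\<And>i. Ps i \<in> space (prob_algebra S)" and P_in: "P \<in> \<PP>"
begin

abbreviation "PM \<equiv> PiM {1..m} Ps"

sublocale product_prob_space Ps "{1..m}"
proof -
  have "prob_space (Ps i)" for i using Ps[of i] by (simp add: space_prob_algebra)
  then show "product_prob_space Ps"
    by (simp add: product_prob_space_def product_prob_space_axioms_def product_sigma_finite_def prob_space_imp_sigma_finite)
qed

definition H :: real where "H = (\<Sum>i=1..m. hellinger_sq (Ps i) P)"
definition A :: "'a measure \<Rightarrow> real" where "A Q = (\<Sum>i=1..m. hellinger_sq (Ps i) Q)"

text \<open>Centred term by term, so that it is a sum of independent variables to which the
  concentration inequality applies. \<open>dev_eq\<close> identifies it with the globally centred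
  statistic in the dimension.\<close>

definition dev :: "'a measure \<Rightarrow> ('a \<Rightarrow> real) set \<Rightarrow> 'a measure \<Rightarrow> (nat \<Rightarrow> 'a) \<Rightarrow> real" where
  "dev \<mu> \<M> Q x = (\<Sum>i=1..m. psi_dens \<mu> \<M> P Q (x i) - (\<integral>z. psi_dens \<mu> \<M> P Q z \<partial>Ps i))"

lemma sets_Ps: "sets (Ps i) = sets S" and prob_Ps: "prob_space (Ps i)"
  using Ps[of i] by (auto simp: space_prob_algebra)

lemma space_Ps: "space (Ps i) = space S"
  using sets_Ps by (rule sets_eq_imp_space_eq)

lemma sets_PM: "sets PM = sets (PiM {1..m} (\<lambda>_. S))"
  using sets_Ps by (intro sets_PiM_cong) auto

lemma space_PM: "x \<in> space PM \<Longrightarrow> i \<in> {1..m} \<Longrightarrow> x i \<in> space S"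
  by (auto simp: space_PiM PiE_iff space_Ps)

lemma measurable_Ps: "f \<in> borel_measurable S \<Longrightarrow> f \<in> borel_measurable (Ps i)"
  using sets_Ps by (simp cong: measurable_cong_sets)

lemma component_measurable: "i \<in> {1..m} \<Longrightarrow> f \<in> borel_measurable S \<Longrightarrow> (\<lambda>x. f (x i)) \<in> borel_measurable PM"
  using measurable_component_singleton[of i "{1..m}" Ps] measurable_Ps[of f i] by (rule measurable_compose)

lemma component_integral:
  assumes "i \<in> {1..m}" "f \<in> borel_measurable S"
  shows "(\<integral>x. f (x i) \<partial>PM) = (\<integral>z. f z \<partial>Ps i :: real)"
proof -
  have "(\<integral>z. f z \<partial>Ps i) = (\<integral>z. f z \<partial>distr PM (Ps i) (\<lambda>x. x i))"
    using distr_PiM_component[of "{1..m}" Ps i] prob_Ps assms(1) by simp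
  also have "\<dots> = (\<integral>x. f (x i) \<partial>PM)"
    using assms measurable_Ps by (intro integral_distr) auto
  finally show ?thesis by simp
qed

lemma component_integrable:
  fixes f :: "'a \<Rightarrow> real"
  assumes "i \<in> {1..m}" "f \<in> borel_measurable S" "\<And>x. x \<in> space S \<Longrightarrow> \<bar>f x\<bar> \<le> B"
  shows "integrable PM (\<lambda>x. f (x i))"
  using assms space_PM by (intro P.integrable_bounded[where B = B] component_measurable) auto

context
  fixes \<mu> \<M>
  assumes rep: "represents S \<mu> \<M> \<PP>"
begin

lemma psi_dens_integrable: "Q \<in> \<PP> \<Longrightarrow> integrable (Ps i) (psi_dens \<mu> \<M> P Q)"
  using psi_dens_measurable[OF rep P_in] abs_psi_dens_le[OF rep P_in] space_Ps
  by (intro M.integrable_bounded[where B = 1] measurable_Ps) auto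

lemma abs_expectation_psi_dens_le:
  assumes "Q \<in> \<PP>" shows "\<bar>\<integral>z. psi_dens \<mu> \<M> P Q z \<partial>Ps i\<bar> \<le> 1"
  using M.integral_between[OF psi_dens_integrable[OF assms], of i "-1" 1] abs_psi_dens_le[OF rep P_in assms] space_Ps
  by (simp add: abs_le_iff minus_le_iff)

lemma dev_eq:
  assumes Q: "Q \<in> \<PP>"
  shows "dev \<mu> \<M> Q x = T_stat m x (density_in \<mu> \<M> P) (density_in \<mu> \<M> Q)
     - (\<integral>z. T_stat m z (density_in \<mu> \<M> P) (density_in \<mu> \<M> Q) \<partial>PM)"
proof -
  have "(\<integral>z. (\<Sum>i=1..m. psi_dens \<mu> \<M> P Q (z i)) \<partial>PM) = (\<Sum>i=1..m. \<integral>z. psi_dens \<mu> \<M> P Q (z i) \<partial>PM)"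
    using psi_dens_measurable[OF rep P_in Q] abs_psi_dens_le[OF rep P_in Q]
    by (intro Bochner_Integration.integral_sum component_integrable) auto
  also have "\<dots> = (\<Sum>i=1..m. \<integral>z. psi_dens \<mu> \<M> P Q z \<partial>Ps i)"
    using psi_dens_measurable[OF rep P_in Q] by (intro sum.cong component_integral) auto
  finally show ?thesis
    by (simp add: dev_def T_stat_def psi_dens_def sum_subtractf)
qed

lemma dev_measurable:
  assumes "Q \<in> \<PP>" shows "dev \<mu> \<M> Q \<in> borel_measurable PM"
  unfolding dev_def using psi_dens_measurable[OF rep P_in assms]
  by (intro borel_measurable_sum borel_measurable_diff component_measurable) auto

lemma abs_dev_le:
  assumes "Q \<in> \<PP>" "x \<in> space PM" shows "\<bar>dev \<mu> \<M> Q x\<bar> \<le> 2 * real m"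
proof -
  have "\<bar>dev \<mu> \<M> Q x\<bar> \<le> (\<Sum>i=1..m. 2)"
    unfolding dev_def
  proof (intro order_trans[OF sum_abs] sum_mono)
    fix i assume "i \<in> {1..m}"
    then show "\<bar>psi_dens \<mu> \<M> P Q (x i) - (\<integral>z. psi_dens \<mu> \<M> P Q z \<partial>Ps i)\<bar> \<le> 2"
      using abs_psi_dens_le[OF rep P_in assms(1) space_PM[OF assms(2)], of i] abs_expectation_psi_dens_le[OF assms(1), of i]
      by linarith
  qed
  then show ?thesis by simp
qed


lemma variance_sum_le:
  assumes Q: "Q \<in> \<PP>"
  defines "v \<equiv> \<lambda>i. \<integral>z. (psi_dens \<mu> \<M> P Q z - (\<integral>z. psi_dens \<mu> \<M> P Q z \<partial>Ps i))\<^sup>2 \<partial>Ps i"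
  shows "0 \<le> v i" "v i \<le> 1" "(\<Sum>i=1..m. v i) \<le> 2 * (H + A Q)"
proof -
  note d = represents_density_in[OF rep P_in] represents_density_in[OF rep Q]
  have sqI: "integrable (Ps i) (\<lambda>z. (psi_dens \<mu> \<M> P Q z)\<^sup>2)" for i
    using psi_dens_measurable[OF rep P_in Q] abs_psi_dens_le[OF rep P_in Q] space_Ps
    by (intro M.integrable_bounded[where B = 1] measurable_Ps) (auto simp: abs_square_le_1)
  have le: "v i \<le> (\<integral>z. (psi_dens \<mu> \<M> P Q z)\<^sup>2 \<partial>Ps i)" for i
    unfolding v_def by (subst M.variance_eq[OF psi_dens_integrable[OF Q] sqI]) simp
  show "0 \<le> v i" unfolding v_def by simp
  have "(\<integral>z. (psi_dens \<mu> \<M> P Q z)\<^sup>2 \<partial>Ps i) \<le> 1"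
    using abs_psi_dens_le[OF rep P_in Q] space_Ps by (intro M.integral_between(2)[OF sqI, where a = 0]) (auto simp: abs_square_le_1)
  with le[of i] show "v i \<le> 1" by simp
  have "v i \<le> 2 * (hellinger_sq (Ps i) P + hellinger_sq (Ps i) Q)" for i
  proof -
    have "density \<mu> (\<lambda>x. ennreal (density_in \<mu> \<M> P x)) \<in> space (prob_algebra S)"
      "density \<mu> (\<lambda>x. ennreal (density_in \<mu> \<M> Q x)) \<in> space (prob_algebra S)"
      using d(2,6) P_in Q model_prob by auto
    from expectation_psi_square_le[OF represents_sigma_finite[OF rep] represents_sets[OF rep] Ps[of i] d(3,4,7,8) this]
    have "(\<integral>z. (psi_dens \<mu> \<M> P Q z)\<^sup>2 \<partial>Ps i) \<le> 2 * (hellinger_sq (Ps i) P + hellinger_sq (Ps i) Q)"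
      unfolding psi_dens_def[abs_def] d(2) d(6) by simp
    with le[of i] show ?thesis by simp
  qed
  then have "(\<Sum>i=1..m. v i) \<le> (\<Sum>i=1..m. 2 * (hellinger_sq (Ps i) P + hellinger_sq (Ps i) Q))"
    by (intro sum_mono)
  also have "\<dots> = 2 * (H + A Q)"
    unfolding H_def A_def sum_distrib_left[symmetric] sum.distrib ..
  finally show "(\<Sum>i=1..m. v i) \<le> 2 * (H + A Q)" .
qed

lemma T_stat_le:
  assumes Q: "Q \<in> \<PP>"
  shows "T_stat m x (density_in \<mu> \<M> P) (density_in \<mu> \<M> Q) \<le> 4 * H - 3/8 * A Q + dev \<mu> \<M> Q x"
proof -
  note d = represents_density_in[OF rep P_in] represents_density_in[OF rep Q]
  have "(\<integral>z. psi_dens \<mu> \<M> P Q z \<partial>Ps i) \<le> 4 * hellinger_sq (Ps i) P - 3/8 * hellinger_sq (Ps i) Q" for i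
  proof -
    have "density \<mu> (\<lambda>x. ennreal (density_in \<mu> \<M> P x)) \<in> space (prob_algebra S)"
      "density \<mu> (\<lambda>x. ennreal (density_in \<mu> \<M> Q x)) \<in> space (prob_algebra S)"
      using d(2,6) P_in Q model_prob by auto
    from expectation_psi_le[OF represents_sigma_finite[OF rep] represents_sets[OF rep] Ps[of i] d(3,4,7,8) this]
    show ?thesis unfolding psi_dens_def[abs_def] d(2) d(6) by simp
  qed
  then have "(\<Sum>i=1..m. \<integral>z. psi_dens \<mu> \<M> P Q z \<partial>Ps i) \<le> (\<Sum>i=1..m. 4 * hellinger_sq (Ps i) P - 3/8 * hellinger_sq (Ps i) Q)"
    by (intro sum_mono)
  also have "\<dots> = 4 * H - 3/8 * A Q"
    unfolding H_def A_def sum_distrib_left sum_subtractf ..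
  finally show ?thesis
    by (simp add: dev_def T_stat_def psi_dens_def sum_subtractf)
qed

lemma Max_dev_measurable:
  assumes "finite F" "F \<noteq> {}" "F \<subseteq> \<PP>"
  shows "(\<lambda>x. Max ((\<lambda>Q. dev \<mu> \<M> Q x) ` F)) \<in> borel_measurable PM"
  using assms dev_measurable by (intro borel_measurable_Max) auto

lemma abs_Max_dev_le:
  assumes "finite F" "F \<noteq> {}" "F \<subseteq> \<PP>" "x \<in> space PM"
  shows "\<bar>Max ((\<lambda>Q. dev \<mu> \<M> Q x) ` F)\<bar> \<le> 2 * real m"
  using Max_in[of "(\<lambda>Q. dev \<mu> \<M> Q x) ` F"] assms abs_dev_le by (auto simp del: Max_in)

lemma Max_dev_integrable:
  assumes "finite F" "F \<noteq> {}" "F \<subseteq> \<PP>"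
  shows "integrable PM (\<lambda>x. Max ((\<lambda>Q. dev \<mu> \<M> Q x) ` F))"
  using assms Max_dev_measurable abs_Max_dev_le by (intro P.integrable_bounded[where B = "2 * real m"]) auto

text \<open>The process is replaced by \<open>W\<close>, which adds \<open>v / 60\<close> to each
  centred term, \<open>v\<close> being its variance. This only raises the maximum, by at most
  \<open>Y / 30\<close> since the variances sum to at most \<open>2 * Y\<close>, and it secures the
  moment condition of the concentration inequality.\<close>

lemma exp_Max_dev_le:
  assumes F: "finite F" "F \<noteq> {}" "F \<subseteq> \<PP>" and y: "\<And>Q. Q \<in> F \<Longrightarrow> H + A Q \<le> Y"
    and w: "(\<integral>x. Max ((\<lambda>Q. dev \<mu> \<M> Q x) ` F) \<partial>PM) \<le> w" and w0: "0 \<le> w"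
  shows "(\<integral>x. exp (1 / 300 * Max ((\<lambda>Q. dev \<mu> \<M> Q x) ` F)) \<partial>PM) \<le> exp (1 / 300 * ((w + Y / 30) * 1.1137))"
proof -
  define e where "e Q i = (\<integral>z. psi_dens \<mu> \<M> P Q z \<partial>Ps i)" for Q i
  define v where "v Q i = (\<integral>z. (psi_dens \<mu> \<M> P Q z - e Q i)\<^sup>2 \<partial>Ps i)" for Q i
  have v: "0 \<le> v Q i" "v Q i \<le> 1" "(\<Sum>i=1..m. v Q i) \<le> 2 * (H + A Q)" if "Q \<in> \<PP>" for Q i
    unfolding v_def e_def using variance_sum_le[OF that] by auto
  define W where "W i Q x = psi_dens \<mu> \<M> P Q x - e Q i + v Q i / 60" for i Q x
  have e1: "\<bar>e Q i\<bar> \<le> 1" if "Q \<in> \<PP>" for Q i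
    unfolding e_def using abs_expectation_psi_dens_le[OF that] .
  have WI: "integrable (Ps i) (\<lambda>x. psi_dens \<mu> \<M> P Q x - e Q i)" if "Q \<in> \<PP>" for i Q
    using psi_dens_integrable[OF that] by auto
  have WI2: "integrable (Ps i) (\<lambda>x. (psi_dens \<mu> \<M> P Q x - e Q i)\<^sup>2)" if Q: "Q \<in> \<PP>" for i Q
  proof (rule M.integrable_bounded)
    show "(\<lambda>x. (psi_dens \<mu> \<M> P Q x - e Q i)\<^sup>2) \<in> borel_measurable (Ps i)"
      using psi_dens_measurable[OF rep P_in Q] by (intro measurable_Ps) auto
    fix x assume "x \<in> space (Ps i)"
    then have "\<bar>psi_dens \<mu> \<M> P Q x - e Q i\<bar> \<le> 2"
      using abs_psi_dens_le[OF rep P_in Q, of x] e1[OF Q, of i] space_Ps by force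
    from power_mono[OF this abs_ge_zero, of 2]
    show "\<bar>(psi_dens \<mu> \<M> P Q x - e Q i)\<^sup>2\<bar> \<le> 2\<^sup>2"
      by simp
  qed
  have E1: "(\<integral>x. psi_dens \<mu> \<M> P Q x - e Q i \<partial>Ps i) = 0" if "Q \<in> \<PP>" for i Q
    using psi_dens_integrable[OF that] by (simp add: e_def M.prob_space)
  have EW: "(\<integral>x. W i Q x \<partial>Ps i) = v Q i / 60" if "Q \<in> \<PP>" for i Q
    unfolding W_def using WI[OF that] E1[OF that] by (simp add: M.prob_space)
  have EW2: "(\<integral>x. (W i Q x)\<^sup>2 \<partial>Ps i) = v Q i + (v Q i / 60)\<^sup>2" if Q: "Q \<in> \<PP>" for i Q
  proof -
    have "(\<integral>x. (W i Q x)\<^sup>2 \<partial>Ps i) = (\<integral>x. (psi_dens \<mu> \<M> P Q x - e Q i)\<^sup>2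
        + 2 * (v Q i / 60) * (psi_dens \<mu> \<M> P Q x - e Q i) + (v Q i / 60)\<^sup>2 \<partial>Ps i)"
      unfolding W_def by (intro Bochner_Integration.integral_cong) (auto simp: power2_sum)
    also have "\<dots> = v Q i + 2 * (v Q i / 60) * (\<integral>x. psi_dens \<mu> \<M> P Q x - e Q i \<partial>Ps i) + (v Q i / 60)\<^sup>2"
      using WI[OF Q] WI2[OF Q] by (simp add: v_def M.prob_space del: Bochner_Integration.integral_diff)
    finally show ?thesis using E1[OF Q] by simp
  qed
  define Z where "Z x = Max ((\<lambda>Q. \<Sum>i\<in>{1..m}. W i Q (x i)) ` F)" for x
  let ?D = "\<lambda>x. Max ((\<lambda>Q. dev \<mu> \<M> Q x) ` F)"
  have sumW: "(\<Sum>i\<in>{1..m}. W i Q (x i)) = dev \<mu> \<M> Q x + (\<Sum>i=1..m. v Q i) / 60" for Q x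
    unfolding W_def dev_def e_def by (simp add: sum.distrib sum_divide_distrib)
  have DZ: "?D x \<le> Z x" for x
  proof (rule Max.boundedI)
    fix a assume "a \<in> (\<lambda>Q. dev \<mu> \<M> Q x) ` F"
    then obtain Q where Q: "Q \<in> F" "a = dev \<mu> \<M> Q x" by auto
    have "dev \<mu> \<M> Q x \<le> (\<Sum>i\<in>{1..m}. W i Q (x i))"
      unfolding sumW using v Q F by (auto intro!: sum_nonneg divide_nonneg_nonneg)
    also have "\<dots> \<le> Z x" unfolding Z_def using F Q by (intro Max_ge) auto
    finally show "a \<le> Z x" using Q by simp
  qed (use F in auto)
  have ZD: "Z x \<le> ?D x + Y / 30" for x
    unfolding Z_def
  proof (rule Max.boundedI)
    fix a assume "a \<in> (\<lambda>Q. \<Sum>i\<in>{1..m}. W i Q (x i)) ` F"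
    then obtain Q where Q: "Q \<in> F" "a = (\<Sum>i\<in>{1..m}. W i Q (x i))" by auto
    have "dev \<mu> \<M> Q x \<le> ?D x" using F Q by (intro Max_ge) auto
    moreover have "(\<Sum>i=1..m. v Q i) / 60 \<le> Y / 30"
      using v(3)[of Q] y[OF Q(1)] Q F by auto
    ultimately show "a \<le> ?D x + Y / 30" unfolding Q(2) sumW by linarith
  qed (use F in auto)
  have Wm: "W i Q \<in> borel_measurable (Ps i)" if "Q \<in> F" for i Q
    unfolding W_def[abs_def] using psi_dens_measurable[OF rep P_in, of Q] that F by (intro measurable_Ps) auto
  have Wb: "\<bar>W i Q x\<bar> \<le> 3" if "Q \<in> F" "x \<in> space (Ps i)" for i Q x
  proof -
    have "Q \<in> \<PP>" "x \<in> space S" using that F space_Ps by auto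
    then have "\<bar>psi_dens \<mu> \<M> P Q x\<bar> \<le> 1" "\<bar>e Q i\<bar> \<le> 1" "0 \<le> v Q i" "v Q i \<le> 1"
      using abs_psi_dens_le[OF rep P_in] e1 v by auto
    then show ?thesis unfolding W_def by linarith
  qed
  \<comment> \<open>\<open>W\<close> has mean \<open>v / 60\<close> and second moment
    \<open>v + v\<^sup>2 / 3600\<close>, which is at most \<open>3601 / 3600 * v\<close> because
    \<open>v \<le> 1\<close>; hence \<open>k = 60 / 3601\<close>.\<close>
  have mom: "60 / 3601 * (\<integral>x. (W i Q x)\<^sup>2 \<partial>Ps i) \<le> (\<integral>x. W i Q x \<partial>Ps i)" if "Q \<in> F" for i Q
  proof -
    have Q: "Q \<in> \<PP>" using that F by auto
    have "(v Q i)\<^sup>2 \<le> v Q i * 1"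
      unfolding power2_eq_square using v(1,2)[OF Q, of i] by (intro mult_left_mono) auto
    then show ?thesis unfolding EW[OF Q] EW2[OF Q] by (simp add: power_divide)
  qed
  \<comment> \<open>Here \<open>K = 3\<close> rounds up the bound \<open>2 + 1 / 60\<close> of
    \<open>W\<close>, and \<open>c = 0.51\<close> is half of an upper bound of
    \<open>exp (3 / 300)\<close>.\<close>
  have ex: "exp (1 / 300 * 3) \<le> 2 * (0.51 :: real)"
    using exp_bound[of "1/100 :: real"] by (simp add: power2_eq_square)
  have "ln (\<integral>x. exp (1 / 300 * Z x) \<partial>PM) \<le> 1 / 300 * (\<integral>x. Z x \<partial>PM) / (1 - 0.51 / (60 / 3601) * (1 / 300))"
    unfolding Z_def
    by (rule ln_mgf_Max_sum_le[where K = 3]) (use F Wm Wb mom ex in auto)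
  also have "\<dots> \<le> 1 / 300 * ((w + Y / 30) * 1.1137)"
  proof -
    have Zb: "\<bar>Z x\<bar> \<le> 3 * real m" if "x \<in> space PM" for x
    proof -
      have "\<bar>\<Sum>i\<in>{1..m}. W i Q (x i)\<bar> \<le> 3 * real m" if Q: "Q \<in> F" for Q
      proof -
        have "\<bar>\<Sum>i\<in>{1..m}. W i Q (x i)\<bar> \<le> (\<Sum>i\<in>{1..m}. 3)"
          using Wb[OF Q] space_PM[OF \<open>x \<in> space PM\<close>] space_Ps
          by (intro order_trans[OF sum_abs] sum_mono) auto
        then show ?thesis by simp
      qed
      then show ?thesis
        unfolding Z_def using Max_in[of "(\<lambda>Q. \<Sum>i\<in>{1..m}. W i Q (x i)) ` F"] F by (auto simp del: Max_in)
    qed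
    have Zm: "Z \<in> borel_measurable PM"
      unfolding Z_def[abs_def] sumW using F dev_measurable by (intro borel_measurable_Max) auto
    have ZI: "integrable PM Z" using Zm Zb by (rule P.integrable_bounded)
    have "(\<integral>x. Z x \<partial>PM) \<le> (\<integral>x. ?D x + Y / 30 \<partial>PM)"
      by (intro integral_mono Bochner_Integration.integrable_add P.integrable_const ZI Max_dev_integrable[OF F] ZD)
    also have "\<dots> \<le> w + Y / 30"
      using w Max_dev_integrable[OF F] by (simp add: P.prob_space del: One_nat_def)
    finally have Zw: "(\<integral>x. Z x \<partial>PM) \<le> w + Y / 30" .
    obtain Q where Q: "Q \<in> F" using F by auto
    have "0 \<le> Y" using y[OF Q] unfolding H_def A_def
      by (meson add_nonneg_nonneg hellinger_sq_nonneg order_trans sum_nonneg)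
    \<comment> \<open>The loss \<open>c / k * l\<close> is about \<open>0.1020\<close>, and
      \<open>1 / (1 - 0.1020)\<close> is just below \<open>1.1137\<close>.\<close>
    then have "(w + Y / 30) / (1 - 0.51 / (60 / 3601) * (1 / 300)) \<le> (w + Y / 30) * 1.1137"
      using w0 by (simp add: field_simps)
    with divide_right_mono[OF Zw, of "1 - 0.51 / (60 / 3601) * (1 / 300)"] show ?thesis by simp
  qed
  finally have ln: "ln (\<integral>x. exp (1 / 300 * Z x) \<partial>PM) \<le> 1 / 300 * ((w + Y / 30) * 1.1137)" .
  have Zm: "Z \<in> borel_measurable PM"
    unfolding Z_def[abs_def] sumW using F dev_measurable by (intro borel_measurable_Max) auto
  have Dm: "?D \<in> borel_measurable PM" by (rule Max_dev_measurable[OF F])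
  have Db: "\<bar>?D x\<bar> \<le> 2 * real m" if "x \<in> space PM" for x by (rule abs_Max_dev_le[OF F that])
  have eDb: "exp (1 / 300 * ?D x) \<le> exp (2 * real m)" "exp (- (2 * real m)) \<le> exp (1 / 300 * ?D x)"
    if "x \<in> space PM" for x
    using Db[OF that] by auto
  have eD: "integrable PM (\<lambda>x. exp (1 / 300 * ?D x))"
    using Dm eDb(1) by (intro P.integrable_bounded[where B = "exp (2 * real m)"]) auto
  have "\<bar>exp (1 / 300 * Z x)\<bar> \<le> exp (2 * real m + Y)" if "x \<in> space PM" for x
  proof -
    obtain Q where Q: "Q \<in> F" using F by auto
    have "0 \<le> Y" using y[OF Q] unfolding H_def A_def
      by (meson add_nonneg_nonneg hellinger_sq_nonneg order_trans sum_nonneg)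
    then show ?thesis using Db[OF that] ZD[of x] by auto
  qed
  then have eZ: "integrable PM (\<lambda>x. exp (1 / 300 * Z x))"
    using Zm by (intro P.integrable_bounded[where B = "exp (2 * real m + Y)"]) auto
  have le: "(\<integral>x. exp (1 / 300 * ?D x) \<partial>PM) \<le> (\<integral>x. exp (1 / 300 * Z x) \<partial>PM)"
    using eD eZ DZ by (intro integral_mono) auto
  have "exp (- (2 * real m)) \<le> (\<integral>x. exp (1 / 300 * ?D x) \<partial>PM)"
    using eD eDb(2,1) by (rule P.integral_between(1))
  then have "0 < (\<integral>x. exp (1 / 300 * Z x) \<partial>PM)"
    using le by (meson exp_gt_zero less_le_trans)
  with ln have "(\<integral>x. exp (1 / 300 * Z x) \<partial>PM) \<le> exp (1 / 300 * ((w + Y / 30) * 1.1137))"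
    by (metis exp_le_cancel_iff exp_ln)
  with le show ?thesis by simp
qed

end

end

subsection \<open>Peeling\<close>

text \<open>The concentration inequality concerns finite maxima. Along an exhaustion by finite sets
  the suprema increase, and monotone convergence carries a uniform bound to the whole
  family.\<close>

lemma nn_integral_SUP_countable_le:
  fixes g :: "'b \<Rightarrow> 'a \<Rightarrow> ennreal"
  assumes C: "countable C" and g: "\<And>Q. Q \<in> C \<Longrightarrow> g Q \<in> borel_measurable M"
    and le: "\<And>F. finite F \<Longrightarrow> F \<noteq> {} \<Longrightarrow> F \<subseteq> C \<Longrightarrow> (\<integral>\<^sup>+x. (SUP Q\<in>F. g Q x) \<partial>M) \<le> B"
  shows "(\<integral>\<^sup>+x. (SUP Q\<in>C. g Q x) \<partial>M) \<le> B"
proof (cases "C = {}")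
  case False
  define F where "F n = from_nat_into C ` {..n}" for n
  have FC: "F n \<subseteq> C" "finite (F n)" "F n \<noteq> {}" for n
    using from_nat_into[OF False] by (auto simp: F_def)
  have "(SUP Q\<in>C. g Q x) = (SUP n. SUP Q\<in>F n. g Q x)" for x
  proof -
    have "C = (\<Union>n. F n)"
      using range_from_nat_into[OF False C] by (simp add: F_def image_UN[symmetric] UN_atMost_UNIV)
    then show ?thesis by (simp add: SUP_UNION)
  qed
  then have "(\<integral>\<^sup>+x. (SUP Q\<in>C. g Q x) \<partial>M) = (\<integral>\<^sup>+x. (SUP n. SUP Q\<in>F n. g Q x) \<partial>M)" by simp
  also have "\<dots> = (SUP n. \<integral>\<^sup>+x. (SUP Q\<in>F n. g Q x) \<partial>M)"
  proof (rule nn_integral_monotone_convergence_SUP)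
    show "incseq (\<lambda>n x. SUP Q\<in>F n. g Q x)"
      unfolding F_def by (intro monoI le_funI SUP_subset_mono image_mono) auto
    show "(\<lambda>x. SUP Q\<in>F n. g Q x) \<in> borel_measurable M" for n
    proof (rule borel_measurable_SUP)
      show "countable (F n)" using FC(2) by (rule countable_finite)
      show "g Q \<in> borel_measurable M" if "Q \<in> F n" for Q using FC(1)[of n] that g by blast
    qed
  qed
  also have "\<dots> \<le> B" using le FC by (intro SUP_least) auto
  finally show ?thesis .
qed (simp add: bot_ennreal)

lemma exp_minus_le_inverse:
  fixes t :: real
  assumes "0 < t"
  shows "exp (- t) \<le> 1 / t"
proof -
  have "t \<le> exp t" using exp_ge_add_one_self[of t] by linarith
  then show ?thesis using assms by (simp add: exp_minus field_simps)
qed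

text \<open>As \<open>2 powr (21/2)\<close> is about \<open>1448\<close>, squared radii from
  \<open>500 * D\<close> on lie beyond the supremum defining a dimension of at most
  \<open>D\<close>.\<close>

lemma rho_dim_factor_gt: "3 / 2 powr (21/2) * 500 > (1::real)"
proof -
  have "(2 powr (21/2))\<^sup>2 = (2::real) ^ 21"
    by (simp add: power2_eq_square flip: powr_add powr_realpow)
  also have "\<dots> < 1500\<^sup>2" by simp
  finally have "2 powr (21/2) < (1500::real)" by (rule power2_less_imp_less) simp
  then show ?thesis by (simp add: field_simps)
qed

context rho_product
begin

text \<open>A radius this large lies outside the set in the definition of the dimension, so
  \<open>w_inf\<close> is at most \<open>3/64 * y\<^sup>2 = 0.046875 * y\<^sup>2\<close>. Rounding
  up to \<open>0.048\<close> makes the inequality strict, so that some representation in the infimum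
  satisfies it.\<close>

lemma w_inf_less:
  assumes D: "rho_dim S \<PP> m Ps P \<le> ennreal D" "1 \<le> D" and y: "0 < y" "500 * D \<le> y\<^sup>2"
  shows "w_inf S \<PP> m Ps P y < ennreal (0.048 * y\<^sup>2)"
proof (rule ccontr)
  assume "\<not> ?thesis"
  then have "ennreal (0.048 * y\<^sup>2) \<le> w_inf S \<PP> m Ps P y" by simp
  moreover have "ennreal (3 * y\<^sup>2 / 64) < ennreal (0.048 * y\<^sup>2)"
    using y by (intro ennreal_lessI) auto
  ultimately have "y \<in> {y. 0 < y \<and> w_inf S \<PP> m Ps P y > ennreal (3 * y\<^sup>2 / 64)}"
    using y by auto
  then have "ennreal (y\<^sup>2) \<le> (SUP y\<in>{y. 0 < y \<and> w_inf S \<PP> m Ps P y > ennreal (3 * y\<^sup>2 / 64)}. ennreal (y\<^sup>2))"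
    by (rule SUP_upper)
  then have "ennreal (3 / 2 powr (21/2)) * ennreal (y\<^sup>2) \<le> rho_dim S \<PP> m Ps P"
    unfolding rho_dim_def by (intro max.coboundedI1 mult_left_mono) auto
  then have "ennreal (3 / 2 powr (21/2) * y\<^sup>2) \<le> ennreal D"
    using D by (subst ennreal_mult) auto
  then have 1: "3 / 2 powr (21/2) * y\<^sup>2 \<le> D" using D by (simp add: ennreal_le_iff)
  have "1 * D < 3 / 2 powr (21/2) * 500 * D"
    using D(2) by (intro mult_strict_right_mono rho_dim_factor_gt) simp
  then have "D < 3 / 2 powr (21/2) * 500 * D" by simp
  also have "\<dots> = 3 / 2 powr (21/2) * (500 * D)" by simp
  also have "\<dots> \<le> 3 / 2 powr (21/2) * y\<^sup>2" using y by (intro mult_left_mono) auto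
  finally show False using 1 by simp
qed

lemma H_nonneg: "0 \<le> H" and A_nonneg: "0 \<le> A Q"
  by (auto simp: H_def A_def intro!: sum_nonneg)

lemma rho_ball_iff: "Q \<in> rho_ball \<PP> m Ps P y \<longleftrightarrow> Q \<in> \<PP> \<and> H + A Q < y\<^sup>2"
  by (simp add: rho_ball_def H_def A_def sum.distrib)

text \<open>
  The infimum in \<open>w_inf\<close> may be approached by other representations than the one the estimator
  uses. The two processes agree off a \<open>P\<close>-null set, whose total mass under the \<open>Ps i\<close> is at most
  \<open>2 H\<close>.
\<close>

lemma expectation_Max_dev_le:
  assumes rep: "represents S \<mu> \<M> \<PP>"
    and D: "rho_dim S \<PP> m Ps P \<le> ennreal D" "1 \<le> D" and y: "0 < y" "500 * D \<le> y\<^sup>2"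
    and F: "finite F" "F \<noteq> {}" "F \<subseteq> \<PP>" and Fy: "\<And>Q. Q \<in> F \<Longrightarrow> H + A Q < y\<^sup>2"
  shows "(\<integral>x. Max ((\<lambda>Q. dev \<mu> \<M> Q x) ` F) \<partial>PM) \<le> 0.048 * y\<^sup>2 + 8 * H"
proof -
  obtain \<nu> \<N> where rep': "represents S \<nu> \<N> \<PP>" and w: "w_rep \<nu> \<N> \<PP> m Ps P y < ennreal (0.048 * y\<^sup>2)"
    using w_inf_less[OF D y] unfolding w_inf_def by (auto simp: INF_less_iff)
  obtain N where N: "N \<in> sets S" "emeasure P N = 0"
    "\<And>Q x. Q \<in> \<PP> \<Longrightarrow> x \<in> space S - N \<Longrightarrow> psi_dens \<mu> \<M> P Q x = psi_dens \<nu> \<N> P Q x"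
    using psi_dens_eq_outside_null[OF rep rep' countable_model model_prob P_in] by blast
  define \<delta> where "\<delta> i = measure (Ps i) N" for i
  have \<delta>H: "(\<Sum>i=1..m. \<delta> i) \<le> 2 * H"
    unfolding H_def sum_distrib_left \<delta>_def using Ps P_in model_prob N
    by (intro sum_mono measure_null_le_hellinger_sq) auto
  have pd: "\<bar>psi_dens \<mu> \<M> P Q x - psi_dens \<nu> \<N> P Q x\<bar> \<le> 2 * indicator N x" if "Q \<in> \<PP>" "x \<in> space S" for Q x
  proof (cases "x \<in> N")
    case True
    then show ?thesis
      using abs_psi_dens_le[OF rep P_in that] abs_psi_dens_le[OF rep' P_in that] by simp
  next
    case False then show ?thesis using N(3) that by simp
  qed
  have indI: "integrable (Ps i) (\<lambda>z. 2 * indicator N z :: real)" for i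
    using N by (intro M.integrable_bounded[where B = 2] measurable_Ps) (auto simp: indicator_def)
  have ed: "(\<integral>z. psi_dens \<nu> \<N> P Q z \<partial>Ps i) - (\<integral>z. psi_dens \<mu> \<M> P Q z \<partial>Ps i) \<le> 2 * \<delta> i" if Q: "Q \<in> \<PP>" for Q i
  proof -
    have "(\<integral>z. psi_dens \<nu> \<N> P Q z \<partial>Ps i) - (\<integral>z. psi_dens \<mu> \<M> P Q z \<partial>Ps i)
        = (\<integral>z. psi_dens \<nu> \<N> P Q z - psi_dens \<mu> \<M> P Q z \<partial>Ps i)"
      using psi_dens_integrable[OF rep Q] psi_dens_integrable[OF rep' Q] by simp
    also have "\<dots> \<le> (\<integral>z. 2 * indicator N z \<partial>Ps i)"
    proof (rule integral_mono[OF _ indI])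
      show "psi_dens \<nu> \<N> P Q z - psi_dens \<mu> \<M> P Q z \<le> 2 * indicator N z" if "z \<in> space (Ps i)" for z
        using pd[OF Q, of z] that space_Ps by auto
    qed (use psi_dens_integrable[OF rep Q] psi_dens_integrable[OF rep' Q] in auto)
    also have "\<dots> = 2 * \<delta> i"
      using N sets_Ps by (simp add: \<delta>_def)
    finally show ?thesis .
  qed
  define cnt :: "(nat \<Rightarrow> 'a) \<Rightarrow> real" where "cnt x = (\<Sum>i=1..m. 2 * indicator N (x i))" for x
  define \<Delta> where "\<Delta> = (\<Sum>i=1..m. \<delta> i)"
  have dd: "dev \<mu> \<M> Q x \<le> \<bar>dev \<nu> \<N> Q x\<bar> + (cnt x + 2 * \<Delta>)" if "Q \<in> \<PP>" "x \<in> space PM" for Q x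
  proof -
    have "dev \<mu> \<M> Q x \<le> (\<Sum>i=1..m. (psi_dens \<nu> \<N> P Q (x i) - (\<integral>z. psi_dens \<nu> \<N> P Q z \<partial>Ps i)) + 2 * indicator N (x i) + 2 * \<delta> i)"
      unfolding dev_def
    proof (rule sum_mono)
      fix i assume i: "i \<in> {1..m}"
      show "psi_dens \<mu> \<M> P Q (x i) - (\<integral>z. psi_dens \<mu> \<M> P Q z \<partial>Ps i)
        \<le> (psi_dens \<nu> \<N> P Q (x i) - (\<integral>z. psi_dens \<nu> \<N> P Q z \<partial>Ps i)) + 2 * indicator N (x i) + 2 * \<delta> i"
        using pd[OF that(1) space_PM[OF that(2) i]] ed[OF that(1), of i] by linarith
    qed
    also have "\<dots> = dev \<nu> \<N> Q x + cnt x + 2 * \<Delta>"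
      unfolding dev_def cnt_def \<Delta>_def sum.distrib sum_distrib_left ..
    finally show ?thesis by linarith
  qed
  let ?S = "\<lambda>x. Max ((\<lambda>Q. \<bar>dev \<nu> \<N> Q x\<bar>) ` F)"
  have Sm: "?S \<in> borel_measurable PM"
    using F dev_measurable[OF rep'] by (intro borel_measurable_Max borel_measurable_abs) auto
  have Sb: "0 \<le> ?S x \<and> ?S x \<le> 2 * real m" if x: "x \<in> space PM" for x
  proof -
    obtain Q where "Q \<in> F" "?S x = \<bar>dev \<nu> \<N> Q x\<bar>"
      using Max_in[of "(\<lambda>Q. \<bar>dev \<nu> \<N> Q x\<bar>) ` F"] F by (auto simp del: Max_in)
    then show ?thesis using abs_dev_le[OF rep' _ x, of Q] F by auto
  qed
  have SI: "integrable PM ?S"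
  proof (rule P.integrable_bounded[OF Sm])
    show "\<bar>?S x\<bar> \<le> 2 * real m" if "x \<in> space PM" for x using Sb[OF that] by simp
  qed
  have "ennreal (\<integral>x. ?S x \<partial>PM) = (\<integral>\<^sup>+x. ennreal (?S x) \<partial>PM)"
    using SI Sb by (intro nn_integral_eq_integral[symmetric] AE_I2) auto
  also have "\<dots> \<le> w_rep \<nu> \<N> \<PP> m Ps P y"
    unfolding w_rep_def
  proof (rule nn_integral_mono)
    fix x assume "x \<in> space PM"
    obtain Q where Q: "Q \<in> F" "?S x = \<bar>dev \<nu> \<N> Q x\<bar>"
      using Max_in[of "(\<lambda>Q. \<bar>dev \<nu> \<N> Q x\<bar>) ` F"] F by (auto simp del: Max_in)
    then have Q': "Q \<in> \<PP>" "Q \<in> rho_ball \<PP> m Ps P y" using F Fy by (auto simp: rho_ball_iff)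
    show "ennreal (?S x) \<le> (SUP Q\<in>rho_ball \<PP> m Ps P y. ennreal \<bar>T_stat m x (density_in \<nu> \<N> P) (density_in \<nu> \<N> Q)
          - (\<integral>z. T_stat m z (density_in \<nu> \<N> P) (density_in \<nu> \<N> Q) \<partial>PM)\<bar>)"
      unfolding Q(2) dev_eq[OF rep' Q'(1)] using Q'(2) by (rule SUP_upper)
  qed
  also have "\<dots> \<le> ennreal (0.048 * y\<^sup>2)" using w by simp
  finally have ES: "(\<integral>x. ?S x \<partial>PM) \<le> 0.048 * y\<^sup>2" by (simp add: ennreal_le_iff)
  have cm: "(\<lambda>z. 2 * indicator N z :: real) \<in> borel_measurable S" using N by simp
  have ci: "integrable PM (\<lambda>x. 2 * indicator N (x i) :: real)" if "i \<in> {1..m}" for i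
    using that cm by (rule component_integrable[where B = 2]) (simp add: indicator_def)
  have cI: "integrable PM cnt" unfolding cnt_def using ci by (intro Bochner_Integration.integrable_sum) auto
  have Ec: "(\<integral>x. cnt x \<partial>PM) = 2 * \<Delta>"
  proof -
    have "(\<integral>x. cnt x \<partial>PM) = (\<Sum>i=1..m. \<integral>x. 2 * indicator N (x i) \<partial>PM)"
      unfolding cnt_def using ci by (intro Bochner_Integration.integral_sum) auto
    also have "\<dots> = (\<Sum>i=1..m. \<integral>z. 2 * indicator N z \<partial>Ps i)"
      by (intro sum.cong refl component_integral[OF _ cm])
    also have "\<dots> = 2 * \<Delta>"
      unfolding \<Delta>_def sum_distrib_left using N sets_Ps by (simp add: \<delta>_def)
    finally show ?thesis .
  qed
  have "(\<integral>x. Max ((\<lambda>Q. dev \<mu> \<M> Q x) ` F) \<partial>PM) \<le> (\<integral>x. ?S x + (cnt x + 2 * \<Delta>) \<partial>PM)"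
  proof (intro integral_mono Max_dev_integrable[OF rep F] Bochner_Integration.integrable_add SI cI P.integrable_const)
    fix x assume x: "x \<in> space PM"
    show "Max ((\<lambda>Q. dev \<mu> \<M> Q x) ` F) \<le> ?S x + (cnt x + 2 * \<Delta>)"
    proof (rule Max.boundedI)
      fix a assume "a \<in> (\<lambda>Q. dev \<mu> \<M> Q x) ` F"
      then obtain Q where Q: "Q \<in> F" "a = dev \<mu> \<M> Q x" by auto
      have "\<bar>dev \<nu> \<N> Q x\<bar> \<le> ?S x" using F Q by (intro Max_ge) auto
      moreover have "a \<le> \<bar>dev \<nu> \<N> Q x\<bar> + (cnt x + 2 * \<Delta>)" using dd[of Q x] x Q F by blast
      ultimately show "a \<le> ?S x + (cnt x + 2 * \<Delta>)" by linarith
    qed (use F in auto)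
  qed
  \<comment> \<open>Changing the representation moves each summand by at most \<open>2\<close> on
    \<open>N\<close> and its mean by at most \<open>2 * \<delta> i\<close>. In expectation each
    effect sums to \<open>2 * \<Delta>\<close>, and \<open>\<Delta> \<le> 2 * H\<close> makes the
    total at most \<open>8 * H\<close>.\<close>
  also have "\<dots> = (\<integral>x. ?S x \<partial>PM) + 4 * \<Delta>"
    using SI cI Ec by (simp add: P.prob_space del: One_nat_def)
  also have "\<dots> \<le> 0.048 * y\<^sup>2 + 8 * H" using ES \<delta>H by (simp add: \<Delta>_def)
  finally show ?thesis .
qed

text \<open>The coefficients round up \<open>(0.048 + 1 / 30) * 1.1137\<close> and
  \<open>8 * 1.1137\<close>.\<close>

lemma nn_integral_exp_SUP_dev_le:
  assumes rep: "represents S \<mu> \<M> \<PP>"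
    and D: "rho_dim S \<PP> m Ps P \<le> ennreal D" "1 \<le> D" and Y: "500 * D \<le> Y"
    and C: "C \<subseteq> \<PP>" and CY: "\<And>Q. Q \<in> C \<Longrightarrow> H + A Q < Y"
  shows "(\<integral>\<^sup>+x. (SUP Q\<in>C. ennreal (exp (1 / 300 * dev \<mu> \<M> Q x))) \<partial>PM)
     \<le> ennreal (exp (1 / 300 * (0.0906 * Y + 8.91 * H)))"
proof (rule nn_integral_SUP_countable_le)
  show "countable C" using C countable_model by (rule countable_subset)
  show "(\<lambda>x. ennreal (exp (1 / 300 * dev \<mu> \<M> Q x))) \<in> borel_measurable PM" if "Q \<in> C" for Q
    using dev_measurable[OF rep, of Q] that C by auto
  fix F assume F: "finite F" "F \<noteq> {}" "F \<subseteq> C"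
  define y where "y = sqrt Y"
  have Y0: "0 < Y" using Y D by linarith
  have y: "0 < y" "y\<^sup>2 = Y" using Y0 by (auto simp: y_def)
  have F': "F \<subseteq> \<PP>" using F C by auto
  let ?X = "\<lambda>x. Max ((\<lambda>Q. dev \<mu> \<M> Q x) ` F)"
  have 1: "(\<integral>x. ?X x \<partial>PM) \<le> 0.048 * Y + 8 * H"
    using expectation_Max_dev_le[OF rep D y(1) _ F(1,2) F'] CY F Y unfolding y(2) by auto
  have "(\<integral>x. exp (1 / 300 * ?X x) \<partial>PM) \<le> exp (1 / 300 * ((0.048 * Y + 8 * H + Y / 30) * 1.1137))"
    using CY F Y0 H_nonneg by (intro exp_Max_dev_le[OF rep F(1,2) F' _ 1]) (auto intro: less_imp_le)
  also have "\<dots> \<le> exp (1 / 300 * (0.0906 * Y + 8.91 * H))"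
    using Y0 H_nonneg by simp
  finally have 2: "(\<integral>x. exp (1 / 300 * ?X x) \<partial>PM) \<le> exp (1 / 300 * (0.0906 * Y + 8.91 * H))" .
  have eb: "\<bar>exp (1 / 300 * ?X x)\<bar> \<le> exp (2 * real m)" if "x \<in> space PM" for x
    using abs_Max_dev_le[OF rep F(1,2) F' that] by auto
  have eI: "integrable PM (\<lambda>x. exp (1 / 300 * ?X x))"
  proof (rule P.integrable_bounded[OF _ eb])
    show "(\<lambda>x. exp (1 / 300 * ?X x)) \<in> borel_measurable PM"
      using Max_dev_measurable[OF rep F(1,2) F'] by measurable
  qed
  have "(\<integral>\<^sup>+x. (SUP Q\<in>F. ennreal (exp (1 / 300 * dev \<mu> \<M> Q x))) \<partial>PM) \<le> (\<integral>\<^sup>+x. ennreal (exp (1 / 300 * ?X x)) \<partial>PM)"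
    using F by (intro nn_integral_mono SUP_least ennreal_leI) auto
  also have "\<dots> = ennreal (\<integral>x. exp (1 / 300 * ?X x) \<partial>PM)"
    using eI by (intro nn_integral_eq_integral) auto
  also have "\<dots> \<le> ennreal (exp (1 / 300 * (0.0906 * Y + 8.91 * H)))"
    using 2 by (rule ennreal_leI)
  finally show "(\<integral>\<^sup>+x. (SUP Q\<in>F. ennreal (exp (1 / 300 * dev \<mu> \<M> Q x))) \<partial>PM)
      \<le> ennreal (exp (1 / 300 * (0.0906 * Y + 8.91 * H)))" .
qed

text \<open>The first shell is a full ball; its disjunct \<open>k = 0\<close> also keeps the
  truncated \<open>k - 1\<close> out. Starting at \<open>1000 * D\<close> instead of
  \<open>500 * D\<close> shrinks the contributions of the later shells and costs only a larger
  multiple of \<open>D\<close> in the exponent of the first.\<close>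

definition shell :: "real \<Rightarrow> nat \<Rightarrow> 'a measure set" where
  "shell D k = {Q \<in> \<PP>. H + A Q < 1000 * D * (3/2) ^ k \<and> (k = 0 \<or> 1000 * D * (3/2) ^ (k - 1) \<le> H + A Q)}"

text \<open>
  On a shell \<open>(2/3) Y \<le> H + A Q < Y\<close> the supremum of \<open>dev\<close> costs \<open>0.0906 Y + 8.91 H\<close>. The
  coefficient \<open>0.17\<close> exceeds \<open>(3/2) * 0.0906\<close>, so that the series converges, and is less than the
  drift coefficient \<open>3/8\<close>.
\<close>

definition peel :: "'a measure \<Rightarrow> ('a \<Rightarrow> real) set \<Rightarrow> real \<Rightarrow> (nat \<Rightarrow> 'a) \<Rightarrow> ennreal" where
  "peel \<mu> \<M> D x =
     (\<Sum>k. SUP Q\<in>shell D k. ennreal (exp (1 / 300 * (dev \<mu> \<M> Q x - 0.17 * (H + A Q) - 8.91 * H))))"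

lemma ex_shell:
  assumes "1 \<le> D" "Q \<in> \<PP>"
  shows "\<exists>k. Q \<in> shell D k"
proof -
  define L where "L k \<longleftrightarrow> H + A Q < 1000 * D * (3/2) ^ k" for k
  obtain k where "(H + A Q) / (1000 * D) < (3/2) ^ k"
    using real_arch_pow[of "3/2" "(H + A Q) / (1000 * D)"] by auto
  then have "L k" using assms by (simp add: L_def field_simps)
  then have *: "L (LEAST k. L k)" by (rule LeastI)
  have "(LEAST k. L k) = 0 \<or> \<not> L ((LEAST k. L k) - 1)"
    using not_less_Least[of "(LEAST k. L k) - 1" L] by (cases "(LEAST k. L k)") auto
  with * assms show ?thesis
    unfolding L_def shell_def by (intro exI[of _ "LEAST k. L k"]) (auto simp: L_def)
qed

lemma exp_dev_le_peel:
  assumes "1 \<le> D" "Q \<in> \<PP>"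
  shows "ennreal (exp (1 / 300 * (dev \<mu> \<M> Q x - 0.17 * (H + A Q) - 8.91 * H))) \<le> peel \<mu> \<M> D x"
proof -
  let ?f = "\<lambda>k. SUP Q\<in>shell D k. ennreal (exp (1 / 300 * (dev \<mu> \<M> Q x - 0.17 * (H + A Q) - 8.91 * H)))"
  obtain k where k: "Q \<in> shell D k" using ex_shell[OF assms] by auto
  then have "ennreal (exp (1 / 300 * (dev \<mu> \<M> Q x - 0.17 * (H + A Q) - 8.91 * H))) \<le> ?f k"
    by (rule SUP_upper)
  also have "\<dots> \<le> (\<Sum>k. ?f k)"
    using sum_le_suminf[of ?f "{k}"] by simp
  finally show ?thesis by (simp add: peel_def)
qed

text \<open>The ball contributes at most \<open>exp (90.6 / 300 * D)\<close>. On a later shell the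
  lower bound \<open>2/3 * Y\<close> of \<open>H + A Q\<close> makes the exponent
  \<open>(0.0906 - 0.17 * 2/3) * Y / 300\<close> negative, and \<open>Y\<close> grows geometrically.
  The factor \<open>42 = 14 * 3\<close> is the sum of the series.\<close>

lemma nn_integral_peel_le:
  assumes rep: "represents S \<mu> \<M> \<PP>"
    and D: "rho_dim S \<PP> m Ps P \<le> ennreal D" "1 \<le> D"
  shows "(\<integral>\<^sup>+x. peel \<mu> \<M> D x \<partial>PM) \<le> ennreal (42 * exp (91 / 300 * D))"
proof -
  let ?g = "\<lambda>Q x. ennreal (exp (1 / 300 * (dev \<mu> \<M> Q x - 0.17 * (H + A Q) - 8.91 * H)))"
  have sh: "shell D k \<subseteq> \<PP>" for k by (auto simp: shell_def)
  have m: "(\<lambda>x. SUP Q\<in>shell D k. ?g Q x) \<in> borel_measurable PM" for k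
  proof (intro borel_measurable_SUP)
    show "countable (shell D k)" using sh countable_model by (rule countable_subset)
    show "?g Q \<in> borel_measurable PM" if "Q \<in> shell D k" for Q
    proof -
      have [measurable]: "dev \<mu> \<M> Q \<in> borel_measurable PM"
        using dev_measurable[OF rep, of Q] that sh by auto
      show ?thesis by measurable
    qed
  qed
  have step: "(\<integral>\<^sup>+x. (SUP Q\<in>shell D k. ?g Q x) \<partial>PM) \<le> ennreal (14 * exp (91 / 300 * D) * (2/3) ^ k)" for k
  proof -
    define Y where "Y = 1000 * D * (3/2) ^ k"
    define lb where "lb = (if k = 0 then 0 else 2/3 * Y)"
    have lb: "lb \<le> H + A Q" if "Q \<in> shell D k" for Q
    proof (cases k)
      case 0 then show ?thesis using H_nonneg A_nonneg by (simp add: lb_def)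
    next
      case (Suc j) then show ?thesis using that by (simp add: lb_def Y_def shell_def)
    qed
    have Y1: "1000 * D \<le> Y" using D one_le_power[of "3/2::real" k] by (simp add: Y_def)
    let ?c = "ennreal (exp (1 / 300 * (- 0.17 * lb - 8.91 * H)))"
    have "(\<integral>\<^sup>+x. (SUP Q\<in>shell D k. ?g Q x) \<partial>PM)
       \<le> (\<integral>\<^sup>+x. ?c * (SUP Q\<in>shell D k. ennreal (exp (1 / 300 * dev \<mu> \<M> Q x))) \<partial>PM)"
    proof (intro nn_integral_mono SUP_least)
      fix x Q assume Q: "Q \<in> shell D k"
      have "?g Q x \<le> ennreal (exp (1 / 300 * (- 0.17 * lb - 8.91 * H)) * exp (1 / 300 * dev \<mu> \<M> Q x))"
        using lb[OF Q] by (intro ennreal_leI) (simp flip: exp_add)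
      also have "\<dots> = ?c * ennreal (exp (1 / 300 * dev \<mu> \<M> Q x))"
        by (rule ennreal_mult) auto
      also have "\<dots> \<le> ?c * (SUP Q\<in>shell D k. ennreal (exp (1 / 300 * dev \<mu> \<M> Q x)))"
        using Q by (intro mult_left_mono SUP_upper) auto
      finally show "?g Q x \<le> ?c * (SUP Q\<in>shell D k. ennreal (exp (1 / 300 * dev \<mu> \<M> Q x)))" .
    qed
    also have "\<dots> = ?c * (\<integral>\<^sup>+x. (SUP Q\<in>shell D k. ennreal (exp (1 / 300 * dev \<mu> \<M> Q x))) \<partial>PM)"
    proof (rule nn_integral_cmult, intro borel_measurable_SUP)
      show "countable (shell D k)" using sh countable_model by (rule countable_subset)
      show "(\<lambda>x. ennreal (exp (1 / 300 * dev \<mu> \<M> Q x))) \<in> borel_measurable PM" if "Q \<in> shell D k" for Q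
      proof -
        have [measurable]: "dev \<mu> \<M> Q \<in> borel_measurable PM"
          using dev_measurable[OF rep, of Q] that sh by auto
        show ?thesis by measurable
      qed
    qed
    also have "\<dots> \<le> ?c * ennreal (exp (1 / 300 * (0.0906 * Y + 8.91 * H)))"
    proof (intro mult_left_mono nn_integral_exp_SUP_dev_le[OF rep D _ sh])
      show "500 * D \<le> Y" using Y1 D(2) by linarith
      show "H + A Q < Y" if "Q \<in> shell D k" for Q using that by (simp add: shell_def Y_def)
    qed simp
    also have "\<dots> = ennreal (exp (1 / 300 * (0.0906 * Y - 0.17 * lb)))"
      by (simp add: field_simps flip: ennreal_mult exp_add)
    also have "\<dots> \<le> ennreal (14 * exp (91 / 300 * D) * (2/3) ^ k)"
    proof (rule ennreal_leI)
      show "exp (1 / 300 * (0.0906 * Y - 0.17 * lb)) \<le> 14 * exp (91 / 300 * D) * (2/3) ^ k"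
      proof (cases "k = 0")
        case True
        have "exp (1 / 300 * (0.0906 * Y - 0.17 * lb)) \<le> exp (91 / 300 * D)"
          using True D by (simp add: lb_def Y_def)
        also have "\<dots> \<le> 14 * exp (91 / 300 * D)" by simp
        finally show ?thesis using True by simp
      next
        case False
        \<comment> \<open>\<open>0.0757\<close> is a lower bound of
          \<open>(0.17 * 2/3 - 0.0906) * 1000 / 300\<close>, and \<open>D \<ge> 1\<close> removes
          \<open>D\<close>. Since \<open>t\<close> is geometric in \<open>k\<close>, the crude
          \<open>exp (- t) \<le> 1 / t\<close> is already summable, with
          \<open>1 / 0.0757 \<le> 14\<close>.\<close>
        define t where "t = 0.0757 * (3/2 :: real) ^ k"
        have t: "0 < t" by (simp add: t_def)
        have "t \<le> 0.0757 * Y / 1000" using D by (simp add: t_def Y_def)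
        then have "exp (1 / 300 * (0.0906 * Y - 0.17 * lb)) \<le> exp (- t)"
          using False Y1 D by (simp add: lb_def)
        also have "\<dots> \<le> 1 / t" using t by (rule exp_minus_le_inverse)
        also have "\<dots> \<le> 14 * (2/3) ^ k" by (simp add: t_def field_simps power_divide)
        also have "\<dots> \<le> 14 * exp (91 / 300 * D) * (2/3) ^ k" using D by simp
        finally show ?thesis .
      qed
    qed
    finally show ?thesis .
  qed
  have sums: "(\<lambda>k. 14 * exp (91 / 300 * D) * (2/3::real) ^ k) sums (14 * exp (91 / 300 * D) * (1 / (1 - 2/3)))"
    by (intro sums_mult geometric_sums) simp
  have "(\<integral>\<^sup>+x. peel \<mu> \<M> D x \<partial>PM) = (\<Sum>k. \<integral>\<^sup>+x. (SUP Q\<in>shell D k. ?g Q x) \<partial>PM)"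
    unfolding peel_def by (rule nn_integral_suminf[OF m])
  also have "\<dots> \<le> (\<Sum>k. ennreal (14 * exp (91 / 300 * D) * (2/3) ^ k))"
    using step by (intro suminf_le) auto
  also have "\<dots> = ennreal (14 * exp (91 / 300 * D) * (1 / (1 - 2/3)))"
    by (rule suminf_ennreal_eq[OF _ sums]) simp
  finally show ?thesis by simp
qed

end

subsection \<open>Deviation of the estimator on one block\<close>

lemma topspace_hellinger [simp]: "topspace (hellinger_topology S) = space (prob_algebra S)"
  unfolding hellinger_topology_def by (rule Metric_space.topspace_mtopology[OF Metric_space_hellinger])

lemma space_hellinger_borel: "space (hellinger_borel S) = space (prob_algebra S)"
  by (simp add: hellinger_borel_def space_measure_of_conv)

lemma openin_sets_hellinger_borel: "openin (hellinger_topology S) U \<Longrightarrow> U \<in> sets (hellinger_borel S)"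
  unfolding hellinger_borel_def
  by (intro in_measure_of) (use openin_subset in \<open>fastforce\<close>)+

lemma measurable_hellinger:
  assumes R: "R \<in> space (prob_algebra S)" and f: "f \<in> M \<rightarrow>\<^sub>M hellinger_borel S"
  shows "(\<lambda>x. hellinger R (f x)) \<in> borel_measurable M"
proof (rule borel_measurableI_less)
  fix a :: real
  let ?B = "Metric_space.mball (space (prob_algebra S)) hellinger R a"
  have "openin (hellinger_topology S) ?B"
    unfolding hellinger_topology_def by (rule Metric_space.openin_mball[OF Metric_space_hellinger])
  then have "f -` ?B \<inter> space M \<in> sets M"
    using f openin_sets_hellinger_borel by (auto intro: measurable_sets)
  moreover have "f -` ?B \<inter> space M = {x \<in> space M. hellinger R (f x) < a}"
    using measurable_space[OF f] R
    by (auto simp: Metric_space.in_mball[OF Metric_space_hellinger] space_hellinger_borel)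
  ultimately show "{x \<in> space M. hellinger R (f x) < a} \<in> sets M" by simp
qed

text \<open>The Donsker--Varadhan inequality. With \<open>r\<close> the density of \<open>Q\<close>,
  the function \<open>g = exp f / (c * r)\<close> has \<open>Q\<close>-mean at most
  \<open>1\<close>; it is only an inequality because \<open>r\<close> may vanish on a set charged by
  \<open>P\<close>. Integrating \<open>ln g \<le> g - 1\<close> gives the claim.\<close>

lemma expectation_le_KL_plus_ln:
  assumes P: "prob_space P" and Q: "prob_space Q" and st: "sets Q = sets P"
    and KL: "KL Q P = ereal \<kappa>"
    and fm: "f \<in> borel_measurable P" and fb: "\<And>x. x \<in> space P \<Longrightarrow> \<bar>f x\<bar> \<le> B"
    and c: "(\<integral>\<^sup>+x. ennreal (exp (f x)) \<partial>P) \<le> ennreal c" "0 < c"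
  shows "(\<integral>x. f x \<partial>Q) \<le> \<kappa> + ln c"
proof -
  interpret P: prob_space P by fact
  interpret Q: prob_space Q by fact
  have sp: "space Q = space P" using st by (rule sets_eq_imp_space_eq)
  have ac: "absolutely_continuous P Q" and ei: "integrable Q (entropy_density (exp 1) P Q)"
    and \<kappa>: "\<kappa> = (\<integral>x. entropy_density (exp 1) P Q x \<partial>Q)"
    using KL by (auto simp: KL_def KL_divergence_def split: if_splits)
  define r where "r x = enn2real (RN_deriv P Q x)" for x
  have rm[measurable]: "r \<in> borel_measurable P" unfolding r_def by measurable
  have "AE x in P. RN_deriv P Q x \<noteq> \<infinity>"
    using ac st by (intro P.RN_deriv_finite Q.sigma_finite_measure_axioms) auto
  then have "AE x in P. RN_deriv P Q x = ennreal (r x)"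
    unfolding r_def by eventually_elim (simp add: less_top)
  then have Qd: "Q = density P (\<lambda>x. ennreal (r x))"
    using P.density_RN_deriv[OF ac st] density_cong[of "RN_deriv P Q" P "\<lambda>x. ennreal (r x)"] by simp
  have r0: "AE x in Q. 0 < r x"
    by (subst Qd, subst AE_density) auto
  have e: "entropy_density (exp 1) P Q x = ln (r x)" for x
    by (simp add: entropy_density_def r_def log_def)
  note [measurable] = fm
  define g where "g x = exp (f x) / (c * r x)" for x
  have gm: "g \<in> borel_measurable P" unfolding g_def[abs_def] by measurable
  have gmQ: "g \<in> borel_measurable Q" using gm st by (simp cong: measurable_cong_sets)
  have r_nn: "0 \<le> r x" for x by (simp add: r_def)
  have "(\<integral>\<^sup>+x. ennreal (g x) \<partial>Q) = (\<integral>\<^sup>+x. ennreal (r x) * ennreal (g x) \<partial>P)"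
    by (subst Qd, rule nn_integral_density) (use gm in auto)
  also have "\<dots> \<le> (\<integral>\<^sup>+x. ennreal (1 / c) * ennreal (exp (f x)) \<partial>P)"
    using c(2) r_nn by (intro nn_integral_mono) (auto simp: g_def divide_right_mono simp flip: ennreal_mult)
  also have "\<dots> = ennreal (1 / c) * (\<integral>\<^sup>+x. ennreal (exp (f x)) \<partial>P)"
    by (rule nn_integral_cmult) measurable
  also have "\<dots> \<le> ennreal (1 / c) * ennreal c" using c by (intro mult_left_mono) auto
  also have "\<dots> = 1" using c by (simp flip: ennreal_mult)
  finally have g1: "(\<integral>\<^sup>+x. ennreal (g x) \<partial>Q) \<le> 1" .
  have g0: "0 \<le> g x" for x using c r_nn by (simp add: g_def)
  have gI: "integrable Q g"
    using gmQ g0 g1 by (intro integrableI_nonneg) (auto simp: le_less_trans[OF _ ennreal_one_less_top])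
  have "ennreal (\<integral>x. g x \<partial>Q) \<le> 1"
    using nn_integral_eq_integral[OF gI] g0 g1 by simp
  then have gE: "(\<integral>x. g x \<partial>Q) \<le> 1" by (simp flip: ennreal_1 add: ennreal_le_iff)
  have fI: "integrable Q f"
    using fm fb sp st by (intro Q.integrable_bounded[where B = B]) (auto cong: measurable_cong_sets)
  have "(\<integral>x. f x - ln c - entropy_density (exp 1) P Q x \<partial>Q) \<le> (\<integral>x. g x - 1 \<partial>Q)"
  proof (rule integral_mono_AE)
    show "AE x in Q. f x - ln c - entropy_density (exp 1) P Q x \<le> g x - 1"
      using r0
    proof eventually_elim
      case (elim x)
      have "ln (g x) = f x - ln c - ln (r x)"
        using elim c by (simp add: g_def ln_div ln_mult)
      moreover have "ln (g x) \<le> g x - 1"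
        using elim c by (intro ln_le_minus_one) (simp add: g_def)
      ultimately show ?case by (simp add: e)
    qed
  qed (use fI ei gI in auto)
  also have "\<dots> \<le> 0" using gI gE by (simp add: Q.prob_space)
  finally have "(\<integral>x. f x - ln c - entropy_density (exp 1) P Q x \<partial>Q) \<le> 0" .
  moreover have "(\<integral>x. f x - ln c - entropy_density (exp 1) P Q x \<partial>Q) = (\<integral>x. f x \<partial>Q) - ln c - \<kappa>"
    using fI ei by (simp add: \<kappa> Q.prob_space)
  ultimately show ?thesis by simp
qed

lemma KL_nonneg:
  assumes P: "prob_space P" and Q: "prob_space Q" and st: "sets Q = sets P"
    and KL: "KL Q P = ereal \<kappa>"
  shows "0 \<le> \<kappa>"
proof -
  interpret P: prob_space P by fact
  show ?thesis
    using expectation_le_KL_plus_ln[OF assms, of "\<lambda>_. 0" 0 1] by (simp add: P.emeasure_space_1)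
qed

lemma T_stat_swap:
  assumes "\<And>i. i \<in> {1..m} \<Longrightarrow> x i \<in> space S"
    and "\<And>z. z \<in> space S \<Longrightarrow> 0 \<le> q z" "\<And>z. z \<in> space S \<Longrightarrow> 0 \<le> q' z"
  shows "T_stat m x q q' = - T_stat m x q' q"
  unfolding T_stat_def sum_negf[symmetric] using assms by (intro sum.cong refl psi_sqrt_ratio_swap) auto

lemma abs_T_stat_le:
  assumes "\<And>i. i \<in> {1..m} \<Longrightarrow> x i \<in> space S"
    and "\<And>z. z \<in> space S \<Longrightarrow> 0 \<le> q z" "\<And>z. z \<in> space S \<Longrightarrow> 0 \<le> q' z"
  shows "\<bar>T_stat m x q q'\<bar> \<le> real m"
proof -
  have "\<bar>T_stat m x q q'\<bar> \<le> (\<Sum>i=1..m. 1)"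
    unfolding T_stat_def using assms
    by (intro order_trans[OF sum_abs] sum_mono abs_psi_sqrt_ratio_le) auto
  then show ?thesis by simp
qed

section \<open>From the comparison statistic to the estimator\<close>

context rho_product
begin

text \<open>\<open>peel\<close> controls all deviations at once, and the resulting bound on the
  statistic from \<open>P\<close> to \<open>Q'\<close> is used twice. Over all \<open>Q'\<close> it
  bounds \<open>Upsilon\<close> at \<open>P\<close>, hence, up to \<open>11.36\<close>, at the
  density \<open>q\<close> of \<open>Q\<close>. At \<open>Q\<close> itself, antisymmetry turns it
  into a lower bound of \<open>Upsilon\<close> at \<open>q\<close>, which contains a positive
  multiple of \<open>A Q\<close>.\<close>

lemma A_rho_set_le:
  assumes rep: "represents S \<mu> \<M> \<PP>" and D: "1 \<le> D"
    and x: "x \<in> space PM" and g: "peel \<mu> \<M> D x = ennreal g"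
    and Q: "Q \<in> rho_set \<mu> \<M> m x"
  shows "0.1025 / 300 * (A Q - 128 * H - 56) \<le> ln g"
proof -
  note xs = space_PM[OF x]
  have dev: "dev \<mu> \<M> Q' x \<le> 0.17 * (H + A Q') + 8.91 * H + 300 * ln g" and g0: "0 < g" if "Q' \<in> \<PP>" for Q'
  proof -
    have le: "ennreal (exp (1 / 300 * (dev \<mu> \<M> Q' x - 0.17 * (H + A Q') - 8.91 * H))) \<le> ennreal g"
      using exp_dev_le_peel[OF D that] g by metis
    show "0 < g"
    proof (rule ccontr)
      assume "\<not> 0 < g"
      then have "ennreal g = 0" by (simp add: ennreal_neg)
      with le show False by simp
    qed
    then have "exp (1 / 300 * (dev \<mu> \<M> Q' x - 0.17 * (H + A Q') - 8.91 * H)) \<le> g"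
      using le by (simp add: ennreal_le_iff)
    then have "1 / 300 * (dev \<mu> \<M> Q' x - 0.17 * (H + A Q') - 8.91 * H) \<le> ln g"
      unfolding ln_ge_iff[OF \<open>0 < g\<close>] .
    then show "dev \<mu> \<M> Q' x \<le> 0.17 * (H + A Q') + 8.91 * H + 300 * ln g" by simp
  qed
  let ?p = "density_in \<mu> \<M> P"
  \<comment> \<open>\<open>327/25 = 4 + 0.17 + 8.91\<close> and \<open>41/200 = 3/8 - 0.17\<close>:
    drift minus the price of peeling.\<close>
  have T: "T_stat m x ?p (density_in \<mu> \<M> Q') \<le> 327/25 * H - 41/200 * A Q' + 300 * ln g" if "Q' \<in> \<PP>" for Q'
  proof -
    have "t \<le> 327/25 * h - 41/200 * a + 300 * l"
      if "t \<le> 4 * h - 3/8 * a + d" "d \<le> 0.17 * (h + a) + 8.91 * h + 300 * l" for t h a d l :: real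
      using that by (simp add: field_simps)
    from this[OF T_stat_le[OF rep that, of x] dev[OF that]] show ?thesis .
  qed
  have nn: "0 \<le> q z" if "q \<in> \<M>" "z \<in> space S" for q z
    using rep that by (auto simp: represents_def)
  have T_abs: "\<bar>T_stat m x q q'\<bar> \<le> real m" if "q \<in> \<M>" "q' \<in> \<M>" for q q'
    using xs nn that by (intro abs_T_stat_le) auto
  have pM: "?p \<in> \<M>" using represents_density_in(1)[OF rep P_in] .
  then have ne: "\<M> \<noteq> {}" by auto
  obtain q where q: "q \<in> \<M>" "Q = density \<mu> (\<lambda>z. ennreal (q z))"
    "Upsilon \<M> m x q < (INF q'\<in>\<M>. Upsilon \<M> m x q') + 11.36"
    using Q by (auto simp: rho_set_def)
  have QP: "Q \<in> \<PP>" "density_in \<mu> \<M> Q = q"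
    using represents_density_in_density[OF rep q(1)] q(2) by auto
  have bdd: "bdd_above ((\<lambda>q'. T_stat m x q1 q') ` \<M>)" if "q1 \<in> \<M>" for q1
    using T_abs[OF that] by (intro bdd_aboveI2[where M = "real m"]) (auto simp: abs_le_iff)
  have up: "T_stat m x q1 q2 \<le> Upsilon \<M> m x q1" if "q1 \<in> \<M>" "q2 \<in> \<M>" for q1 q2
    unfolding Upsilon_def using that bdd by (intro cSUP_upper) auto
  have "bdd_below (Upsilon \<M> m x ` \<M>)"
  proof (rule bdd_belowI2)
    fix q1 assume "q1 \<in> \<M>"
    then show "- real m \<le> Upsilon \<M> m x q1"
      using up[of q1 q1] T_abs[of q1 q1] by (auto simp: abs_le_iff)
  qed
  then have "(INF q'\<in>\<M>. Upsilon \<M> m x q') \<le> Upsilon \<M> m x ?p"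
    using pM by (rule cINF_lower)
  also have "\<dots> \<le> 327/25 * H + 300 * ln g"
    unfolding Upsilon_def
  proof (rule cSUP_least[OF ne])
    fix q' assume q': "q' \<in> \<M>"
    have "T_stat m x ?p q' \<le> 327/25 * H - 41/200 * A (density \<mu> (\<lambda>x. ennreal (q' x))) + 300 * ln g"
      using T[OF represents_density_in_density(1)[OF rep q']] represents_density_in_density(2)[OF rep q'] by simp
    then show "T_stat m x ?p q' \<le> 327/25 * H + 300 * ln g"
      using A_nonneg[of "density \<mu> (\<lambda>x. ennreal (q' x))"] by linarith
  qed
  finally have "Upsilon \<M> m x q \<le> 327/25 * H + 300 * ln g + 284/25" using q(3) by simp
  moreover have "- T_stat m x ?p q \<le> Upsilon \<M> m x q"
    using up[OF q(1) pM] T_stat_swap[OF xs nn[OF pM] nn[OF q(1)]] by simp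
  ultimately have "- (327/25 * H - 41/200 * A Q + 300 * ln g) \<le> 327/25 * H + 300 * ln g + 284/25"
    using T[OF QP(1)] unfolding QP(2) by linarith
  \<comment> \<open>After halving, \<open>0.1025 * 128 = 13.12\<close> exceeds
    \<open>327/25 = 13.08\<close>, and \<open>0.1025 * 56 = 5.74\<close> exceeds
    \<open>142/25 = 5.68\<close>.\<close>
  then have "41/400 * A Q \<le> 327/25 * H + 300 * ln g + 142/25" by simp
  then show ?thesis using H_nonneg by simp
qed

text \<open>The estimator lies only in the closure of \<open>rho_set\<close>. A Hellinger
  perturbation \<open>\<delta> \<le> 1\<close> raises each squared distance by at most
  \<open>3 * \<delta>\<close>, as distances are at most \<open>1\<close>, so the non-strict bound
  survives the limit.\<close>

lemma A_closure_le:
  assumes rep: "represents S \<mu> \<M> \<PP>" and D: "1 \<le> D"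
    and x: "x \<in> space PM" and g: "peel \<mu> \<M> D x = ennreal g"
    and Q: "Q \<in> hellinger_topology S closure_of rho_set \<mu> \<M> m x"
  shows "0.1025 / 300 * (A Q - 128 * H - 56) \<le> ln g"
proof (rule field_le_epsilon)
  fix e :: real assume e: "0 < e"
  define \<delta> where "\<delta> = min 1 (e / (3 * (real m + 1)))"
  have \<delta>: "0 < \<delta>" "\<delta> \<le> 1" "\<delta> \<le> e / (3 * (real m + 1))" using e by (auto simp: \<delta>_def)
  have "\<delta> * (3 * (real m + 1)) \<le> e" using \<delta>(3) by (simp add: pos_le_divide_eq)
  then have \<delta>m: "3 * real m * \<delta> \<le> e" using \<delta>(1) by (simp add: algebra_simps)
  have QS: "Q \<in> space (prob_algebra S)" and "\<exists>q\<in>rho_set \<mu> \<M> m x. q \<in> Metric_space.mball (space (prob_algebra S)) hellinger Q \<delta>"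
    using Q \<delta>(1) unfolding hellinger_topology_def Metric_space.metric_closure_of[OF Metric_space_hellinger] by auto
  then obtain q where q: "q \<in> rho_set \<mu> \<M> m x" "hellinger Q q < \<delta>" "q \<in> space (prob_algebra S)"
    by (auto simp: Metric_space.in_mball[OF Metric_space_hellinger])
  have "hellinger_sq (Ps i) Q \<le> hellinger_sq (Ps i) q + 3 * \<delta>" for i
  proof -
    have "hellinger (Ps i) Q \<le> hellinger (Ps i) q + hellinger q Q"
      by (rule hellinger_triangle[OF Ps q(3) QS])
    then have "hellinger (Ps i) Q \<le> hellinger (Ps i) q + \<delta>"
      using q(2) by (simp add: hellinger_commute[of q])
    then have "(hellinger (Ps i) Q)\<^sup>2 \<le> (hellinger (Ps i) q + \<delta>)\<^sup>2" by (intro power_mono) auto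
    also have "\<dots> = hellinger_sq (Ps i) q + (2 * hellinger (Ps i) q * \<delta> + \<delta> * \<delta>)"
      by (simp add: power2_sum power2_eq_square[of \<delta>])
    also have "\<dots> \<le> hellinger_sq (Ps i) q + (2 * 1 * \<delta> + 1 * \<delta>)"
    proof (intro add_left_mono add_mono mult_right_mono mult_left_mono)
      show "hellinger (Ps i) q \<le> 1"
        unfolding hellinger_def using hellinger_sq_le_1[OF Ps q(3)] by simp
    qed (use \<delta> in auto)
    finally show ?thesis by simp
  qed
  then have "A Q \<le> (\<Sum>i=1..m. hellinger_sq (Ps i) q + 3 * \<delta>)" unfolding A_def by (intro sum_mono)
  also have "\<dots> = A q + 3 * real m * \<delta>" by (simp add: A_def sum.distrib)
  finally have "A Q \<le> A q + e" using \<delta>m by simp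
  then show "0.1025 / 300 * (A Q - 128 * H - 56) \<le> ln g + e"
    using A_rho_set_le[OF rep D x g q(1)] e by simp
qed

text \<open>\<open>peel\<close> dominates the exponential of
  \<open>0.1025 / 300 * (A - 128 * H - 56)\<close> at the estimator, and the Donsker--Varadhan
  inequality moves this to \<open>Q\<close>. Solving for the mean of \<open>A\<close> yields the
  constants: \<open>300 / 0.1025 < 3000\<close>, \<open>91 / 0.1025 < 900\<close> and
  \<open>56 + 3.83 * 300 / 0.1025 < 11300\<close>.\<close>

lemma expectation_A_rho_estimator_le:
  assumes rep: "represents S \<mu> \<M> \<PP>"
    and D: "rho_dim S \<PP> m Ps P \<le> ennreal D" "1 \<le> D"
    and est: "rho_estimator S \<mu> \<M> m Ph"
    and Q: "prob_space Q" "sets Q = sets PM" and KL: "KL Q PM = ereal \<kappa>"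
  shows "(\<lambda>x. A (Ph x)) \<in> borel_measurable Q"
    and "x \<in> space Q \<Longrightarrow> \<bar>A (Ph x)\<bar> \<le> real m"
    and "(\<integral>x. A (Ph x) \<partial>Q) \<le> 128 * H + 3000 * \<kappa> + 900 * D + 11300"
proof -
  interpret Q: prob_space Q by fact
  have \<kappa>: "0 \<le> \<kappa>" using KL_nonneg[OF P.prob_space_axioms Q KL] .
  have spQ: "space Q = space PM" using Q(2) by (rule sets_eq_imp_space_eq)
  have spS: "space PM = space (PiM {1..m} (\<lambda>_. S))" using sets_PM by (rule sets_eq_imp_space_eq)
  have Pc: "Ph x \<in> hellinger_topology S closure_of rho_set \<mu> \<M> m x" if "x \<in> space PM" for x
    using est that unfolding rho_estimator_def spS by simp
  have Pm: "Ph \<in> PM \<rightarrow>\<^sub>M hellinger_borel S"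
    using est unfolding rho_estimator_def measurable_cong_sets[OF sets_PM refl] by simp
  have Ph: "Ph x \<in> space (prob_algebra S)" if "x \<in> space PM" for x
    using measurable_space[OF Pm that] by (simp add: space_hellinger_borel)
  have Am[measurable]: "(\<lambda>x. A (Ph x)) \<in> borel_measurable PM"
    unfolding A_def hellinger_power2[symmetric] using Pm Ps
    by (intro borel_measurable_sum borel_measurable_power measurable_hellinger) auto
  then show "(\<lambda>x. A (Ph x)) \<in> borel_measurable Q"
    using Q(2) by (simp cong: measurable_cong_sets)
  have Ab: "0 \<le> A (Ph x) \<and> A (Ph x) \<le> real m" if "x \<in> space PM" for x
  proof -
    have "A (Ph x) \<le> (\<Sum>i=1..m. 1)"
      unfolding A_def using hellinger_sq_le_1[OF Ps Ph[OF that]] by (intro sum_mono)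
    then show ?thesis using A_nonneg by simp
  qed
  then show "x \<in> space Q \<Longrightarrow> \<bar>A (Ph x)\<bar> \<le> real m" by (simp add: spQ)
  let ?f = "\<lambda>x. 0.1025 / 300 * (A (Ph x) - 128 * H - 56)"
  have AI: "integrable Q (\<lambda>x. A (Ph x))"
    using Am Ab Q(2) spQ by (intro Q.integrable_bounded[where B = "real m"]) (auto cong: measurable_cong_sets)
  have fm: "?f \<in> borel_measurable PM" by measurable
  have fb: "\<bar>?f x\<bar> \<le> real m + 128 * H + 56" if "x \<in> space PM" for x
    using Ab[OF that] H_nonneg by (simp add: abs_le_iff)
  have "(\<integral>\<^sup>+x. ennreal (exp (?f x)) \<partial>PM) \<le> (\<integral>\<^sup>+x. peel \<mu> \<M> D x \<partial>PM)"
  proof (rule nn_integral_mono)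
    fix x assume x: "x \<in> space PM"
    show "ennreal (exp (?f x)) \<le> peel \<mu> \<M> D x"
    \<comment> \<open>Nothing is to be shown where \<open>peel\<close> is infinite. Where it is
      finite, the term of \<open>P\<close> itself makes it positive, so its logarithm can be
      exponentiated back.\<close>
    proof (cases "peel \<mu> \<M> D x")
      case (real g)
      have "0 < g"
      proof (rule ccontr)
        assume "\<not> 0 < g"
        then have "peel \<mu> \<M> D x = 0" using real by (simp add: ennreal_neg)
        then show False using exp_dev_le_peel[OF D(2) P_in, of \<mu> \<M> x] by simp
      qed
      moreover have "?f x \<le> ln g" using A_closure_le[OF rep D(2) x real(2) Pc[OF x]] .
      ultimately have "exp (?f x) \<le> g" by (metis exp_le_cancel_iff exp_ln)
      then show ?thesis using real by (simp add: ennreal_leI)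
    qed simp
  qed
  also have "\<dots> \<le> ennreal (42 * exp (91 / 300 * D))" by (rule nn_integral_peel_le[OF rep D])
  finally have "(\<integral>x. ?f x \<partial>Q) \<le> \<kappa> + ln (42 * exp (91 / 300 * D))"
    by (intro expectation_le_KL_plus_ln[OF P.prob_space_axioms Q KL fm fb]) auto
  also have "ln (42 * exp (91 / 300 * D)) = ln 42 + 91 / 300 * D" by (simp add: ln_mult)
  also have "ln 42 \<le> (3.83 :: real)"
  proof -
    have "(42::real) = 2 ^ 6 * (42 / 64)" by simp
    then have "ln (42::real) = ln (2 ^ 6) + ln (42/64)" by (metis ln_mult_pos zero_less_divide_iff zero_less_numeral zero_less_power)
    also have "\<dots> = 6 * ln 2 + ln (42/64)" by (subst ln_realpow) simp_all
    also have "\<dots> \<le> 6 * (25/36) + (42/64 - 1)"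
      using ln2_le_25_over_36 ln_le_minus_one[of "42/64::real"] by (intro add_mono) auto
    also have "\<dots> \<le> 3.83" by simp
    finally show ?thesis by simp
  qed
  finally have "(\<integral>x. ?f x \<partial>Q) \<le> \<kappa> + (3.83 + 91 / 300 * D)" by simp
  moreover have "(\<integral>x. ?f x \<partial>Q) = 0.1025 / 300 * ((\<integral>x. A (Ph x) \<partial>Q) - 128 * H - 56)"
    using AI by (simp add: Q.prob_space)
  ultimately show "(\<integral>x. A (Ph x) \<partial>Q) \<le> 128 * H + 3000 * \<kappa> + 900 * D + 11300"
    using \<kappa> D(2) by simp
qed

end

subsection \<open>Blocks\<close>

lemma block_expectation_le:
  fixes Rs :: "nat \<Rightarrow> 'a measure"
  assumes model: "countable \<PP>" "\<PP> \<subseteq> space (prob_algebra S)" "P \<in> \<PP>"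
    and rep: "represents S \<mu> \<M> \<PP>" and D: "rho_dim_bounded S \<PP> D" "1 \<le> D m" and m: "1 \<le> m"
    and Rs: "\<And>i. i \<in> {1..m} \<Longrightarrow> Rs i \<in> space (prob_algebra S)"
    and est: "rho_estimator S \<mu> \<M> m Ph"
    and Q: "prob_space Q" "sets Q = sets (PiM {1..m} (\<lambda>_. S))" and KL: "KL Q (PiM {1..m} Rs) = ereal \<kappa>"
  shows "(\<lambda>x. \<Sum>i=1..m. hellinger_sq (Rs i) (Ph x)) \<in> borel_measurable Q"
    and "x \<in> space Q \<Longrightarrow> \<bar>\<Sum>i=1..m. hellinger_sq (Rs i) (Ph x)\<bar> \<le> real m"
    and "(\<integral>x. (\<Sum>i=1..m. hellinger_sq (Rs i) (Ph x)) \<partial>Q)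
      \<le> 128 * (\<Sum>i=1..m. hellinger_sq (Rs i) P) + 3000 * \<kappa> + 900 * D m + 11300"
    and "0 \<le> \<kappa>"
proof -
  \<comment> \<open>The locale asks for a distribution at every index; \<open>P\<close> fills those
    outside the block, which leaves the product unchanged.\<close>
  define Ps where "Ps i = (if i \<in> {1..m} then Rs i else P)" for i
  have Ps: "Ps i \<in> space (prob_algebra S)" for i using Rs model by (auto simp: Ps_def)
  interpret rho_product S \<PP> Ps m P using model Ps by unfold_locales
  have PM: "PiM {1..m} Rs = PM" by (intro PiM_cong) (auto simp: Ps_def)
  have AR: "A R = (\<Sum>i=1..m. hellinger_sq (Rs i) R)" for R
    unfolding A_def Ps_def by (intro sum.cong) auto
  have HR: "H = (\<Sum>i=1..m. hellinger_sq (Rs i) P)"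
    unfolding H_def Ps_def by (intro sum.cong) auto
  have rd: "rho_dim S \<PP> m Ps P \<le> ennreal (D m)"
    using D(1) m Ps model(3) by (simp add: rho_dim_bounded_def)
  note * = expectation_A_rho_estimator_le[OF rep rd D(2) est Q(1) trans[OF Q(2) sets_PM[symmetric]] KL[unfolded PM], unfolded AR HR]
  show "(\<lambda>x. \<Sum>i=1..m. hellinger_sq (Rs i) (Ph x)) \<in> borel_measurable Q" by (rule *(1))
  show "x \<in> space Q \<Longrightarrow> \<bar>\<Sum>i=1..m. hellinger_sq (Rs i) (Ph x)\<bar> \<le> real m" by (rule *(2))
  show "(\<integral>x. (\<Sum>i=1..m. hellinger_sq (Rs i) (Ph x)) \<partial>Q)
      \<le> 128 * (\<Sum>i=1..m. hellinger_sq (Rs i) P) + 3000 * \<kappa> + 900 * D m + 11300" by (rule *(3))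
  show "0 \<le> \<kappa>"
    using KL_nonneg[OF P.prob_space_axioms Q(1) trans[OF Q(2) sets_PM[symmetric]] KL[unfolded PM]] .
qed

section \<open>Partition of the sample into blocks\<close>

lemma block_size_pos:
  assumes "s + 1 \<le> n" "b \<in> {1..s+1}"
  shows "1 \<le> block_size n s b"
proof -
  have "(1 + s) * 1 \<le> n + s + 1 - b" using assms by auto
  then have "1 \<le> (n + s + 1 - b) div (1 + s)" by (simp add: less_eq_div_iff_mult_less_eq)
  then show ?thesis by (simp add: block_size_def)
qed

lemma block_index_le_iff:
  assumes "b \<in> {1..s+1}" "b \<le> n" "1 \<le> i"
  shows "i \<le> block_size n s b \<longleftrightarrow> block_index s b i \<le> n"
proof -
  have "i \<le> block_size n s b \<longleftrightarrow> i * (1 + s) \<le> n + s + 1 - b"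
    unfolding block_size_def by (rule less_eq_div_iff_mult_less_eq) simp
  also have "i * (1 + s) = (i - 1) * (s + 1) + (s + 1)"
    using assms(3) by (cases i) auto
  also have "\<dots> \<le> n + s + 1 - b \<longleftrightarrow> block_index s b i \<le> n"
    using assms by (auto simp: block_index_def)
  finally show ?thesis .
qed

lemma block_index_in:
  assumes "s + 1 \<le> n" "b \<in> {1..s+1}" "i \<in> {1..block_size n s b}"
  shows "block_index s b i \<in> {1..n}"
  using block_index_le_iff[of b s n i] assms by (auto simp: block_index_def)

text \<open>The blocks are the residue classes of \<open>j - 1\<close> modulo \<open>s + 1\<close>,
  so division with remainder inverts \<open>block_index\<close>. Remainder and quotient are shifted
  by one because blocks and positions are counted from \<open>1\<close>.\<close>

lemma sum_blocks:
  fixes f :: "nat \<Rightarrow> 'b::comm_monoid_add"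
  assumes "s + 1 \<le> n"
  shows "(\<Sum>b=1..s+1. \<Sum>i=1..block_size n s b. f (block_index s b i)) = (\<Sum>j=1..n. f j)"
proof -
  let ?S = "SIGMA b:{1..s+1}. {1..block_size n s b}"
  have "(\<Sum>b=1..s+1. \<Sum>i=1..block_size n s b. f (block_index s b i)) = (\<Sum>(b, i)\<in>?S. f (block_index s b i))"
    by (rule sum.Sigma) auto
  also have "\<dots> = (\<Sum>j=1..n. f j)"
  proof (rule sum.reindex_bij_witness[of _ "\<lambda>j. ((j - 1) mod (s + 1) + 1, (j - 1) div (s + 1) + 1)"
        "\<lambda>(b, i). block_index s b i"])
    fix a assume a: "a \<in> ?S"
    then obtain b i where bi: "a = (b, i)" "b \<in> {1..s+1}" "i \<in> {1..block_size n s b}" by auto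
    have e: "block_index s b i - 1 = (b - 1) + (i - 1) * (s + 1)" using bi by (auto simp: block_index_def)
    have "(block_index s b i - 1) mod (s + 1) = b - 1"
      unfolding e using bi by (simp only: mod_mult_self1) (auto intro: mod_less)
    moreover have "(block_index s b i - 1) div (s + 1) = i - 1"
      unfolding e using bi by (subst div_mult_self1) (auto intro: div_less)
    ultimately show "(\<lambda>j. ((j - 1) mod (s + 1) + 1, (j - 1) div (s + 1) + 1)) (case a of (b, i) \<Rightarrow> block_index s b i) = a"
      using bi by auto
    show "(case a of (b, i) \<Rightarrow> block_index s b i) \<in> {1..n}"
      using block_index_in[OF assms bi(2,3)] bi by auto
    show "f (case a of (b, i) \<Rightarrow> block_index s b i) = (case a of (b, i) \<Rightarrow> f (block_index s b i))"
      using bi by auto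
  next
    fix j assume j: "j \<in> {1..n}"
    let ?b = "(j - 1) mod (s + 1) + 1" and ?i = "(j - 1) div (s + 1) + 1"
    have b: "?b \<in> {1..s+1}" using mod_less_divisor[of "s+1" "j - 1"] by auto
    have e: "block_index s ?b ?i = j"
      using j mod_mult_div_eq[of "j - 1" "s + 1"] by (simp add: block_index_def mult.commute)
    then show "(case ((j - 1) mod (s + 1) + 1, (j - 1) div (s + 1) + 1) of (b, i) \<Rightarrow> block_index s b i) = j" by simp
    have "?b \<le> n" using b assms by (meson atLeastAtMost_iff order_trans)
    then have "?i \<le> block_size n s ?b"
      using block_index_le_iff[OF b, of n ?i] j e by auto
    then show "((j - 1) mod (s + 1) + 1, (j - 1) div (s + 1) + 1) \<in> ?S" using b by auto
  qed
  finally show ?thesis .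
qed

section \<open>Combination of the blocks\<close>

lemma hellinger_sq_commute: "hellinger_sq P Q = hellinger_sq Q P"
  unfolding hellinger_power2[symmetric] hellinger_commute[of P] ..

text \<open>The slack is \<open>(t * ?a - ?b)\<^sup>2 / t\<close>. The free \<open>t\<close> allows
  the triangle inequality to be lopsided, with a factor close to \<open>1\<close> on the more
  expensive distance.\<close>

lemma hellinger_sq_young:
  assumes "P \<in> space (prob_algebra S)" "Q \<in> space (prob_algebra S)" "R \<in> space (prob_algebra S)" "0 < t"
  shows "hellinger_sq P R \<le> (1 + t) * hellinger_sq P Q + (1 + 1 / t) * hellinger_sq Q R"
proof -
  let ?a = "hellinger P Q" and ?b = "hellinger Q R"
  have "(hellinger P R)\<^sup>2 \<le> (?a + ?b)\<^sup>2"
    using hellinger_triangle[OF assms(1-3)] by (intro power_mono) auto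
  also have "\<dots> \<le> (1 + t) * ?a\<^sup>2 + (1 + 1 / t) * ?b\<^sup>2"
  proof -
    have "(1 + t) * ?a\<^sup>2 + (1 + 1 / t) * ?b\<^sup>2 - (?a + ?b)\<^sup>2 = (t * ?a - ?b)\<^sup>2 / t"
      using assms(4) by (simp add: power2_eq_square field_simps)
    moreover have "0 \<le> (t * ?a - ?b)\<^sup>2 / t" using assms(4) by simp
    ultimately show ?thesis by linarith
  qed
  finally show ?thesis by simp
qed

text \<open>The constants fit: \<open>4.2 * 128 + 22 = 559.6 \<le> 602\<close>,
  \<open>4.2 * 3000 = 12600 \<le> 30084\<close>, \<open>4.2 * 900 = 3780 \<le> 20056 / 4.7\<close>,
  and \<open>4.2 * 11300 + 2 * 1273 = 50006 \<le> 17 * 20056 / 4.7\<close>. The term in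
  \<open>\<iota>\<close> is absorbed because \<open>s + 1 \<ge> 1\<close>.\<close>

lemma risk_bound_arith:
  fixes L n a h d k \<iota> s :: real
  assumes "n * L \<le> 4.2 * a + 22 * h + 2 * \<iota>" "a \<le> 128 * h + 3000 * k + (s + 1) * (900 * d + 11300)"
    "\<iota> \<le> 1273" "0 \<le> h" "0 \<le> k" "0 \<le> s" "1 \<le> d" "0 < n"
  shows "L \<le> 602 / n * h + 20056 / 4.7 * ((s + 1) / n) * (17 + d) + 30084 / n * k"
proof -
  define u v where "u = s + 1" and "v = (s + 1) * d"
  have u: "1 \<le> u" and v: "0 \<le> v" using assms by (auto simp: u_def v_def)
  have "a \<le> 128 * h + 3000 * k + (900 * v + 11300 * u)"
    using assms(2) by (simp add: u_def v_def algebra_simps)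
  then have "n * L \<le> 602 * h + 20056 / 4.7 * (17 * u + v) + 30084 * k"
    using assms(1,3,4,5) u v by (simp add: field_simps)
  also have "20056 / 4.7 * (17 * u + v) = 20056 / 4.7 * (s + 1) * (17 + d)"
    by (simp add: u_def v_def algebra_simps)
  finally have "n * L \<le> 602 * h + 20056 / 4.7 * (s + 1) * (17 + d) + 30084 * k" .
  then have "L \<le> (602 * h + 20056 / 4.7 * (s + 1) * (17 + d) + 30084 * k) / n"
    using assms(8) by (simp add: pos_le_divide_eq mult.commute)
  also have "\<dots> = 602 / n * h + 20056 / 4.7 * ((s + 1) / n) * (17 + d) + 30084 / n * k"
    using assms(8) by (simp add: field_simps)
  finally show ?thesis .
qed

theorem theorem1:
  fixes S :: "'a measure" and \<Omega> :: "'w measure" and \<mu> :: "'a measure"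
    and \<M> :: "('a \<Rightarrow> real) set" and \<PP> :: "'a measure set"
    and D :: "nat \<Rightarrow> real" and X :: "nat \<Rightarrow> 'w \<Rightarrow> 'a" and n s :: nat and \<iota> :: real
    and P\<^sub>s :: "(nat \<Rightarrow> 'a) \<Rightarrow> 'a measure"
  assumes n: "2 \<le> n"
    and model: "\<PP> \<noteq> {}" "countable \<PP>" "\<PP> \<subseteq> space (prob_algebra S)"
    and repr: "represents S \<mu> \<M> \<PP>"
    and D_mono: "mono_on {1..} D" and D_ge: "\<And>m. 1 \<le> m \<Longrightarrow> 1 \<le> D m"
    and D_bound: "rho_dim_bounded S \<PP> D"
    and \<Omega>: "prob_space \<Omega>"
    and X: "\<And>i. i \<in> {1..n} \<Longrightarrow> X i \<in> \<Omega> \<rightarrow>\<^sub>M S"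
    and iota: "0 < \<iota>" "\<iota> \<le> 1273"
    and s: "s \<le> (n - 2) div 2"
    and est: "block_rho_estimator S \<mu> \<M> \<PP> \<iota> n s P\<^sub>s"
  shows "ereal (\<integral>x. 1 / real n * (\<Sum>i=1..n. (hellinger (distr \<Omega> S (X i)) (P\<^sub>s x))\<^sup>2)
            \<partial>distr \<Omega> (Pi\<^sub>M {1..n} (\<lambda>_. S)) (\<lambda>\<omega>. \<lambda>i\<in>{1..n}. X i \<omega>))
       \<le> ereal (602 / real n * (INF Q\<in>\<PP>. \<Sum>i=1..n. (hellinger (distr \<Omega> S (X i)) Q)\<^sup>2))
         + ereal (20056 / 4.7 * ((real s + 1) / real n) * (17 + D (block_size n s 1)))
         + ereal (30084 / real n) *
             (\<Sum>b=1..s+1. KL (block_law \<Omega> S X n s b) (block_ind_law \<Omega> S X n s b))"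
proof -
  interpret \<Omega>: prob_space \<Omega> by fact
  let ?KL = "\<lambda>b. KL (block_law \<Omega> S X n s b) (block_ind_law \<Omega> S X n s b)"
  have sn: "s + 1 \<le> n" using s n by auto
  have n0: "0 < real n" using n by simp
  define R where "R i = distr \<Omega> S (X i)" for i
  have R: "R i \<in> space (prob_algebra S)" if "i \<in> {1..n}" for i
    using \<Omega>.prob_space_distr[OF X[OF that]] by (simp add: R_def space_prob_algebra)
  define N where "N b = block_size n s b" for b
  let ?B = "{1..s+1}"
  have Npos: "1 \<le> N b" if "b \<in> ?B" for b unfolding N_def by (rule block_size_pos[OF sn that])
  have idx: "block_index s b i \<in> {1..n}" if "b \<in> ?B" "i \<in> {1..N b}" for b i
    using block_index_in[OF sn] that by (simp add: N_def)
  show ?thesis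
  \<comment> \<open>One infinite divergence makes the right-hand side infinite; otherwise all of
    them are real and the inequality is one between reals.\<close>
  proof (cases "\<exists>b\<in>?B. ?KL b = \<infinity>")
    case True
    then have e: "(\<Sum>b=1..s+1. ?KL b) = \<infinity>" by (subst sum_Pinfty) blast
    show ?thesis unfolding e using n0 by simp
  next
    case False
    define \<kappa> where "\<kappa> b = real_of_ereal (?KL b)" for b
    have \<kappa>: "?KL b = ereal (\<kappa> b)" if "b \<in> ?B" for b
      using False that by (auto simp: \<kappa>_def KL_def split: if_splits)
    have KLsum: "(\<Sum>b=1..s+1. ?KL b) = ereal (\<Sum>b=1..s+1. \<kappa> b)"
    proof -
      have "(\<Sum>b=1..s+1. ?KL b) = (\<Sum>b=1..s+1. ereal (\<kappa> b))" using \<kappa> by (rule sum.cong[OF refl])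
      then show ?thesis unfolding sum_ereal .
    qed
    have Psm: "P\<^sub>s \<in> PiM {1..n} (\<lambda>_. S) \<rightarrow>\<^sub>M hellinger_borel S"
      using est by (simp add: block_rho_estimator_def)
    obtain Pb where Pb: "\<And>b. b \<in> ?B \<Longrightarrow> rho_estimator S \<mu> \<M> (N b) (Pb b)"
      and Ps: "\<And>x. x \<in> space (PiM {1..n} (\<lambda>_. S)) \<Longrightarrow> P\<^sub>s x \<in> \<PP>"
      and opt: "\<And>x. x \<in> space (PiM {1..n} (\<lambda>_. S)) \<Longrightarrow>
          (\<Sum>b=1..s+1. real (N b) * (hellinger (Pb b (block n s b x)) (P\<^sub>s x))\<^sup>2)
          \<le> (INF Q\<in>\<PP>. \<Sum>b=1..s+1. real (N b) * (hellinger (Pb b (block n s b x)) Q)\<^sup>2) + \<iota>"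
      using est unfolding block_rho_estimator_def N_def by blast
    define x where "x \<omega> = (\<lambda>i\<in>{1..n}. X i \<omega>)" for \<omega>
    have xm: "x \<in> \<Omega> \<rightarrow>\<^sub>M PiM {1..n} (\<lambda>_. S)"
      unfolding x_def[abs_def] using X by (intro measurable_restrict) auto
    define y where "y b \<omega> = block n s b (\<lambda>i. X i \<omega>)" for b \<omega>
    \<comment> \<open>The sample vector is undefined outside \<open>{1..n}\<close>, but the indices
      of a block stay inside.\<close>
    have yx: "block n s b (x \<omega>) = y b \<omega>" if "b \<in> ?B" for b \<omega>
      unfolding y_def block_def x_def using idx[OF that] by (auto simp: fun_eq_iff N_def restrict_def)
    have ym: "y b \<in> \<Omega> \<rightarrow>\<^sub>M PiM {1..N b} (\<lambda>_. S)" if "b \<in> ?B" for b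
      unfolding y_def[abs_def] block_def N_def[symmetric] using X idx[OF that] by (intro measurable_restrict) auto
    define Ab where "Ab b \<omega> = (\<Sum>i=1..N b. hellinger_sq (R (block_index s b i)) (Pb b (y b \<omega>)))" for b \<omega>
    define L where "L \<omega> = (\<Sum>i=1..n. hellinger_sq (R i) (P\<^sub>s (x \<omega>)))" for \<omega>
    have Lm: "L \<in> borel_measurable \<Omega>"
      unfolding L_def[abs_def] hellinger_power2[symmetric]
      using measurable_compose[OF xm Psm] R
      by (intro borel_measurable_sum borel_measurable_power measurable_hellinger) auto
    have lhs: "(\<integral>x. 1 / real n * (\<Sum>i=1..n. (hellinger (distr \<Omega> S (X i)) (P\<^sub>s x))\<^sup>2)
            \<partial>distr \<Omega> (Pi\<^sub>M {1..n} (\<lambda>_. S)) (\<lambda>\<omega>. \<lambda>i\<in>{1..n}. X i \<omega>)) = 1 / real n * (\<integral>\<omega>. L \<omega> \<partial>\<Omega>)"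
    proof -
      have "(\<lambda>x. 1 / real n * (\<Sum>i=1..n. (hellinger (R i) (P\<^sub>s x))\<^sup>2)) \<in> borel_measurable (PiM {1..n} (\<lambda>_. S))"
        using Psm R by (intro borel_measurable_sum borel_measurable_power borel_measurable_times measurable_hellinger) auto
      from integral_distr[OF xm this] show ?thesis
        unfolding x_def[abs_def, symmetric] R_def[symmetric] L_def by simp
    qed
    \<comment> \<open>A fixed \<open>Q\<close> in the model serves both as the reference point of
      the block bounds and as the competitor in the minimisation defining \<open>P\<^sub>s\<close>;
      the infimum over \<open>Q\<close> is taken at the very end.\<close>
    have main: "real n * (1 / real n * (\<integral>\<omega>. L \<omega> \<partial>\<Omega>))
        \<le> 4.2 * (\<Sum>b=1..s+1. \<integral>\<omega>. Ab b \<omega> \<partial>\<Omega>) + 22 * (\<Sum>i=1..n. hellinger_sq (R i) Q) + 2 * \<iota>"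
      and block: "(\<Sum>b=1..s+1. \<integral>\<omega>. Ab b \<omega> \<partial>\<Omega>) \<le> 128 * (\<Sum>i=1..n. hellinger_sq (R i) Q) + 3000 * (\<Sum>b=1..s+1. \<kappa> b)
          + (real s + 1) * (900 * D (N 1) + 11300)"
      and \<kappa>0: "0 \<le> (\<Sum>b=1..s+1. \<kappa> b)"
      if Q: "Q \<in> \<PP>" for Q
    proof -
      have QS: "Q \<in> space (prob_algebra S)" using Q model by auto
      define Hb where "Hb b = (\<Sum>i=1..N b. hellinger_sq (R (block_index s b i)) Q)" for b
      have Hsum: "(\<Sum>b=1..s+1. Hb b) = (\<Sum>i=1..n. hellinger_sq (R i) Q)"
        unfolding Hb_def N_def by (rule sum_blocks[OF sn])
      have bl: "(\<lambda>\<omega>. Ab b \<omega>) \<in> borel_measurable \<Omega>" "\<And>\<omega>. \<omega> \<in> space \<Omega> \<Longrightarrow> \<bar>Ab b \<omega>\<bar> \<le> real (N b)"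
        "(\<integral>\<omega>. Ab b \<omega> \<partial>\<Omega>) \<le> 128 * Hb b + 3000 * \<kappa> b + 900 * D (N b) + 11300" "0 \<le> \<kappa> b"
        if b: "b \<in> ?B" for b
      proof -
        have law: "block_law \<Omega> S X n s b = distr \<Omega> (PiM {1..N b} (\<lambda>_. S)) (y b)"
          by (simp add: block_law_def y_def[abs_def] N_def)
        have ind: "block_ind_law \<Omega> S X n s b = PiM {1..N b} (\<lambda>i. R (block_index s b i))"
          by (simp add: block_ind_law_def R_def N_def)
        note * = block_expectation_le[OF model(2,3) Q repr D_bound D_ge[OF Npos[OF b]] Npos[OF b] R[OF idx[OF b]] Pb[OF b]
            \<Omega>.prob_space_distr[OF ym[OF b]] sets_distr \<kappa>[OF b, unfolded law ind]]
        have fm: "(\<lambda>z. \<Sum>i=1..N b. hellinger_sq (R (block_index s b i)) (Pb b z)) \<in> borel_measurable (PiM {1..N b} (\<lambda>_. S))"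
          using *(1) by simp
        show "(\<lambda>\<omega>. Ab b \<omega>) \<in> borel_measurable \<Omega>"
          unfolding Ab_def using measurable_compose[OF ym[OF b] fm] .
        show "\<bar>Ab b \<omega>\<bar> \<le> real (N b)" if "\<omega> \<in> space \<Omega>" for \<omega>
          unfolding Ab_def using *(2)[of "y b \<omega>"] measurable_space[OF ym[OF b] that] by simp
        show "(\<integral>\<omega>. Ab b \<omega> \<partial>\<Omega>) \<le> 128 * Hb b + 3000 * \<kappa> b + 900 * D (N b) + 11300"
          using *(3) unfolding integral_distr[OF ym[OF b] fm] Ab_def Hb_def .
        show "0 \<le> \<kappa> b" by (rule *(4))
      qed
      then show "0 \<le> (\<Sum>b=1..s+1. \<kappa> b)" by (intro sum_nonneg)
      have "(\<Sum>b=1..s+1. \<integral>\<omega>. Ab b \<omega> \<partial>\<Omega>) \<le> (\<Sum>b=1..s+1. 128 * Hb b + 3000 * \<kappa> b + (900 * D (N 1) + 11300))"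
      proof (rule sum_mono)
        fix b assume b: "b \<in> ?B"
        have "N b \<le> N 1" unfolding N_def block_size_def using b by (intro div_le_mono) auto
        then have "D (N b) \<le> D (N 1)"
          using Npos[OF b] Npos[of 1] by (intro mono_onD[OF D_mono]) auto
        then show "(\<integral>\<omega>. Ab b \<omega> \<partial>\<Omega>) \<le> 128 * Hb b + 3000 * \<kappa> b + (900 * D (N 1) + 11300)"
          using bl(3)[OF b] by linarith
      qed
      also have "\<dots> = 128 * (\<Sum>i=1..n. hellinger_sq (R i) Q) + 3000 * (\<Sum>b=1..s+1. \<kappa> b)
          + (real s + 1) * (900 * D (N 1) + 11300)"
        unfolding sum.distrib sum_distrib_left[symmetric] Hsum by (simp add: algebra_simps)
      finally show "(\<Sum>b=1..s+1. \<integral>\<omega>. Ab b \<omega> \<partial>\<Omega>) \<le> 128 * (\<Sum>i=1..n. hellinger_sq (R i) Q) + 3000 * (\<Sum>b=1..s+1. \<kappa> b)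
          + (real s + 1) * (900 * D (N 1) + 11300)" .
      \<comment> \<open>The path goes from \<open>R\<close> to \<open>P\<^sub>s\<close> through the
        block estimators, with \<open>t = 1\<close>, then from these to \<open>Q\<close> through
        \<open>R\<close>, with \<open>t = 1/10\<close>. The small \<open>t\<close> keeps the
        multiple of \<open>Ab\<close> low, since its mean alone costs \<open>128\<close> times the
        distance to \<open>Q\<close>: in the end \<open>4.2 = 2 + 2 * 1.1\<close> and
        \<open>22 = 2 * 11\<close>.\<close>
      have pw: "L \<omega> \<le> 4.2 * (\<Sum>b=1..s+1. Ab b \<omega>) + 22 * (\<Sum>i=1..n. hellinger_sq (R i) Q) + 2 * \<iota>"
        if \<omega>: "\<omega> \<in> space \<Omega>" for \<omega>
      proof -
        have xs: "x \<omega> \<in> space (PiM {1..n} (\<lambda>_. S))" using measurable_space[OF xm \<omega>] .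
        have PsS: "P\<^sub>s (x \<omega>) \<in> space (prob_algebra S)" using Ps[OF xs] model by auto
        have PbS: "Pb b (y b \<omega>) \<in> space (prob_algebra S)" if "b \<in> ?B" for b
          using Pb[OF that] measurable_space[OF ym[OF that] \<omega>]
          unfolding rho_estimator_def space_hellinger_borel[symmetric] by (auto intro: measurable_space)
        let ?G = "\<lambda>Q. \<Sum>b=1..s+1. real (N b) * hellinger_sq (Pb b (y b \<omega>)) Q"
        have Gx: "(\<Sum>b=1..s+1. real (N b) * (hellinger (Pb b (block n s b (x \<omega>))) Q)\<^sup>2) = ?G Q" for Q
          using yx by (intro sum.cong) auto
        have "L \<omega> = (\<Sum>b=1..s+1. \<Sum>i=1..N b. hellinger_sq (R (block_index s b i)) (P\<^sub>s (x \<omega>)))"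
          unfolding L_def N_def by (rule sum_blocks[OF sn, symmetric])
        also have "\<dots> \<le> (\<Sum>b=1..s+1. \<Sum>i=1..N b. 2 * hellinger_sq (R (block_index s b i)) (Pb b (y b \<omega>))
            + 2 * hellinger_sq (Pb b (y b \<omega>)) (P\<^sub>s (x \<omega>)))"
        proof (intro sum_mono)
          fix b i assume "b \<in> ?B" "i \<in> {1..N b}"
          then show "hellinger_sq (R (block_index s b i)) (P\<^sub>s (x \<omega>)) \<le> 2 * hellinger_sq (R (block_index s b i)) (Pb b (y b \<omega>))
            + 2 * hellinger_sq (Pb b (y b \<omega>)) (P\<^sub>s (x \<omega>))"
            using hellinger_sq_young[OF R[OF idx] PbS PsS, of b i b 1] by simp
        qed
        also have "\<dots> = 2 * (\<Sum>b=1..s+1. Ab b \<omega>) + 2 * ?G (P\<^sub>s (x \<omega>))"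
          unfolding Ab_def sum.distrib sum_distrib_left by (simp add: mult.left_commute)
        also have "?G (P\<^sub>s (x \<omega>)) \<le> (INF Q\<in>\<PP>. ?G Q) + \<iota>"
          using opt[OF xs] unfolding Gx .
        also have "(INF Q\<in>\<PP>. ?G Q) \<le> ?G Q"
          by (intro cINF_lower[OF _ Q] bdd_belowI2[where m = 0] sum_nonneg mult_nonneg_nonneg) simp_all
        also have "?G Q \<le> (\<Sum>b=1..s+1. 1.1 * Ab b \<omega> + 11 * Hb b)"
        proof (rule sum_mono)
          fix b assume b: "b \<in> ?B"
          have "real (N b) * hellinger_sq (Pb b (y b \<omega>)) Q = (\<Sum>i=1..N b. hellinger_sq (Pb b (y b \<omega>)) Q)" by simp
          also have "\<dots> \<le> (\<Sum>i=1..N b. 1.1 * hellinger_sq (R (block_index s b i)) (Pb b (y b \<omega>))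
              + 11 * hellinger_sq (R (block_index s b i)) Q)"
          proof (rule sum_mono)
            fix i assume i: "i \<in> {1..N b}"
            show "hellinger_sq (Pb b (y b \<omega>)) Q \<le> 1.1 * hellinger_sq (R (block_index s b i)) (Pb b (y b \<omega>))
              + 11 * hellinger_sq (R (block_index s b i)) Q"
              using hellinger_sq_young[OF PbS[OF b] R[OF idx[OF b i]] QS, of "1/10"]
              by (simp add: hellinger_sq_commute)
          qed
          also have "\<dots> = 1.1 * Ab b \<omega> + 11 * Hb b"
            unfolding Ab_def Hb_def sum.distrib sum_distrib_left ..
          finally show "real (N b) * hellinger_sq (Pb b (y b \<omega>)) Q \<le> 1.1 * Ab b \<omega> + 11 * Hb b" .
        qed
        also have "\<dots> = 1.1 * (\<Sum>b=1..s+1. Ab b \<omega>) + 11 * (\<Sum>i=1..n. hellinger_sq (R i) Q)"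
          unfolding sum.distrib sum_distrib_left[symmetric] Hsum ..
        finally have le: "L \<omega> \<le> 2 * (\<Sum>b=1..s+1. Ab b \<omega>)
            + 2 * (1.1 * (\<Sum>b=1..s+1. Ab b \<omega>) + 11 * (\<Sum>i=1..n. hellinger_sq (R i) Q) + \<iota>)"
          by simp
        have "2 * a + 2 * (1.1 * a + 11 * h + \<iota>) = 4.2 * a + 22 * h + 2 * \<iota>" for a h :: real
          by (simp add: field_simps)
        from le[unfolded this] show ?thesis .
      qed
      have AI: "integrable \<Omega> (Ab b)" if "b \<in> ?B" for b
        using bl(1,2)[OF that] by (rule \<Omega>.integrable_bounded)
      have LI: "integrable \<Omega> L"
      proof (rule \<Omega>.integrable_bounded[OF Lm])
        fix \<omega> assume \<omega>: "\<omega> \<in> space \<Omega>"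
        have "P\<^sub>s (x \<omega>) \<in> space (prob_algebra S)" using Ps[OF measurable_space[OF xm \<omega>]] model by auto
        then have "L \<omega> \<le> (\<Sum>i=1..n. 1)"
          unfolding L_def using R by (intro sum_mono hellinger_sq_le_1) auto
        moreover have "0 \<le> L \<omega>" unfolding L_def by (intro sum_nonneg) auto
        ultimately show "\<bar>L \<omega>\<bar> \<le> real n" by simp
      qed
      have AsI: "integrable \<Omega> (\<lambda>\<omega>. \<Sum>b=1..s+1. Ab b \<omega>)" using AI by (intro Bochner_Integration.integrable_sum)
      have "(\<integral>\<omega>. L \<omega> \<partial>\<Omega>) \<le> (\<integral>\<omega>. 4.2 * (\<Sum>b=1..s+1. Ab b \<omega>) + 22 * (\<Sum>i=1..n. hellinger_sq (R i) Q) + 2 * \<iota> \<partial>\<Omega>)"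
        by (intro integral_mono LI pw Bochner_Integration.integrable_add integrable_mult_right AsI \<Omega>.integrable_const)
      also have "\<dots> = 4.2 * (\<integral>\<omega>. (\<Sum>b=1..s+1. Ab b \<omega>) \<partial>\<Omega>) + 22 * (\<Sum>i=1..n. hellinger_sq (R i) Q) + 2 * \<iota>"
        using AsI by (simp add: \<Omega>.prob_space del: One_nat_def)
      also have "(\<integral>\<omega>. (\<Sum>b=1..s+1. Ab b \<omega>) \<partial>\<Omega>) = (\<Sum>b=1..s+1. \<integral>\<omega>. Ab b \<omega> \<partial>\<Omega>)"
        using AI by (intro Bochner_Integration.integral_sum)
      finally show "real n * (1 / real n * (\<integral>\<omega>. L \<omega> \<partial>\<Omega>))
        \<le> 4.2 * (\<Sum>b=1..s+1. \<integral>\<omega>. Ab b \<omega> \<partial>\<Omega>) + 22 * (\<Sum>i=1..n. hellinger_sq (R i) Q) + 2 * \<iota>"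
        using n0 by simp
    qed
    let ?l = "1 / real n * (\<integral>\<omega>. L \<omega> \<partial>\<Omega>)"
    let ?r = "20056 / 4.7 * ((real s + 1) / real n) * (17 + D (N 1)) + 30084 / real n * (\<Sum>b=1..s+1. \<kappa> b)"
    have le: "?l \<le> 602 / real n * (\<Sum>i=1..n. hellinger_sq (R i) Q) + ?r" if "Q \<in> \<PP>" for Q
    proof -
      have "0 \<le> (\<Sum>i=1..n. hellinger_sq (R i) Q)" by (intro sum_nonneg) auto
      from risk_bound_arith[OF main[OF that] block[OF that] iota(2) this \<kappa>0[OF that] _ D_ge[OF Npos[of 1]] n0]
      show ?thesis by simp
    qed
    \<comment> \<open>Rearranged so that the bare sum of distances is bounded below for every
      \<open>Q\<close>, which passes to the infimum.\<close>
    have "(?l - ?r) * (real n / 602) \<le> (INF Q\<in>\<PP>. \<Sum>i=1..n. hellinger_sq (R i) Q)"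
    proof (rule cINF_greatest[OF model(1)])
      fix Q assume "Q \<in> \<PP>"
      then have "(?l - ?r) * (real n / 602) \<le> (602 / real n * (\<Sum>i=1..n. hellinger_sq (R i) Q)) * (real n / 602)"
        using le n0 by (intro mult_right_mono) (auto simp: diff_le_eq)
      then show "(?l - ?r) * (real n / 602) \<le> (\<Sum>i=1..n. hellinger_sq (R i) Q)" using n0 by simp
    qed
    then have "(602 / real n) * ((?l - ?r) * (real n / 602)) \<le> 602 / real n * (INF Q\<in>\<PP>. \<Sum>i=1..n. hellinger_sq (R i) Q)"
      using n0 by (intro mult_left_mono) auto
    moreover have "(602 / real n) * ((?l - ?r) * (real n / 602)) = ?l - ?r" using n0 by simp
    ultimately have "?l \<le> 602 / real n * (INF Q\<in>\<PP>. \<Sum>i=1..n. hellinger_sq (R i) Q) + ?r" by linarith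
    then show ?thesis
      unfolding lhs KLsum unfolding R_def[symmetric] N_def[symmetric] hellinger_power2
      by (simp only: plus_ereal.simps(1) times_ereal.simps(1) ereal_less_eq(3) add.assoc)
  qed
qed

end
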